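(* Let $2\le m\le n$, $n_1+\dots+n_m=n$ with $n_i\ge1$, and consider the control system $$\dot z^i=A_iz^i+b_{0i}H_i(z,u),\qquad z^i\in\mathbb R^{n_i},\quad i=1,\dots,m,\quad u\in\mathbb R,$$ where $z=(z^1,\dots,z^m)\in\mathbb R^n$, $A_i$ is the $n_i\times n_i$ matrix with ones on the first superdiagonal and zeros elsewhere, $b_{0i}=(0,\dots,0,1)^*\in\mathbb R^{n_i}$, and $H_1,\dots,H_m:\mathbb R^n\times\mathbb R\to\mathbb R$ are continuously differentiable with $H_i(0,0)=0$. Fix $i\in\{1,\dots,m\}$ and a number $d_i>0$, and let $N_i$, $a_{0i}$, $\Theta_i$ be as in the context. Suppose there exist two functions $u^+(z)$, $u^-(z)$ which satisfy the Lipschitz condition in each set $K(\rho_1,\rho_2)=\{z:0<\rho_1\le\|z\|\le\rho_2\}$ and satisfy the inequalities $$H_i(z,u^+(z))\ge d_i,\qquad H_i(z,u^-(z))\le-d_i.$$ Then the control $u(z)$ of the form $$u(z)=\begin{cases}u^-(z),& z\in S^+,\\ u^+(z),& z\in S^-,\\ u^0(z)\in[u^-(z),u^+(z)],& z\in S,\end{cases}$$ where $S^+=\{z\in\mathbb R^n: b_{0i}^*N_i^{-1}(\Theta_i(z^i))z^i>0\}$, $S^-=\{z\in\mathbb R^n: b_{0i}^*N_i^{-1}(\Theta_i(z^i))z^i<0\}$, $S=\{z\in\mathbb R^n: b_{0i}^*N_i^{-1}(\Theta_i(z^i))z^i=0\}$, transfers any point $z_0=(z_0^1,\dots,z_0^{i-1},z_0^i,z_0^{i+1},\dots,z_0^m)^*$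 to a point $z_T=(z_T^1,\dots,z_T^{i-1},0^i,z_T^{i+1},\dots,z_T^m)^*$ along a trajectory of the system in a certain finite time $T(z_0^i)\le\Theta_i(z_0^i)$.
   Context: $^*$ denotes transposition and $0^i$ is the zero of $\mathbb R^{n_i}$. For $\Theta>0$, $N_i(\Theta)=\int_0^\Theta\left(1-\frac t\Theta\right)e^{-A_it}b_{0i}b_{0i}^*e^{-A_i^*t}\,dt$, a nonsingular $n_i\times n_i$ matrix. The number $a_{0i}$ is chosen with $0<a_{0i}\le 2d_i^2/(N_i^{-1}(1)b_{0i},b_{0i})$. The controllability function $\Theta_i(z^i)$ is the unique positive solution $\Theta$ of $2a_{0i}\Theta=(N_i^{-1}(\Theta)z^i,z^i)$ for $z^i\ne0^i$, and $\Theta_i(0^i)=0$. Solutions of the closed-loop system are understood in the sense of differential inclusions (Filippov).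
   Formalization: Existence of a trajectory reaching z^i=0 is proved assuming no solution from z_0 blows up in finite time while z^i≠0 (otherwise false: H_1=u, H_2=z_2^2); every trajectory existing on [0,Θ_i] reaches it. At the arrival time only continuity of the trajectory is required. *)

theory Defs
  imports "HOL-Analysis.Analysis"
begin

text \<open>
  Encoding of \<open>z = (z\<^sup>1, \<dots>, z\<^sup>m)\<close>. The state space is \<open>real ^ 'n\<close>, and \<open>coord j k\<close> is the
  element of \<open>'n\<close> that indexes the \<open>k\<close>-th coordinate of the block \<open>z\<^sup>j\<close>, for \<open>1 \<le> j \<le> m\<close> and
  \<open>1 \<le> k \<le> n\<^sub>j\<close>. It is a bijection from these pairs onto \<open>'n\<close>, so that
  \<open>CARD('n) = n\<^sub>1 + \<dots> + n\<^sub>m\<close>.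
  The distinguished block \<open>z\<^sup>i\<close> is a vector in \<open>real ^ 'k\<close>, and \<open>pos\<close> is a bijection from \<open>'k\<close>
  onto \<open>{1..n\<^sub>i}\<close> which gives the rank of an index: it says which row of \<open>A\<^sub>i\<close> is the first one,
  which is the second one, and so on.
\<close>

definition block_indices :: "nat \<Rightarrow> (nat \<Rightarrow> nat) \<Rightarrow> (nat \<times> nat) set" where
  "block_indices m ns = (SIGMA j:{1..m}. {1..ns j})"

definition block :: "(nat \<Rightarrow> nat \<Rightarrow> 'n) \<Rightarrow> ('k \<Rightarrow> nat) \<Rightarrow> nat \<Rightarrow> real ^ 'n::finite \<Rightarrow> real ^ 'k::finite"
  where "block coord pos i z = (\<chi> p. z $ coord i (pos p))"

definition superdiag :: "('k \<Rightarrow> nat) \<Rightarrow> real ^ 'k::finite ^ 'k" where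
  "superdiag pos = (\<chi> p q. if pos q = pos p + 1 then 1 else 0)"

definition last_unit :: "('k \<Rightarrow> nat) \<Rightarrow> real ^ 'k::finite" where
  "last_unit pos = (\<chi> p. if pos p = CARD('k) then 1 else 0)"

text \<open>The right-hand side of all the subsystems \<open>A\<^sub>j z\<^sup>j + b\<^sub>0\<^sub>j H\<^sub>j(z,u)\<close>, written out by coordinates.\<close>

definition system_rhs ::
    "nat \<Rightarrow> (nat \<Rightarrow> nat) \<Rightarrow> (nat \<Rightarrow> nat \<Rightarrow> 'n) \<Rightarrow> (nat \<Rightarrow> real ^ 'n \<Rightarrow> real \<Rightarrow> real)
      \<Rightarrow> real ^ 'n::finite \<Rightarrow> real \<Rightarrow> real ^ 'n" where
  "system_rhs m ns coord H z u =
     (\<chi> p. case inv_into (block_indices m ns) (\<lambda>(j, k). coord j k) p of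
             (j, k) \<Rightarrow> if k < ns j then z $ coord j (k + 1) else H j z u)"

lemma block_system_rhs:
  assumes coord: "bij_betw (\<lambda>(j, k). coord j k) (block_indices m ns) (UNIV :: 'n::finite set)"
    and pos: "bij_betw pos (UNIV :: 'k::finite set) {1..ns i}"
    and i: "i \<in> {1..m}"
  shows "block coord pos i (system_rhs m ns coord H z u) =
           superdiag pos *v block coord pos i z + H i z u *\<^sub>R last_unit pos"
proof -
  have card: "CARD('k) = ns i"
    using bij_betw_same_card[OF pos] by simp
  have inj: "pos q = pos q' \<longleftrightarrow> q = q'" for q q'
    using pos by (auto simp: bij_betw_def inj_on_def)
  have rng: "pos p \<in> {1..ns i}" for p
    using pos by (auto simp: bij_betw_def)
  have inv: "inv_into (block_indices m ns) (\<lambda>(j, k). coord j k) (coord i (pos p)) = (i, pos p)" for p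
    using inv_into_f_f[OF bij_betw_imp_inj_on[OF coord], of "(i, pos p)"] i rng[of p]
    by (auto simp: block_indices_def)
  have sum: "(\<Sum>q\<in>UNIV. (if pos q = pos p + 1 then 1 else 0) * z $ coord i (pos q)) =
      (if pos p < ns i then z $ coord i (pos p + 1) else 0)" for p
  proof (cases "pos p < ns i")
    case True
    then have "pos p + 1 \<in> pos ` UNIV"
      using pos by (auto simp: bij_betw_def)
    then obtain q0 where q0: "pos q0 = pos p + 1" by force
    have "(\<Sum>q\<in>UNIV. (if pos q = pos p + 1 then 1 else 0) * z $ coord i (pos q)) =
        (\<Sum>q\<in>UNIV. if q = q0 then z $ coord i (pos p + 1) else 0)"
    proof (rule sum.cong)
      fix q
      show "(if pos q = pos p + 1 then 1 else 0) * z $ coord i (pos q) =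
          (if q = q0 then z $ coord i (pos p + 1) else 0)"
        using q0 inj[of q q0] by (cases "q = q0") auto
    qed simp
    then show ?thesis using True by simp
  next
    case False
    have "pos q \<noteq> pos p + 1" for q
      using rng[of q] False by auto
    then show ?thesis using False by simp
  qed
  have "pos p = ns i" if "\<not> pos p < ns i" for p
    using rng[of p] that by auto
  then show ?thesis
    by (auto simp: vec_eq_iff block_def system_rhs_def superdiag_def last_unit_def
        matrix_vector_mult_def inv card sum[unfolded Suc_eq_plus1[symmetric]])
qed

definition matrix_exp :: "real ^ 'k::finite ^ 'k \<Rightarrow> real ^ 'k ^ 'k" where
  "matrix_exp M = (\<Sum>l. (1 / fact l) *\<^sub>R (((**) M ^^ l) (mat 1)))"

definition gram :: "('k \<Rightarrow> nat) \<Rightarrow> real \<Rightarrow> real ^ 'k::finite ^ 'k" where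
  "gram pos \<Theta> = integral {0..\<Theta>} (\<lambda>t. (1 - t / \<Theta>) *\<^sub>R
     (matrix_exp (- t *\<^sub>R superdiag pos)
       ** ((columnvector (last_unit pos) :: real ^ 1 ^ 'k) ** rowvector (last_unit pos))
       ** matrix_exp (- t *\<^sub>R transpose (superdiag pos))))"

definition controllability_fun :: "('k \<Rightarrow> nat) \<Rightarrow> real \<Rightarrow> real ^ 'k::finite \<Rightarrow> real" where
  "controllability_fun pos a0 y =
     (if y = 0 then 0
      else (THE \<Theta>. 0 < \<Theta> \<and> 2 * a0 * \<Theta> = (matrix_inv (gram pos \<Theta>) *v y) \<bullet> y))"

text \<open>The sign of this function decides between \<open>S\<^sup>+\<close>, \<open>S\<^sup>-\<close> and \<open>S\<close>. It vanishes where \<open>z\<^sup>i = 0\<close>,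
  whatever \<open>matrix_inv\<close> yields for the singular matrix \<open>gram pos 0\<close>.\<close>

definition switching_fun :: "('k \<Rightarrow> nat) \<Rightarrow> real \<Rightarrow> real ^ 'k::finite \<Rightarrow> real" where
  "switching_fun pos a0 y =
     last_unit pos \<bullet> (matrix_inv (gram pos (controllability_fun pos a0 y)) *v y)"

definition continuously_differentiable :: "('a::euclidean_space \<Rightarrow> real) \<Rightarrow> bool" where
  "continuously_differentiable h \<longleftrightarrow>
     (\<exists>h' :: 'a \<Rightarrow> 'a \<Rightarrow>\<^sub>L real.
        (\<forall>w. (h has_derivative blinfun_apply (h' w)) (at w)) \<and> continuous_on UNIV h')"

definition lipschitz_on_annuli :: "('a::euclidean_space \<Rightarrow> real) \<Rightarrow> bool" where
  "lipschitz_on_annuli w \<longleftrightarrow>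
     (\<forall>\<rho>1 \<rho>2. 0 < \<rho>1 \<and> \<rho>1 \<le> \<rho>2 \<longrightarrow>
        (\<exists>L. L-lipschitz_on {z. \<rho>1 \<le> norm z \<and> norm z \<le> \<rho>2} w))"

text \<open>The Filippov regularisation of a vector field, and the solutions on \<open>[0,\<tau>)\<close> of the
  resulting differential inclusion: locally absolutely continuous functions whose derivative lies
  in the regularisation almost everywhere. Absolute continuity is expressed by saying that \<open>x\<close> is
  an indefinite Lebesgue integral; the integrand \<open>v\<close> is then the derivative of \<open>x\<close> almost
  everywhere.\<close>

definition filippov :: "('a::euclidean_space \<Rightarrow> 'a) \<Rightarrow> 'a \<Rightarrow> 'a set" where
  "filippov f z = (\<Inter>\<delta>\<in>{0<..}. \<Inter>N\<in>{N. negligible N}. closure (convex hull (f ` (ball z \<delta> - N))))"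

definition filippov_solution :: "('a::euclidean_space \<Rightarrow> 'a) \<Rightarrow> real \<Rightarrow> (real \<Rightarrow> 'a) \<Rightarrow> bool" where
  "filippov_solution f \<tau> x \<longleftrightarrow>
     (\<exists>v. (\<forall>t\<in>{0..<\<tau>}. v absolutely_integrable_on {0..t} \<and> x t = x 0 + integral {0..t} v) \<and>
          (AE t in lebesgue. t \<in> {0..<\<tau>} \<longrightarrow> v t \<in> filippov f (x t)))"

text \<open>A trajectory on \<open>[0,T]\<close> is a solution on \<open>[0,T)\<close> that extends continuously to \<open>T\<close>. Integrability
  of the velocity up to \<open>T\<close> is not asked for: the feedbacks \<open>u\<^sup>+\<close> and \<open>u\<^sup>-\<close> may be unbounded near
  the origin, so it can fail when the trajectory arrives at \<open>z = 0\<close> at time \<open>T\<close>.\<close>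

definition filippov_trajectory :: "('a::euclidean_space \<Rightarrow> 'a) \<Rightarrow> real \<Rightarrow> (real \<Rightarrow> 'a) \<Rightarrow> bool" where
  "filippov_trajectory f T x \<longleftrightarrow> filippov_solution f T x \<and> continuous_on {0..T} x"

text \<open>No solution from \<open>z0\<close> escapes to infinity in finite time while it is off the target set
  \<open>P = 0\<close>. Without such a condition there need not be a trajectory that reaches the target: for
  \<open>m = 2\<close>, \<open>n\<^sub>1 = n\<^sub>2 = 1\<close>, \<open>i = 1\<close>, coordinates \<open>z = (p, q)\<close>, \<open>H\<^sub>1(z,u) = u\<close>, \<open>H\<^sub>2(z,u) = q\<^sup>2\<close>
  and \<open>u\<^sup>+ = 1\<close>, \<open>u\<^sup>- = -1\<close>, the coordinate \<open>p\<close> needs the time \<open>\<bar>p(0)\<bar>\<close> to vanish, while \<open>q\<close> blows up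
  at the time \<open>1 / q(0)\<close>, which can be smaller.\<close>

definition no_escape_off_target ::
    "('a::euclidean_space \<Rightarrow> 'a) \<Rightarrow> ('a \<Rightarrow> 'b::real_vector) \<Rightarrow> 'a \<Rightarrow> bool" where
  "no_escape_off_target f P z0 \<longleftrightarrow>
     (\<forall>\<tau> x. filippov_solution f \<tau> x \<and> x 0 = z0 \<and> (\<forall>t\<in>{0..<\<tau>}. P (x t) \<noteq> 0)
        \<longrightarrow> bounded (x ` {0..<\<tau>}))"

end

theory Submission
  imports Defs
begin

text \<open>
  Write \<open>y\<close> for the controlled block, \<open>w = N(\<Theta>)\<^sup>-\<^sup>1 y\<close> with \<open>\<Theta> = \<Theta>(y)\<close>, and \<open>h\<close> for the value of the
  input \<open>H\<^sub>i\<close>. Differentiating \<open>2 a\<^sub>0 \<Theta> = (N(\<Theta>)\<^sup>-\<^sup>1 y, y)\<close> along \<open>y' = A y + b h\<close> and using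
  \<open>A N + N A\<^sup>* = b b\<^sup>* - N / \<Theta> - N'\<close> gives
  \<open>(2 a\<^sub>0 + (N' w, w)) (\<Theta>' + 1) = (b, w) ((b, w) + 2 h)\<close>. The choice of \<open>a\<^sub>0\<close> and the Cauchy-Schwarz
  inequality give \<open>\<bar>(b, w)\<bar> \<le> 2 d\<close>, so that \<open>\<Theta>' \<le> -1\<close> as soon as \<open>h \<le> -d\<close> where \<open>(b, w) > 0\<close> and
  \<open>h \<ge> d\<close> where \<open>(b, w) < 0\<close>; on the switching surface the value of \<open>h\<close> does not matter. This bounds
  the time during which a solution can stay off the target.

  Existence: Euler polygons with velocities in the Filippov set have a cluster point, Zorn's lemma
  yields a maximal solution off the target, and as the right-hand side is bounded near every point
  other than \<open>0\<close>, a bounded solution has a limit at its final time, which can only lie in the target.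
\<close>

section \<open>Differentiation of Lipschitz curves\<close>

text \<open>A pointwise limit of Euler polygons carries no velocity. The constructions therefore
  work with conditions on increments alone: near a time \<open>t\<close>, every half-space that
  contains the regularisation at \<open>x t\<close> bounds the difference quotients. Such conditions
  are local in time and survive pointwise limits; the velocity is recovered only at the end, as a
  limit of dyadic difference quotients.

  The Gram matrix is handled through its homogeneity. With weights \<open>deg\<close> counted from
  the last coordinate, N(\<Theta>) = \<Theta> S C S, where C = N(1) and S is the diagonal matrix of
  the powers \<open>\<Theta> ^ deg p\<close>. Positivity and the Lyapunov identity are thus needed
  only at \<Theta> = 1, where C consists, up to the factors \<open>cf\<close>, of the moments of the
  weight 1 - t.

  The origin is the only point near which the feedback may be unbounded. It belongs to the target,
  so local existence and continuation are needed only away from it.\<close>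

definition dyadic_quotient :: "(real \<Rightarrow> 'a::real_vector) \<Rightarrow> nat \<Rightarrow> real \<Rightarrow> 'a" where
  "dyadic_quotient x n t =
     2 ^ n *\<^sub>R (x ((of_int \<lfloor>2 ^ n * t\<rfloor> + 1) / 2 ^ n) - x (of_int \<lfloor>2 ^ n * t\<rfloor> / 2 ^ n))"

lemma dyadic_quotient_cell:
  assumes "real k / 2 ^ n < t" "t < (real k + 1) / 2 ^ n"
  shows "dyadic_quotient x n t = 2 ^ n *\<^sub>R (x ((real k + 1) / 2 ^ n) - x (real k / 2 ^ n))"
proof -
  have "\<lfloor>2 ^ n * t\<rfloor> = int k"
    using assms by (intro floor_unique) (auto simp: field_simps)
  then show ?thesis by (simp add: dyadic_quotient_def)
qed

lemma has_integral_dyadic_cells: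
  fixes g :: "real \<Rightarrow> 'b::euclidean_space"
  assumes "\<And>k. k < j \<Longrightarrow> (g has_integral c k) {real k / 2 ^ n .. (real k + 1) / 2 ^ n}"
  shows "(g has_integral (\<Sum>k<j. c k)) {0 .. real j / 2 ^ n}"
  using assms
proof (induction j)
  case 0
  then show ?case using has_integral_refl(2)[of g 0] by simp
next
  case (Suc j)
  have "(g has_integral (\<Sum>k<j. c k) + c j) {0 .. (real j + 1) / 2 ^ n}"
    by (rule has_integral_combine[OF _ _ Suc.IH Suc.prems[of j]])
       (simp_all add: Suc.prems divide_right_mono)
  then show ?case by (simp add: add.commute)
qed

lemma has_integral_dyadic_quotient_cell:
  fixes x :: "real \<Rightarrow> 'a::euclidean_space"
  shows "(dyadic_quotient x n has_integral x ((real k + 1) / 2 ^ n) - x (real k / 2 ^ n))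
           {real k / 2 ^ n .. (real k + 1) / 2 ^ n}"
proof -
  let ?c = "x ((real k + 1) / 2 ^ n) - x (real k / 2 ^ n)"
  have "(real k + 1) / 2 ^ n - real k / 2 ^ n = 1 / 2 ^ n"
    by (simp flip: diff_divide_distrib)
  then have *: "((\<lambda>_. 2 ^ n *\<^sub>R ?c) has_integral ?c) (cbox (real k / 2 ^ n) ((real k + 1) / 2 ^ n))"
    using has_integral_const_real[of "2 ^ n *\<^sub>R ?c" "real k / 2 ^ n" "(real k + 1) / 2 ^ n"]
    by (simp add: divide_right_mono)
  show ?thesis
    unfolding interval_cbox
    by (rule has_integral_spike_interior[OF * dyadic_quotient_cell]) auto
qed

lemma has_integral_dyadic_quotient_grid:
  fixes x :: "real \<Rightarrow> 'a::euclidean_space"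
  shows "(dyadic_quotient x n has_integral x (real j / 2 ^ n) - x 0) {0 .. real j / 2 ^ n}"
proof -
  have "(\<Sum>k<j. x ((real k + 1) / 2 ^ n) - x (real k / 2 ^ n)) = x (real j / 2 ^ n) - x 0"
    using sum_lessThan_telescope[of "\<lambda>k. x (real k / 2 ^ n)" j] by (simp add: add.commute)
  moreover have "(dyadic_quotient x n has_integral
      (\<Sum>k<j. x ((real k + 1) / 2 ^ n) - x (real k / 2 ^ n))) {0 .. real j / 2 ^ n}"
    by (rule has_integral_dyadic_cells[OF has_integral_dyadic_quotient_cell])
  ultimately show ?thesis by simp
qed

lemma has_integral_dyadic_quotient:
  fixes x :: "real \<Rightarrow> 'a::euclidean_space"
  assumes "i \<le> j"
  shows "(dyadic_quotient x n has_integral x (real j / 2 ^ n) - x (real i / 2 ^ n))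
           {real i / 2 ^ n .. real j / 2 ^ n}"
proof -
  let ?D = "dyadic_quotient x n"
  have sub: "{real i / 2 ^ n .. real j / 2 ^ n} \<subseteq> {0 .. real j / 2 ^ n}"
    by (auto intro: order_trans[of 0 "real i / 2 ^ n"])
  have int: "?D integrable_on {real i / 2 ^ n .. real j / 2 ^ n}"
    using integrable_on_subinterval[OF _ sub] has_integral_dyadic_quotient_grid[of x n j] by blast
  then have "(?D has_integral (x (real i / 2 ^ n) - x 0) + integral {real i / 2 ^ n .. real j / 2 ^ n} ?D) {0 .. real j / 2 ^ n}"
    using assms
    by (intro has_integral_combine[OF _ _ has_integral_dyadic_quotient_grid integrable_integral])
       (simp_all add: divide_right_mono)
  from has_integral_unique[OF this has_integral_dyadic_quotient_grid]
  have "integral {real i / 2 ^ n .. real j / 2 ^ n} ?D = x (real j / 2 ^ n) - x (real i / 2 ^ n)"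
    by (simp add: algebra_simps)
  with int show ?thesis using has_integral_integral by metis
qed

text \<open>The martingale property: on a cell of level \<open>n\<close> the quotient of a finer level \<open>m\<close> averages to
  the quotient of level \<open>n\<close>.\<close>

lemma has_integral_dyadic_quotient_inner:
  fixes x :: "real \<Rightarrow> 'a::euclidean_space"
  assumes "n \<le> m"
  shows "((\<lambda>t. dyadic_quotient x m t \<bullet> dyadic_quotient x n t) has_integral
     (\<Sum>k<j. 2 ^ n * (norm (x ((real k + 1) / 2 ^ n) - x (real k / 2 ^ n)))\<^sup>2)) {0 .. real j / 2 ^ n}"
proof (rule has_integral_dyadic_cells)
  fix k
  let ?a = "real k / 2 ^ n" and ?b = "(real k + 1) / 2 ^ n"
  let ?c = "x ?b - x ?a"
  have "(2::real) ^ m = 2 ^ n * 2 ^ (m - n)"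
    using assms by (simp flip: power_add)
  then have ab: "?a = real (k * 2 ^ (m - n)) / 2 ^ m" "?b = real ((k + 1) * 2 ^ (m - n)) / 2 ^ m"
    by (simp_all only: of_nat_mult of_nat_add of_nat_1 of_nat_power of_nat_numeral
        mult_divide_mult_cancel_right[OF power_not_zero[OF zero_neq_numeral[symmetric]]])
  have "(dyadic_quotient x m has_integral ?c) {?a..?b}"
    unfolding ab by (rule has_integral_dyadic_quotient) simp
  from has_integral_linear[OF this bounded_linear_inner_left[of "2 ^ n *\<^sub>R ?c"]]
  have *: "((\<lambda>t. dyadic_quotient x m t \<bullet> (2 ^ n *\<^sub>R ?c)) has_integral 2 ^ n * (norm ?c)\<^sup>2) (cbox ?a ?b)"
    by (simp add: o_def power2_norm_eq_inner)
  show "((\<lambda>t. dyadic_quotient x m t \<bullet> dyadic_quotient x n t) has_integral 2 ^ n * (norm ?c)\<^sup>2) {?a..?b}"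
    unfolding interval_cbox
    by (rule has_integral_spike_interior[OF *])
       (auto simp: dyadic_quotient_cell[of k n])
qed

lemma norm_dyadic_quotient_le:
  fixes x :: "real \<Rightarrow> 'a::euclidean_space"
  assumes "L-lipschitz_on UNIV x"
  shows "norm (dyadic_quotient x n t) \<le> L"
proof -
  have "norm (x ((of_int \<lfloor>2 ^ n * t\<rfloor> + 1) / 2 ^ n) - x (of_int \<lfloor>2 ^ n * t\<rfloor> / 2 ^ n)) \<le> L * (1 / 2 ^ n)"
    using lipschitz_onD[OF assms, of "(of_int \<lfloor>2 ^ n * t\<rfloor> + 1) / 2 ^ n" "of_int \<lfloor>2 ^ n * t\<rfloor> / 2 ^ n"]
    by (simp add: dist_norm diff_divide_distrib[symmetric])
  then show ?thesis by (simp add: dyadic_quotient_def pos_le_divide_eq mult.commute)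
qed

lemma borel_measurable_dyadic_quotient:
  fixes x :: "real \<Rightarrow> 'a::euclidean_space"
  assumes "continuous_on UNIV x"
  shows "dyadic_quotient x n \<in> borel_measurable borel"
proof -
  have [measurable]: "x \<in> borel_measurable borel"
    using assms by (rule borel_measurable_continuous_onI)
  show ?thesis
    unfolding dyadic_quotient_def by measurable
qed

text \<open>Up to the last grid point before \<open>t\<close> the integral telescopes exactly; the
  remaining piece of the integral and the remaining increment of \<open>x\<close> are each at most
  \<open>L / 2 ^ n\<close>, whence the factor \<open>2 * L\<close>.\<close>

lemma integral_dyadic_quotient_tendsto:
  fixes x :: "real \<Rightarrow> 'a::euclidean_space"
  assumes L: "L-lipschitz_on UNIV x" and t: "0 \<le> t"
  shows "(\<lambda>n. integral {0..t} (dyadic_quotient x n)) \<longlonglongrightarrow> x t - x 0"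
proof -
  have "0 \<le> L" using lipschitz_on_nonneg[OF L] .
  have bd: "norm (integral {0..t} (dyadic_quotient x n) - (x t - x 0)) \<le> 2 * L * (1 / 2) ^ n" for n
  proof -
    define k where "k = nat \<lfloor>2 ^ n * t\<rfloor>"
    have k: "real k \<le> 2 ^ n * t" "2 ^ n * t < real k + 1"
      using t unfolding k_def by (auto simp: zero_le_mult_iff)
    let ?D = "dyadic_quotient x n" and ?a = "real k / 2 ^ n"
    have a: "0 \<le> ?a" "?a \<le> t" "t \<le> (real k + 1) / 2 ^ n"
      using k by (simp_all add: pos_divide_le_eq pos_le_divide_eq mult.commute)
    have a': "t - ?a \<le> (1 / 2) ^ n"
      using a(3) by (simp add: add_divide_distrib power_divide)
    have int: "?D integrable_on {0..t}"
      using integrable_on_subinterval[of ?D "{0..real (Suc k) / 2 ^ n}" 0 t] has_integral_dyadic_quotient_grid[of x n "Suc k"] a(3)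
      by (auto simp: add.commute)
    have int2: "?D integrable_on {?a..t}"
      using integrable_on_subinterval[OF int] a by auto
    have "integral {0..t} ?D = integral {0..?a} ?D + integral {?a..t} ?D"
      using Henstock_Kurzweil_Integration.integral_combine[OF a(1,2) int] by simp
    moreover have "integral {0..?a} ?D = x ?a - x 0"
      using has_integral_dyadic_quotient_grid by blast
    moreover have "norm (integral {?a..t} ?D) \<le> L * (t - ?a)"
      using integrable_bound[OF \<open>0 \<le> L\<close>, of ?D ?a t] int2 norm_dyadic_quotient_le[OF L] a by simp
    moreover have "norm (x t - x ?a) \<le> L * (t - ?a)"
      using lipschitz_onD[OF L, of t ?a] a by (simp add: dist_norm)
    moreover have "norm (integral {?a..t} ?D - (x t - x ?a)) \<le> norm (integral {?a..t} ?D) + norm (x t - x ?a)"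
      by (rule norm_triangle_ineq4)
    moreover have "L * (t - ?a) \<le> L * (1 / 2) ^ n"
      using \<open>0 \<le> L\<close> a' by (rule mult_left_mono[rotated])
    ultimately show ?thesis by (simp add: algebra_simps)
  qed
  have "(\<lambda>n. 2 * L * (1 / 2) ^ n) \<longlonglongrightarrow> 2 * L * 0"
    by (intro tendsto_intros LIMSEQ_power_zero) auto
  then have "(\<lambda>n. integral {0..t} (dyadic_quotient x n) - (x t - x 0)) \<longlonglongrightarrow> 0"
    by (intro Lim_null_comparison[OF always_eventually[OF allI[OF bd]]]) simp
  then show ?thesis by (simp add: LIM_zero_iff)
qed

lemma absolutely_integrable_dyadic_quotient:
  fixes x :: "real \<Rightarrow> 'a::euclidean_space"
  assumes L: "L-lipschitz_on UNIV x"
  shows "dyadic_quotient x n absolutely_integrable_on {a..b}"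
proof (rule measurable_bounded_by_integrable_imp_absolutely_integrable[where g = "\<lambda>_. L"])
  show "dyadic_quotient x n \<in> borel_measurable (lebesgue_on {a..b})"
    using borel_measurable_dyadic_quotient[OF lipschitz_on_continuous_on[OF L]]
    by (intro measurable_restrict_space1 measurable_completion) simp
qed (auto simp: norm_dyadic_quotient_le[OF L])

text \<open>Pythagoras for a martingale: the finer quotient integrates against the coarser one to
  the coarser energy \<open>E N n\<close>, so the last two terms of the expanded square add up to
  \<open>- E N n\<close>.\<close>

lemma has_integral_dyadic_quotient_diff:
  fixes x :: "real \<Rightarrow> 'a::euclidean_space"
  defines "E \<equiv> \<lambda>N n. \<Sum>k<N * 2 ^ n. 2 ^ n * (norm (x ((real k + 1) / 2 ^ n) - x (real k / 2 ^ n)))\<^sup>2"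
  assumes "n \<le> m"
  shows "((\<lambda>t. (norm (dyadic_quotient x m t - dyadic_quotient x n t))\<^sup>2) has_integral E N m - E N n) {0..real N}"
proof -
  have *: "((\<lambda>t. dyadic_quotient x j t \<bullet> dyadic_quotient x i t) has_integral E N i) {0..real N}" if "i \<le> j" for i j
    using has_integral_dyadic_quotient_inner[OF that, of x "N * 2 ^ i"] unfolding E_def by simp
  have "((\<lambda>t. dyadic_quotient x m t \<bullet> dyadic_quotient x m t - 2 * (dyadic_quotient x m t \<bullet> dyadic_quotient x n t)
      + dyadic_quotient x n t \<bullet> dyadic_quotient x n t) has_integral E N m - 2 * E N n + E N n) {0..real N}"
    by (intro has_integral_add has_integral_diff has_integral_mult_right * order_refl assms)
  then show ?thesis
    by (simp add: power2_norm_eq_inner inner_diff_left inner_diff_right inner_commute algebra_simps)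
qed

text \<open>The energies increase with the level and are bounded by
  \<open>L\<^sup>2 * real N\<close>, hence form a Cauchy sequence; their differences are squared L2
  distances.\<close>

lemma dyadic_quotient_L1_Cauchy:
  fixes x :: "real \<Rightarrow> 'a::euclidean_space"
  assumes L: "L-lipschitz_on UNIV x" and e: "0 < e"
  shows "\<exists>K. \<forall>i\<ge>K. \<forall>j\<ge>K. integral {0..real N} (\<lambda>t. norm (dyadic_quotient x i t - dyadic_quotient x j t)) < e"
proof -
  define E where "E n = (\<Sum>k<N * 2 ^ n. 2 ^ n * (norm (x ((real k + 1) / 2 ^ n) - x (real k / 2 ^ n)))\<^sup>2)" for n :: nat
  let ?D = "dyadic_quotient x"
  have diff: "((\<lambda>t. (norm (?D m t - ?D n t))\<^sup>2) has_integral E m - E n) {0..real N}" if "n \<le> m" for m n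
    using has_integral_dyadic_quotient_diff[OF that] unfolding E_def .
  have "incseq E"
    using has_integral_nonneg[OF diff] by (auto simp: incseq_def)
  moreover have "E n \<le> L\<^sup>2 * real N" for n
  proof (rule has_integral_le)
    show "((\<lambda>t. ?D n t \<bullet> ?D n t) has_integral E n) {0..real N}"
      using has_integral_dyadic_quotient_inner[OF order_refl, of x n "N * 2 ^ n"] unfolding E_def by simp
    show "((\<lambda>_. L\<^sup>2) has_integral L\<^sup>2 * real N) {0..real N}"
      using has_integral_const_real[of "L\<^sup>2" 0 "real N"] by (simp add: mult.commute)
  qed (auto simp: norm_dyadic_quotient_le[OF L] power_mono simp flip: power2_norm_eq_inner)
  ultimately have "Cauchy E"
    using incseq_convergent[of E "L\<^sup>2 * real N"] LIMSEQ_imp_Cauchy by metis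
  \<comment> \<open>Passing from L2 to L1 uses the pointwise bound
    \<open>a \<le> \<epsilon> + a\<^sup>2 / \<epsilon>\<close>. This \<epsilon> makes the constant
    part integrate to less than \<open>e / 2\<close>, and the tolerance
    \<open>\<epsilon> * (e / 2)\<close> for the energies does the same for the quadratic
    part.\<close>
  define \<epsilon> where "\<epsilon> = e / (2 * (real N + 1))"
  have \<epsilon>: "0 < \<epsilon>" "\<epsilon> * real N < e / 2"
    using e by (auto simp: \<epsilon>_def field_simps)
  obtain K where K: "dist (E i) (E j) < \<epsilon> * (e / 2)" if "i \<ge> K" "j \<ge> K" for i j
    using metric_CauchyD[OF \<open>Cauchy E\<close>, of "\<epsilon> * (e / 2)"] \<epsilon> e by (metis half_gt_zero mult_pos_pos)
  have less: "integral {0..real N} (\<lambda>t. norm (?D i t - ?D j t)) < e" if "K \<le> j" "j \<le> i" for i j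
  proof -
    have "(\<lambda>t. norm (?D i t - ?D j t)) integrable_on {0..real N}"
      using set_integral_diff(1)[OF absolutely_integrable_dyadic_quotient[OF L] absolutely_integrable_dyadic_quotient[OF L]]
      unfolding absolutely_integrable_on_def by blast
    moreover have "((\<lambda>t. \<epsilon> + (norm (?D i t - ?D j t))\<^sup>2 / \<epsilon>) has_integral \<epsilon> * real N + (E i - E j) / \<epsilon>) {0..real N}"
      using has_integral_const_real[of \<epsilon> 0 "real N"]
      by (intro has_integral_add has_integral_divide diff that) (simp add: mult.commute)
    moreover have "norm (?D i t - ?D j t) \<le> \<epsilon> + (norm (?D i t - ?D j t))\<^sup>2 / \<epsilon>" for t
    proof (cases "norm (?D i t - ?D j t) \<le> \<epsilon>")
      case True
      then show ?thesis using \<epsilon> by (simp add: add_increasing2)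
    next
      case False
      then have "norm (?D i t - ?D j t) * \<epsilon> \<le> (norm (?D i t - ?D j t))\<^sup>2"
        unfolding power2_eq_square by (intro mult_left_mono) auto
      then show ?thesis using \<epsilon> by (simp add: pos_le_divide_eq add_increasing)
    qed
    ultimately have "integral {0..real N} (\<lambda>t. norm (?D i t - ?D j t)) \<le> \<epsilon> * real N + (E i - E j) / \<epsilon>"
      by (intro has_integral_le[OF integrable_integral]) auto
    moreover have "\<bar>E i - E j\<bar> < \<epsilon> * (e / 2)"
      using K[of i j] that by (simp add: dist_real_def)
    then have "E i - E j < e / 2 * \<epsilon>"
      using abs_ge_self[of "E i - E j"] unfolding mult.commute[of _ \<epsilon>] by (rule le_less_trans[rotated])
    then have "(E i - E j) / \<epsilon> < e / 2"
      by (simp only: pos_divide_less_eq[OF \<epsilon>(1)])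
    ultimately show ?thesis using \<epsilon> by linarith
  qed
  have "integral {0..real N} (\<lambda>t. norm (?D i t - ?D j t)) < e" if "K \<le> i" "K \<le> j" for i j
    using less[of i j] less[of j i] that by (cases "i \<le> j") (auto simp: norm_minus_commute)
  then show ?thesis by blast
qed

text \<open>The martingale is bounded in \<open>L\<^sup>2\<close>, hence Cauchy in \<open>L\<^sup>1\<close>, hence convergent almost everywhere
  along a subsequence; this replaces the almost everywhere differentiability of \<open>x\<close>.\<close>

lemma lipschitz_indefinite_integral:
  fixes x :: "real \<Rightarrow> 'a::euclidean_space"
  assumes L: "L-lipschitz_on UNIV x"
  obtains v r where "v absolutely_integrable_on {0..real N}"
    and "\<forall>t\<in>{0..real N}. x t = x 0 + integral {0..t} v"
    and "strict_mono r"
    and "AE t in lebesgue. t \<in> {0..real N} \<longrightarrow> (\<lambda>k. dyadic_quotient x (r k) t) \<longlonglongrightarrow> v t"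
proof -
  let ?S = "{0..real N}" and ?D = "dyadic_quotient x"
  have int: "integrable (lebesgue_on ?S) (?D n)" for n
    using absolutely_integrable_imp_integrable[OF absolutely_integrable_dyadic_quotient[OF L]] by simp
  have "\<exists>K. \<forall>i\<ge>K. \<forall>j\<ge>K. (LINT t|lebesgue_on ?S. norm (?D i t - ?D j t)) < e" if "0 < e" for e
    using dyadic_quotient_L1_Cauchy[OF L that, of N]
    by (subst lebesgue_integral_eq_integral) (auto intro!: integrable_norm Bochner_Integration.integrable_diff int)
  then obtain r where r: "strict_mono r" "AE t in lebesgue_on ?S. Cauchy (\<lambda>i. ?D (r i) t)"
    using cauchy_L1_AE_cauchy_subseq[of "lebesgue_on ?S" ?D] int by blast
  define C where "C t \<longleftrightarrow> Cauchy (\<lambda>i. ?D (r i) t)" for t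
  define v where "v t = (if C t then lim (\<lambda>i. ?D (r i) t) else 0)" for t
  have AE: "AE t in lebesgue. t \<in> ?S \<longrightarrow> C t"
    using r(2) by (subst (asm) AE_restrict_space_iff) (auto simp: C_def)
  then have "negligible {t \<in> ?S. \<not> C t}"
    by (simp add: eventually_ae_filter_negligible) (metis (no_types, lifting) mem_Collect_eq negligible_subset subsetI)
  \<comment> \<open>Replacing the quotients by 0 on the null set of divergence makes them converge
    to \<open>v\<close> at every time, as the dominated convergence used below asks for.\<close>
  let ?g = "\<lambda>k t. if C t then ?D (r k) t else 0"
  have g: "?g k absolutely_integrable_on {0..t}" and gi: "integral {0..t} (?g k) = integral {0..t} (?D (r k))"
    if "t \<in> ?S" for k t
  proof -
    have neg: "negligible {t \<in> ?S. \<not> C t}" by fact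
    have sub: "?g k s = ?D (r k) s" if "s \<in> {0..t} - {t \<in> ?S. \<not> C t}" for s
      using that \<open>t \<in> ?S\<close> by auto
    show "?g k absolutely_integrable_on {0..t}"
      by (rule absolutely_integrable_spike[OF absolutely_integrable_dyadic_quotient[OF L] neg sub])
    show "integral {0..t} (?g k) = integral {0..t} (?D (r k))"
      by (rule integral_spike[OF neg]) (use sub in auto)
  qed
  have lim: "(\<lambda>k. ?g k t) \<longlonglongrightarrow> v t" for t
    by (auto simp: v_def C_def Cauchy_convergent_iff convergent_LIMSEQ_iff)
  have bd: "norm (?g k t) \<le> L" for k t
    using norm_dyadic_quotient_le[OF L] lipschitz_on_nonneg[OF L] by simp
  have vbd: "norm (v t) \<le> L" for t
    by (rule Lim_norm_ubound[OF _ lim]) (auto simp: bd)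
  show thesis
  proof (rule that[OF _ _ r(1)])
    show "v absolutely_integrable_on ?S"
      by (rule dominated_convergence_absolutely_integrable[OF g _ _ lim, where h = "\<lambda>_. L"]) (auto simp: vbd)
    show "\<forall>t\<in>?S. x t = x 0 + integral {0..t} v"
    proof
      fix t assume t: "t \<in> ?S"
      have "(\<lambda>k. integral {0..t} (?g k)) \<longlonglongrightarrow> integral {0..t} v"
        using g[OF t]
        by (intro dominated_convergence(2)[OF _ _ _ lim, where h = "\<lambda>_. L"])
           (auto simp: bd absolutely_integrable_on_def)
      moreover have "(\<lambda>k. integral {0..t} (?g k)) \<longlonglongrightarrow> x t - x 0"
        unfolding gi[OF t]
        using LIMSEQ_subseq_LIMSEQ[OF integral_dyadic_quotient_tendsto[OF L] r(1), of t] t by (simp add: o_def)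
      ultimately have "x t - x 0 = integral {0..t} v"
        using LIMSEQ_unique by blast
      then show "x t = x 0 + integral {0..t} v" by (simp add: algebra_simps)
    qed
    show "AE t in lebesgue. t \<in> ?S \<longrightarrow> (\<lambda>k. ?D (r k) t) \<longlonglongrightarrow> v t"
      using AE proof eventually_elim
      case (elim t)
      then show ?case using lim[of t] by (cases "t \<in> ?S") auto
    qed
  qed
qed

section \<open>Slope solutions\<close>

text \<open>The relation is imposed on the ends of all short time intervals around \<open>t\<close>,
  whether they contain \<open>t\<close> or lie on one side of it. They are cut off at 0 and below
  \<tau>, so the notion is one-sided at \<open>t = 0\<close>.\<close>

definition near :: "real \<Rightarrow> real \<Rightarrow> (real \<Rightarrow> real \<Rightarrow> bool) \<Rightarrow> bool" where
  "near \<tau> t P \<longleftrightarrow> (\<exists>\<eta>>0. \<forall>s s'. 0 \<le> s \<and> s \<le> s' \<and> s' < \<tau> \<and> t - \<eta> < s \<and> s' < t + \<eta> \<longrightarrow> P s s')"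

text \<open>By \<open>not_in_filippovE\<close> and \<open>filippov_le\<close>, the half-spaces
  \<open>{v. p \<bullet> v \<le> c}\<close> with this property cut out \<open>filippov f z\<close>
  exactly.\<close>

definition essential_bound :: "('a::euclidean_space \<Rightarrow> 'a) \<Rightarrow> 'a \<Rightarrow> 'a \<Rightarrow> real \<Rightarrow> bool" where
  "essential_bound f z p c \<longleftrightarrow> (\<exists>\<delta>>0. \<exists>N. negligible N \<and> (\<forall>w\<in>ball z \<delta> - N. p \<bullet> f w \<le> c))"

text \<open>A description of Filippov solutions without velocities, by supporting half-spaces of
  \<open>filippov f\<close>. It is local in time, so such solutions can be glued.\<close>

definition slope_solution :: "('a::euclidean_space \<Rightarrow> 'a) \<Rightarrow> real \<Rightarrow> (real \<Rightarrow> 'a) \<Rightarrow> bool" where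
  "slope_solution f \<tau> x \<longleftrightarrow>
     (\<forall>t\<in>{0..<\<tau>}. (\<exists>L. near \<tau> t (\<lambda>s s'. norm (x s' - x s) \<le> L * (s' - s))) \<and>
        (\<forall>p c. essential_bound f (x t) p c \<longrightarrow> near \<tau> t (\<lambda>s s'. p \<bullet> (x s' - x s) \<le> c * (s' - s))))"

lemma near_mono:
  assumes "near \<tau> t P" and "\<And>s s'. P s s' \<Longrightarrow> Q s s'"
  shows "near \<tau> t Q"
  using assms unfolding near_def by meson

text \<open>Compactness of \<open>[a, b]\<close> in the form of Bolzano's bisection. This is how
  local estimates become global; the main instances are inequalities between quantities that are
  additive over adjacent intervals.\<close>

lemma near_interval:
  assumes ab: "0 \<le> a" "a \<le> b" "b < \<tau>"
    and near: "\<And>t. a \<le> t \<Longrightarrow> t \<le> b \<Longrightarrow> near \<tau> t P"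
    and trans: "\<And>r s t. P r s \<Longrightarrow> P s t \<Longrightarrow> r \<le> s \<Longrightarrow> s \<le> t \<Longrightarrow> P r t"
  shows "P a b"
proof -
  define Q where "Q s s' \<longleftrightarrow> (a \<le> s \<longrightarrow> s \<le> s' \<longrightarrow> s' \<le> b \<longrightarrow> P s s')" for s s'
  have "Q a b"
    using \<open>a \<le> b\<close>
  proof (induction rule: Bolzano)
    case (trans r s t)
    then show ?case using assms(5)[of r s t] unfolding Q_def by auto
  next
    case (local t)
    then obtain \<eta> where \<eta>: "0 < \<eta>"
      "\<And>s s'. 0 \<le> s \<and> s \<le> s' \<and> s' < \<tau> \<and> t - \<eta> < s \<and> s' < t + \<eta> \<Longrightarrow> P s s'"
      using near[of t] unfolding near_def by meson
    show ?case
      using ab \<eta>(1) unfolding Q_def by (intro exI[of _ \<eta>]) (auto intro!: \<eta>(2))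
  qed
  then show ?thesis using ab unfolding Q_def by simp
qed

lemma slope_near_interval:
  fixes x :: "real \<Rightarrow> 'a::euclidean_space"
  assumes ab: "0 \<le> a" "a \<le> b" "b < \<tau>"
    and near: "\<And>t. a \<le> t \<Longrightarrow> t \<le> b \<Longrightarrow> near \<tau> t (\<lambda>s s'. p \<bullet> (x s' - x s) \<le> c * (s' - s))"
  shows "p \<bullet> (x b - x a) \<le> c * (b - a)"
  using near_interval[OF ab near] by (force simp: inner_diff_right algebra_simps)

text \<open>The same null set serves at every nearby point. In dual form this is the upper
  semicontinuity of the Filippov map.\<close>

lemma essential_bound_ball:
  assumes "essential_bound f z p c"
  obtains \<delta> where "0 < \<delta>" "\<And>w. w \<in> ball z \<delta> \<Longrightarrow> essential_bound f w p c"
proof -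
  obtain \<delta> N where \<delta>: "0 < \<delta>" "negligible N" "\<And>w. w \<in> ball z \<delta> - N \<Longrightarrow> p \<bullet> f w \<le> c"
    using assms unfolding essential_bound_def by blast
  have "essential_bound f w p c" if "w \<in> ball z \<delta>" for w
  proof -
    have "ball w (\<delta> - dist z w) \<subseteq> ball z \<delta>"
      by (simp add: ball_subset_ball_iff dist_commute)
    then show ?thesis
      using that \<delta> unfolding essential_bound_def
      by (intro exI[of _ "\<delta> - dist z w"] conjI exI[of _ N] ballI) auto
  qed
  with \<delta>(1) that show ?thesis by blast
qed

lemma essential_bound_norm:
  assumes "0 < \<delta>" "\<And>w. w \<in> ball z \<delta> \<Longrightarrow> norm (f w) \<le> M"
  shows "essential_bound f z p (norm p * M)"
  unfolding essential_bound_def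
proof (intro exI[of _ \<delta>] conjI exI[of _ "{}"] ballI)
  fix w assume "w \<in> ball z \<delta> - {}"
  then show "p \<bullet> f w \<le> norm p * M"
    using norm_cauchy_schwarz[of p "f w"] mult_left_mono[OF assms(2)[of w], of "norm p"] by simp
qed (use assms in auto)

text \<open>Separation of a point from a closed convex set; the sign change turns the lower bound of
  the separating functional into an essential upper bound.\<close>

lemma not_in_filippovE:
  assumes "v \<notin> filippov f z"
  obtains p c where "essential_bound f z p c" "c < p \<bullet> v"
proof -
  obtain \<delta> N where \<delta>: "0 < \<delta>" "negligible N" "v \<notin> closure (convex hull (f ` (ball z \<delta> - N)))"
    using assms unfolding filippov_def by auto
  obtain a b where ab: "a \<bullet> v < b" "\<And>w. w \<in> closure (convex hull (f ` (ball z \<delta> - N))) \<Longrightarrow> b < a \<bullet> w"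
    using separating_hyperplane_closed_point[OF _ _ \<delta>(3)] by (auto simp: convex_closure)
  have "b < a \<bullet> f w" if "w \<in> ball z \<delta> - N" for w
    using that by (intro ab(2) set_mp[OF closure_subset] hull_inc) auto
  then have "essential_bound f z (- a) (- b)"
    unfolding essential_bound_def using \<delta> by (force intro: less_imp_le)
  with ab(1) that[of "- a" "- b"] show thesis by simp
qed

lemma filippov_le:
  assumes "essential_bound f z p c" "v \<in> filippov f z"
  shows "p \<bullet> v \<le> c"
proof -
  obtain \<delta> N where \<delta>: "0 < \<delta>" "negligible N" "\<And>w. w \<in> ball z \<delta> - N \<Longrightarrow> p \<bullet> f w \<le> c"
    using assms unfolding essential_bound_def by blast
  have "closure (convex hull (f ` (ball z \<delta> - N))) \<subseteq> {v. p \<bullet> v \<le> c}"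
    using \<delta>(3) by (intro closure_minimal hull_minimal convex_halfspace_le closed_halfspace_le) auto
  moreover have "v \<in> closure (convex hull (f ` (ball z \<delta> - N)))"
    using assms(2) \<delta>(1,2) unfolding filippov_def by auto
  ultimately show ?thesis by auto
qed

lemma slope_solution_slope:
  assumes "slope_solution f \<tau> x" "t \<in> {0..<\<tau>}" "essential_bound f (x t) p c"
  shows "near \<tau> t (\<lambda>s s'. p \<bullet> (x s' - x s) \<le> c * (s' - s))"
  using assms unfolding slope_solution_def by blast

lemma slope_solution_lipschitz:
  fixes x :: "real \<Rightarrow> 'a::euclidean_space"
  assumes x: "slope_solution f \<tau> x" and T: "0 \<le> T" "T < \<tau>"
  shows "\<exists>L. L-lipschitz_on {0..T} x"
proof -
  have "\<exists>L\<ge>0. \<forall>u u'. 0 \<le> u \<and> u \<le> u' \<and> u' \<le> T \<longrightarrow> norm (x u' - x u) \<le> L * (u' - u)"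
  \<comment> \<open>The constant is quantified inside the relation and has to serve all
    subintervals, so that the relation on \<open>[0, T]\<close> is a genuine Lipschitz condition. On
    adjacent intervals \<open>L1 + L2\<close> is a common constant.\<close>
  proof (rule near_interval[OF order_refl T, where P = "\<lambda>s s'. \<exists>L\<ge>0. \<forall>u u'. s \<le> u \<and> u \<le> u' \<and> u' \<le> s' \<longrightarrow> norm (x u' - x u) \<le> L * (u' - u)"])
    fix t assume "0 \<le> t" "t \<le> T"
    then obtain L \<eta> where "0 < \<eta>" and
      L: "\<And>s s'. 0 \<le> s \<and> s \<le> s' \<and> s' < \<tau> \<and> t - \<eta> < s \<and> s' < t + \<eta> \<Longrightarrow> norm (x s' - x s) \<le> L * (s' - s)"
      using x T unfolding slope_solution_def near_def by (meson atLeastLessThan_iff le_less_trans)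
    have "norm (x s' - x s) \<le> \<bar>L\<bar> * (s' - s)" if "0 \<le> s \<and> s \<le> s' \<and> s' < \<tau> \<and> t - \<eta> < s \<and> s' < t + \<eta>" for s s'
      using L[OF that] mult_right_mono[OF abs_ge_self[of L], of "s' - s"] that by linarith
    with \<open>0 < \<eta>\<close> show "near \<tau> t (\<lambda>s s'. \<exists>L\<ge>0. \<forall>u u'. s \<le> u \<and> u \<le> u' \<and> u' \<le> s' \<longrightarrow> norm (x u' - x u) \<le> L * (u' - u))"
      unfolding near_def by (intro exI[of _ \<eta>]) (auto intro!: exI[of _ "\<bar>L\<bar>"])
  next
    fix r s t :: real
    assume le: "r \<le> s" "s \<le> t"
      and "\<exists>L\<ge>0. \<forall>u u'. r \<le> u \<and> u \<le> u' \<and> u' \<le> s \<longrightarrow> norm (x u' - x u) \<le> L * (u' - u)"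
      and "\<exists>L\<ge>0. \<forall>u u'. s \<le> u \<and> u \<le> u' \<and> u' \<le> t \<longrightarrow> norm (x u' - x u) \<le> L * (u' - u)"
    then obtain L1 L2 where L: "0 \<le> L1" "0 \<le> L2"
      and L1: "\<And>u u'. r \<le> u \<and> u \<le> u' \<and> u' \<le> s \<Longrightarrow> norm (x u' - x u) \<le> L1 * (u' - u)"
      and L2: "\<And>u u'. s \<le> u \<and> u \<le> u' \<and> u' \<le> t \<Longrightarrow> norm (x u' - x u) \<le> L2 * (u' - u)"
      by blast
    let ?L = "L1 + L2"
    have L1': "norm (x u' - x u) \<le> ?L * (u' - u)" if "r \<le> u \<and> u \<le> u' \<and> u' \<le> s" for u u'
      using L1[OF that] that L by (auto intro!: order_trans[OF _ mult_right_mono, of _ L1 "u' - u"])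
    have L2': "norm (x u' - x u) \<le> ?L * (u' - u)" if "s \<le> u \<and> u \<le> u' \<and> u' \<le> t" for u u'
      using L2[OF that] that L by (auto intro!: order_trans[OF _ mult_right_mono, of _ L2 "u' - u"])
    have "norm (x u' - x u) \<le> ?L * (u' - u)" if u: "r \<le> u \<and> u \<le> u' \<and> u' \<le> t" for u u'
    proof -
      consider "u' \<le> s" | "s \<le> u" | "u \<le> s" "s \<le> u'" by linarith
      then show ?thesis
      proof cases
        case 3
        have "norm (x u' - x u) \<le> norm (x u' - x s) + norm (x s - x u)"
          using norm_triangle_ineq[of "x u' - x s" "x s - x u"] by simp
        also have "\<dots> \<le> ?L * (u' - s) + ?L * (s - u)"
          using L1'[of u s] L2'[of s u'] 3 u le by (intro add_mono) auto
        finally show ?thesis by (simp add: algebra_simps)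
      qed (use L1' L2' u in auto)
    qed
    with L show "\<exists>L\<ge>0. \<forall>u u'. r \<le> u \<and> u \<le> u' \<and> u' \<le> t \<longrightarrow> norm (x u' - x u) \<le> L * (u' - u)"
      by (intro exI[of _ ?L]) auto
  qed
  then obtain L where L: "0 \<le> L" "\<And>u u'. 0 \<le> u \<and> u \<le> u' \<and> u' \<le> T \<Longrightarrow> norm (x u' - x u) \<le> L * (u' - u)"
    by blast
  have "dist (x u) (x u') \<le> L * dist u u'" if "u \<in> {0..T}" "u' \<in> {0..T}" for u u'
    using L(2)[of u u'] L(2)[of u' u] that by (cases "u \<le> u'") (auto simp: dist_norm norm_minus_commute)
  with L(1) show ?thesis by (auto simp: lipschitz_on_def)
qed

lemma slope_solution_continuous_on:
  assumes "slope_solution f \<tau> x"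
  shows "continuous_on {0..<\<tau>} x"
proof -
  have "continuous (at t within {0..<\<tau>}) x" if t: "t \<in> {0..<\<tau>}" for t
  proof -
    define T where "T = (t + \<tau>) / 2"
    have T: "t < T" "0 \<le> T" "T < \<tau>" using t by (auto simp: T_def)
    obtain L where "L-lipschitz_on {0..T} x"
      using slope_solution_lipschitz[OF assms] T by blast
    then have "continuous (at t within {0..T}) x"
      using lipschitz_on_continuous_on t T(1) by (fastforce simp: continuous_on_eq_continuous_within)
    moreover have "at t within {0..<\<tau>} = at t within {0..T}"
      by (rule at_within_nhd[of _ "{..<T}"]) (use T t in auto)
    ultimately show ?thesis by simp
  qed
  then show ?thesis by (simp add: continuous_on_eq_continuous_within)
qed

section \<open>Recovering a velocity from a slope solution\<close>

lemma integral_piecewise: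
  fixes V :: "nat \<Rightarrow> real \<Rightarrow> 'a::euclidean_space" and T :: "nat \<Rightarrow> real"
  assumes T: "T 0 = 0" "strict_mono T"
    and V: "\<And>k. V k absolutely_integrable_on {0..T (Suc k)}"
    and x: "\<And>k t. t \<in> {0..T (Suc k)} \<Longrightarrow> x t = x 0 + integral {0..t} (V k)"
    and v: "\<And>k t. T k \<le> t \<Longrightarrow> t < T (Suc k) \<Longrightarrow> v t = V k t"
    and t: "t \<in> {0..T k}"
  shows "v absolutely_integrable_on {0..t} \<and> x t = x 0 + integral {0..t} v"
  using t
proof (induction k arbitrary: t)
  case 0
  then show ?case using T(1) absolutely_integrable_on_null[of 0 0 v] by simp
next
  case (Suc k)
  have less: "T k < T (Suc k)" by (rule strict_monoD[OF T(2)]) simp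
  have "T 0 \<le> T k"
    by (rule monoD[OF strict_mono_mono[OF T(2)]]) simp
  then have "0 \<le> T k" by (simp only: T(1))
  show ?case
  proof (cases "t \<le> T k")
    case True
    with Suc.prems show ?thesis by (intro Suc.IH) simp
  next
    case False
    have "V k absolutely_integrable_on {0..t}"
      using Suc.prems by (intro absolutely_integrable_on_subinterval[OF V]) auto
    then have Vk: "V k absolutely_integrable_on {T k..t}"
      by (rule absolutely_integrable_on_subinterval) (use \<open>0 \<le> T k\<close> in auto)
    have eq: "v s = V k s" if "s \<in> {T k..t} - {T (Suc k)}" for s
      using that Suc.prems by (intro v) (auto simp: less_le)
    have 1: "v absolutely_integrable_on {T k..t}"
      by (rule absolutely_integrable_spike[OF Vk negligible_sing eq])
    have 2: "v absolutely_integrable_on {0..T k}" "x (T k) = x 0 + integral {0..T k} v"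
      using Suc.IH[of "T k"] \<open>0 \<le> T k\<close> by simp_all
    have "{0..t} = {0..T k} \<union> {T k..t}" using False \<open>0 \<le> T k\<close> by auto
    with 1 2 have int: "v absolutely_integrable_on {0..t}"
      using set_integrable_Un[of lebesgue "{0..T k}" v "{T k..t}"] by simp
    have "integral {0..T k} (V k) + integral {T k..t} (V k) = integral {0..t} (V k)"
      using \<open>V k absolutely_integrable_on {0..t}\<close> False \<open>0 \<le> T k\<close>
      by (intro Henstock_Kurzweil_Integration.integral_combine) (auto simp: absolutely_integrable_on_def)
    moreover have "integral {0..T k} v + integral {T k..t} v = integral {0..t} v"
      using int False \<open>0 \<le> T k\<close>
      by (intro Henstock_Kurzweil_Integration.integral_combine) (auto simp: absolutely_integrable_on_def)
    moreover have "integral {T k..t} v = integral {T k..t} (V k)"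
      by (rule integral_spike[OF negligible_sing]) (rule eq[symmetric])
    ultimately have "x t = x 0 + integral {0..t} v"
      using x[of t k] x[of "T k" k] 2(2) Suc.prems less \<open>0 \<le> T k\<close> by (simp add: algebra_simps)
    with int show ?thesis by blast
  qed
qed

text \<open>Were \<open>v\<close> outside, a half-space would separate it. The dyadic cells around
  \<open>t\<close> shrink to \<open>t\<close>, so the slope condition puts their difference
  quotients into this half-space, and the limit \<open>v\<close> with them. The curve
  \<open>y\<close> stands for an extension of \<open>x\<close> to the whole line.\<close>

lemma slope_limit_in_filippov:
  fixes x :: "real \<Rightarrow> 'a::euclidean_space"
  assumes x: "slope_solution f \<tau> x" and t: "0 \<le> t" "t < T" and T: "T < \<tau>"
    and y: "\<And>s. s \<in> {0..T} \<Longrightarrow> y s = x s"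
    and r: "strict_mono r" and lim: "(\<lambda>k. dyadic_quotient y (r k) t) \<longlonglongrightarrow> v"
  shows "v \<in> filippov f (x t)"
proof (rule ccontr)
  assume "v \<notin> filippov f (x t)"
  then obtain p c where pc: "essential_bound f (x t) p c" "c < p \<bullet> v"
    by (rule not_in_filippovE)
  then obtain \<eta> where \<eta>: "0 < \<eta>" and slope:
    "\<And>s s'. 0 \<le> s \<and> s \<le> s' \<and> s' < \<tau> \<and> t - \<eta> < s \<and> s' < t + \<eta> \<Longrightarrow> p \<bullet> (x s' - x s) \<le> c * (s' - s)"
    using slope_solution_slope[OF x, of t p c] t T unfolding near_def by auto
  \<comment> \<open>A cell of length below \<eta> lies where the slope condition holds; one of
    length below \<open>T - t\<close> lies in \<open>[0, T]\<close>, where \<open>y\<close> agrees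
    with \<open>x\<close>.\<close>
  have "\<forall>\<^sub>F k in sequentially. (1 / 2 :: real) ^ r k < min \<eta> (T - t)"
    using LIMSEQ_subseq_LIMSEQ[OF LIMSEQ_power_zero[of "1 / 2 :: real"] r] \<eta> t
    by (intro order_tendstoD(2)[where y = 0]) (auto simp: o_def)
  then have "\<forall>\<^sub>F k in sequentially. p \<bullet> dyadic_quotient y (r k) t \<le> c"
  proof eventually_elim
    case (elim k)
    define a where "a = of_int \<lfloor>2 ^ r k * t\<rfloor> / (2 :: real) ^ r k"
    define b where "b = (of_int \<lfloor>2 ^ r k * t\<rfloor> + 1) / (2 :: real) ^ r k"
    have ba: "b - a = (1 / 2) ^ r k"
      by (simp add: a_def b_def power_divide flip: diff_divide_distrib)
    have "of_int \<lfloor>2 ^ r k * t\<rfloor> \<le> t * 2 ^ r k" "t * 2 ^ r k < of_int \<lfloor>2 ^ r k * t\<rfloor> + 1"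
      using floor_correct[of "2 ^ r k * t"] by (simp_all add: mult.commute)
    then have at: "a \<le> t" "t < b"
      by (simp_all add: a_def b_def pos_divide_le_eq pos_less_divide_eq)
    have "0 \<le> a" using t by (simp add: a_def)
    have "p \<bullet> (x b - x a) \<le> c * (b - a)"
      using at \<open>0 \<le> a\<close> ba elim T by (intro slope) auto
    moreover have "y a = x a" "y b = x b"
      using at \<open>0 \<le> a\<close> ba elim t by (auto intro!: y)
    moreover have "dyadic_quotient y (r k) t = 2 ^ r k *\<^sub>R (y b - y a)"
      by (simp add: dyadic_quotient_def a_def b_def)
    ultimately show ?case
      unfolding ba by (simp add: power_divide pos_le_divide_eq mult.commute)
  qed
  moreover have "(\<lambda>k. p \<bullet> dyadic_quotient y (r k) t) \<longlonglongrightarrow> p \<bullet> v"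
    by (intro tendsto_intros lim)
  ultimately have "p \<bullet> v \<le> c"
    by (intro tendsto_upperbound) auto
  with pc(2) show False by simp
qed

theorem slope_solution_imp_filippov_solution:
  fixes x :: "real \<Rightarrow> 'a::euclidean_space"
  assumes x: "slope_solution f \<tau> x"
  shows "filippov_solution f \<tau> x"
proof (cases "0 < \<tau>")
  case False
  then show ?thesis unfolding filippov_solution_def by auto
next
  case True
  \<comment> \<open>An exhaustion of \<open>[0, \<tau>)\<close>. The Lipschitz constant of
    \<open>x\<close> may blow up at \<tau>, so a velocity \<open>V k\<close> is produced for each
    \<open>[0, T (Suc k)]\<close> and kept only on \<open>[T k, T (Suc k))\<close>.\<close>
  define T where "T k = \<tau> * (1 - inverse (real (Suc k)))" for k
  have T: "T 0 = 0" "strict_mono T" "T k < \<tau>" for k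
    using True by (auto simp: T_def strict_mono_Suc_iff field_simps)
  have "T 0 \<le> T k" for k
    by (rule monoD[OF strict_mono_mono[OF T(2)]]) simp
  then have T_nonneg: "0 \<le> T k" for k by (simp only: T(1))
  have "T \<longlonglongrightarrow> \<tau> * (1 - 0)"
    unfolding T_def by (intro tendsto_intros LIMSEQ_inverse_real_of_nat)
  then have Tlim: "T \<longlonglongrightarrow> \<tau>" by simp
  \<comment> \<open>Clamping the time is 1-Lipschitz, so this extends \<open>x\<close> from
    \<open>[0, T (Suc k)]\<close> to a Lipschitz curve on the whole line.\<close>
  define y where "y k t = x (max 0 (min (T (Suc k)) t))" for k t
  have yx: "y k t = x t" if "t \<in> {0..T (Suc k)}" for k t
    using that by (simp add: y_def)
  define N where "N = nat \<lceil>\<tau>\<rceil>"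
  have N: "\<tau> \<le> real N" by (simp add: N_def real_nat_ceiling_ge)
  define Q where "Q k V r \<longleftrightarrow> V absolutely_integrable_on {0..real N} \<and>
      (\<forall>t\<in>{0..real N}. y k t = y k 0 + integral {0..t} V) \<and> strict_mono r \<and>
      (AE t in lebesgue. t \<in> {0..real N} \<longrightarrow> (\<lambda>j. dyadic_quotient (y k) (r j) t) \<longlonglongrightarrow> V t)" for k V r
  have "\<exists>V r. Q k V r" for k
  proof -
    obtain L where L: "L-lipschitz_on {0..T (Suc k)} x"
      using slope_solution_lipschitz[OF x] T(3) T_nonneg[of "Suc k"] by blast
    have "L-lipschitz_on UNIV (y k)"
      unfolding y_def
    proof (rule lipschitz_onI)
      fix s t
      let ?c = "\<lambda>t. max 0 (min (T (Suc k)) t)"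
      have "dist (x (?c s)) (x (?c t)) \<le> L * dist (?c s) (?c t)"
        using T_nonneg[of "Suc k"] by (intro lipschitz_onD[OF L]) auto
      also have "\<dots> \<le> L * dist s t"
        by (intro mult_left_mono lipschitz_on_nonneg[OF L]) (auto simp: dist_real_def)
      finally show "dist (x (?c s)) (x (?c t)) \<le> L * dist s t" .
    qed (rule lipschitz_on_nonneg[OF L])
    then show ?thesis
      by (rule lipschitz_indefinite_integral[where N = N]) (unfold Q_def, intro exI conjI; assumption)
  qed
  then obtain V r where "\<And>k. Q k (V k) (r k)"
    by metis
  then have V: "\<And>k. V k absolutely_integrable_on {0..real N}"
    and Vx: "\<And>k t. t \<in> {0..real N} \<Longrightarrow> y k t = y k 0 + integral {0..t} (V k)"
    and r: "\<And>k. strict_mono (r k)"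
    and Vlim: "\<And>k. AE t in lebesgue. t \<in> {0..real N} \<longrightarrow> (\<lambda>j. dyadic_quotient (y k) (r k j) t) \<longlonglongrightarrow> V k t"
    unfolding Q_def by blast+
  define idx where "idx t = (LEAST k. t < T (Suc k))" for t
  define v where "v t = V (idx t) t" for t
  have idx: "idx t = k" if "T k \<le> t" "t < T (Suc k)" for k t
    unfolding idx_def
  proof (rule Least_equality)
    fix j assume "t < T (Suc j)"
    with that(1) have "T k < T (Suc j)" by simp
    then show "k \<le> j" using strict_mono_less[OF T(2)] by simp
  qed (use that in auto)
  have less_idx: "t < T (Suc (idx t))" if "t < \<tau>" for t
    unfolding idx_def
  proof (rule LeastI_ex)
    show "\<exists>k. t < T (Suc k)"
      using order_tendstoD(1)[OF filterlim_sequentially_Suc[THEN iffD2, OF Tlim] that] by (auto dest: eventually_happens)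
  qed
  have int: "v absolutely_integrable_on {0..t} \<and> x t = x 0 + integral {0..t} v" if t: "t \<in> {0..<\<tau>}" for t
  proof (rule integral_piecewise[OF T(1,2)])
    show "V k absolutely_integrable_on {0..T (Suc k)}" for k
      by (rule absolutely_integrable_on_subinterval[OF V]) (use T(3)[of "Suc k"] N in auto)
    show "x t = x 0 + integral {0..t} (V k)" if "t \<in> {0..T (Suc k)}" for k t
      using Vx[of t k] that yx[of t k] yx[of 0 k] T_nonneg[of "Suc k"] T(3)[of "Suc k"] N by auto
    show "v t = V k t" if "T k \<le> t" "t < T (Suc k)" for k t
      using idx[OF that] by (simp add: v_def)
    show "t \<in> {0..T (Suc (idx t))}" using less_idx[of t] t by auto
  qed
  have "AE t in lebesgue. \<forall>k. t \<in> {0..real N} \<longrightarrow> (\<lambda>j. dyadic_quotient (y k) (r k j) t) \<longlonglongrightarrow> V k t"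
    unfolding AE_all_countable using Vlim by blast
  then have "AE t in lebesgue. t \<in> {0..<\<tau>} \<longrightarrow> v t \<in> filippov f (x t)"
  proof eventually_elim
    case (elim t)
    show ?case
    proof
      assume t: "t \<in> {0..<\<tau>}"
      with elim N have lim: "(\<lambda>j. dyadic_quotient (y (idx t)) (r (idx t) j) t) \<longlonglongrightarrow> v t"
        unfolding v_def by simp
      show "v t \<in> filippov f (x t)"
        by (rule slope_limit_in_filippov[OF x _ less_idx T(3) yx r lim]) (use t in auto)
    qed
  qed
  with int show ?thesis unfolding filippov_solution_def by blast
qed

section \<open>Local existence\<close>

text \<open>Finite intersection property in the ball of radius \<open>M\<close>: finitely many radii
  and null sets leave a common point \<open>w\<close>, since balls are not negligible, and
  \<open>f w\<close> lies in all the corresponding closures.\<close>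

lemma filippov_nonempty:
  fixes f :: "'a::euclidean_space \<Rightarrow> 'a"
  assumes "0 < \<delta>" and M: "\<And>w. w \<in> ball z \<delta> \<Longrightarrow> norm (f w) \<le> M"
  shows "filippov f z \<noteq> {}"
proof -
  define K where "K = (\<lambda>(e :: real, N). closure (convex hull (f ` (ball z e - N))))"
  have "cball 0 M \<inter> (\<Inter>i\<in>{0<..} \<times> Collect negligible. K i) \<noteq> {}"
  proof (rule compact_imp_fip_image)
    show "closed (K i)" for i by (simp add: K_def split: prod.split)
    fix I :: "(real \<times> 'a set) set"
    assume I: "finite I" "I \<subseteq> {0<..} \<times> Collect negligible"
    define e where "e = Min (insert \<delta> (fst ` I))"
    have e: "0 < e" "e \<le> \<delta>" "\<And>i. i \<in> I \<Longrightarrow> e \<le> fst i"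
      using I \<open>0 < \<delta>\<close> by (auto simp: e_def)
    have "negligible (\<Union>(snd ` I))"
      using I by (intro negligible_Union) auto
    moreover have "\<not> negligible (ball z e)"
      using e(1) by (intro open_not_negligible) auto
    ultimately obtain w where w: "w \<in> ball z e" "w \<notin> \<Union>(snd ` I)"
      using negligible_subset by blast
    have "f w \<in> K i" if "i \<in> I" for i
    proof -
      have "w \<in> ball z (fst i) - snd i"
        using w e(3)[OF that] that by auto
      then show ?thesis
        unfolding K_def case_prod_beta by (intro set_mp[OF closure_subset] hull_inc imageI)
    qed
    moreover have "f w \<in> cball 0 M" using M[of w] w e(2) by simp
    ultimately show "cball 0 M \<inter> (\<Inter>i\<in>I. K i) \<noteq> {}" by blast
  qed simp
  then show ?thesis unfolding filippov_def K_def by auto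
qed

text \<open>Tychonoff's theorem. A subsequence that converges at all times need not exist, but
  arbitrarily late members approximate the cluster point at any finite set of times
  simultaneously.\<close>

lemma pointwise_cluster_point:
  fixes y :: "nat \<Rightarrow> 'b \<Rightarrow> 'a::metric_space"
  assumes y: "\<And>k t. y k t \<in> K t" and K: "\<And>t. compact (K t)"
  obtains x where "\<And>A n e. finite A \<Longrightarrow> 0 < e \<Longrightarrow> \<exists>k\<ge>n. \<forall>t\<in>A. dist (y k t) (x t) < e"
proof -
  have "compactin (product_topology (\<lambda>_. euclidean) UNIV) (PiE UNIV K)"
    using K by (simp add: compactin_PiE)
  then have "compact (PiE UNIV K)"
    by (simp add: euclidean_product_topology)
  moreover have "eventually (\<lambda>g. g \<in> PiE UNIV K) (filtermap y sequentially)"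
    unfolding eventually_filtermap using y by (intro always_eventually) auto
  moreover have "filtermap y sequentially \<noteq> bot"
    by (simp add: filtermap_bot_iff)
  ultimately obtain x where x: "inf (nhds x) (filtermap y sequentially) \<noteq> bot"
    unfolding compact_filter by blast
  show thesis
  proof (rule that)
    fix A :: "'b set" and n and e :: real
    assume A: "finite A" "0 < e"
    let ?U = "\<Inter>t\<in>A. (\<lambda>g. g t) -` ball (x t) e"
    have "open ?U"
      using A by (intro open_INT ballI open_vimage) auto
    then have "eventually (\<lambda>g. g \<in> ?U) (nhds x)"
      using A by (auto simp: eventually_nhds)
    show "\<exists>k\<ge>n. \<forall>t\<in>A. dist (y k t) (x t) < e"
    proof (rule ccontr)
      assume "\<not> ?thesis"
      then have "\<And>k. n \<le> k \<Longrightarrow> y k \<notin> ?U" by (auto simp: dist_commute)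
      then have "eventually (\<lambda>g. g \<notin> ?U) (filtermap y sequentially)"
        unfolding eventually_filtermap eventually_sequentially by blast
      with \<open>eventually (\<lambda>g. g \<in> ?U) (nhds x)\<close>
      have "eventually (\<lambda>_. False) (inf (nhds x) (filtermap y sequentially))"
        unfolding eventually_inf by blast
      with x show False by (simp add: trivial_limit_def)
    qed
  qed
qed

lemma le_if_le_add_small:
  fixes a b :: real
  assumes "0 < e0" "\<And>e. 0 < e \<Longrightarrow> e < e0 \<Longrightarrow> a \<le> b + C * e"
  shows "a \<le> b"
proof (rule tendsto_lowerbound)
  show "((\<lambda>e. b + C * e) \<longlongrightarrow> b) (at_right 0)"
    by (auto intro!: tendsto_eq_intros)
  show "\<forall>\<^sub>F e in at_right 0. a \<le> b + C * e"
    using assms by (auto simp: eventually_at_right_field)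
qed simp

text \<open>Explicit Euler polygons with step \<open>1 / (k + 1)\<close>, as step functions; a pointwise cluster
  point suffices because the slope condition at a time only concerns finitely many times.\<close>

lemma local_slope_solution:
  fixes f :: "'a::euclidean_space \<Rightarrow> 'a"
  assumes R: "0 < R" and M: "\<And>w. w \<in> ball z0 R \<Longrightarrow> norm (f w) \<le> M" and \<tau>: "M * \<tau> < R"
  obtains x where "slope_solution f \<tau> x" "x 0 = z0" "\<forall>t\<ge>0. norm (x t - z0) \<le> M * t"
proof -
  have "0 \<le> M" using order_trans[OF norm_ge_zero M[of z0]] R by simp
  \<comment> \<open>A selection of the Filippov map, set to 0 outside the ball so that its norm is
    at most \<open>M\<close> everywhere. Up to time \<tau> the polygon stays inside the ball because
    of \<open>M * \<tau> < R\<close>.\<close>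
  define \<phi> where "\<phi> w = (if w \<in> ball z0 R then SOME v. v \<in> filippov f w else 0)" for w
  have \<phi>: "\<phi> w \<in> filippov f w" "norm (\<phi> w) \<le> M" if w: "w \<in> ball z0 R" for w
  proof -
    obtain e where e: "0 < e" "ball w e \<subseteq> ball z0 R"
      using openE[OF open_ball w] .
    then have M': "norm (f u) \<le> M" if "u \<in> ball w e" for u
      using that M by blast
    show *: "\<phi> w \<in> filippov f w"
    proof -
      have "filippov f w \<noteq> {}" by (rule filippov_nonempty[OF e(1) M'])
      then show ?thesis using w by (simp add: \<phi>_def some_in_eq)
    qed
    have "\<phi> w \<bullet> \<phi> w \<le> norm (\<phi> w) * M"
      by (rule filippov_le[OF essential_bound_norm[OF e(1) M'] *])
    then show "norm (\<phi> w) \<le> M"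
      using \<open>0 \<le> M\<close> by (cases "\<phi> w = 0") (auto simp: power2_norm_eq_inner[symmetric] power2_eq_square)
  qed
  have \<phi>_le: "norm (\<phi> w) \<le> M" for w
    using \<phi>(2)[of w] \<open>0 \<le> M\<close> by (cases "w \<in> ball z0 R") (auto simp: \<phi>_def)
  define h where "h k = inverse (real (Suc k))" for k
  have h: "0 < h k" for k by (simp add: h_def)
  define X where "X k = rec_nat z0 (\<lambda>_ w. w + h k *\<^sub>R \<phi> w)" for k
  have X: "X k 0 = z0" "X k (Suc j) = X k j + h k *\<^sub>R \<phi> (X k j)" for k j
    by (simp_all add: X_def)
  have X_lip: "norm (X k (j + i) - X k j) \<le> M * (real i * h k)" for k i j
  proof (induction i)
    case (Suc i)
    have "norm (X k (j + Suc i) - X k j) \<le> norm (X k (j + i) - X k j) + norm (h k *\<^sub>R \<phi> (X k (j + i)))"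
      using norm_triangle_ineq[of "X k (j + i) - X k j" "h k *\<^sub>R \<phi> (X k (j + i))"] by (simp add: X algebra_simps)
    also have "\<dots> \<le> M * (real i * h k) + M * h k"
      using Suc \<phi>_le[of "X k (j + i)"] h[of k] by (intro add_mono) (auto simp: mult.commute)
    finally show ?case by (simp add: algebra_simps)
  qed simp
  define J where "J k t = nat \<lfloor>t * real (Suc k)\<rfloor>" for k t
  have J: "real (J k t) * h k \<le> t" "t < real (J k t) * h k + h k" if "0 \<le> t" for k t
  proof -
    have "real (J k t) \<le> t * real (Suc k)" "t * real (Suc k) < real (J k t) + 1"
      using that unfolding J_def by (auto simp: of_nat_nat mult_nonneg_nonneg)
    then show "real (J k t) * h k \<le> t" "t < real (J k t) * h k + h k"
      unfolding h_def by (simp_all add: field_simps)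
  qed
  have J_mono: "J k s \<le> J k t" if "s \<le> t" for k s t
    unfolding J_def by (intro nat_mono floor_mono mult_right_mono that) auto
  define y where "y k t = X k (J k t)" for k t
  have y0: "y k 0 = z0" for k by (simp add: y_def J_def X)
  have y_lip: "norm (y k t - y k s) \<le> M * (t - s + h k)" if "0 \<le> s" "s \<le> t" for k s t
  proof -
    have "norm (y k t - y k s) \<le> M * (real (J k t - J k s) * h k)"
      using X_lip[of k "J k s" "J k t - J k s"] J_mono[OF that(2), of k] by (simp add: y_def)
    also have "real (J k t - J k s) * h k = real (J k t) * h k - real (J k s) * h k"
      using J_mono[OF that(2), of k] by (simp add: of_nat_diff algebra_simps)
    also have "\<dots> \<le> t - s + h k"
      using J[of t k] J[of s k] that by simp
    finally show ?thesis using \<open>0 \<le> M\<close> by (simp add: mult_left_mono)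
  qed
  have y_z0: "norm (y k t - z0) \<le> M * \<bar>t\<bar>" for k t
  proof (cases "0 \<le> t")
    case True
    have "norm (y k t - z0) \<le> M * (real (J k t) * h k)"
      using X_lip[of k 0 "J k t"] by (simp add: y_def X)
    also have "\<dots> \<le> M * t" using J[OF True, of k] \<open>0 \<le> M\<close> by (intro mult_left_mono)
    finally show ?thesis using True by simp
  next
    case False
    then have "t * real (Suc k) \<le> 0" by (intro mult_nonpos_nonneg) auto
    then have "J k t = 0" by (simp add: J_def)
    then show ?thesis using \<open>0 \<le> M\<close> by (simp add: y_def X)
  qed
  \<comment> \<open>The product is taken over all real times; at negative ones the step functions
    rest at \<open>z0\<close>, hence \<open>\<bar>t\<bar>\<close> in the radius.\<close>
  obtain x where cluster: "\<And>A n e. finite A \<Longrightarrow> 0 < e \<Longrightarrow> \<exists>k\<ge>n. \<forall>t\<in>A. dist (y k t) (x t) < e"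
    by (rule pointwise_cluster_point[of y "\<lambda>t. cball z0 (M * \<bar>t\<bar>)"])
       (use y_z0 in \<open>auto simp: dist_norm norm_minus_commute\<close>)
  have close: "\<exists>k. h k < e \<and> (\<forall>t\<in>A. dist (y k t) (x t) < e)" if A: "finite A" "0 < e" for A e
  proof -
    obtain n where "\<And>k. n \<le> k \<Longrightarrow> h k < e"
      using order_tendstoD(2)[OF LIMSEQ_inverse_real_of_nat A(2)] by (auto simp: h_def eventually_sequentially)
    with cluster[OF A, of n] show ?thesis by blast
  qed
  have x0: "x 0 = z0"
  proof (rule ccontr)
    assume "x 0 \<noteq> z0"
    then show False using close[of "{0}" "dist z0 (x 0)"] y0 by auto
  qed
  have x_lip: "norm (x t - x s) \<le> M * (t - s)" if st: "0 \<le> s" "s \<le> t" for s t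
  proof (rule le_if_le_add_small)
    fix e :: real assume "0 < e" "e < 1"
    then obtain k where k: "h k < e" "dist (y k t) (x t) < e" "dist (y k s) (x s) < e"
      using close[of "{s, t}" e] by auto
    have "norm (x t - x s) \<le> norm (x t - y k t) + norm (y k t - y k s) + norm (y k s - x s)"
      using norm_triangle_ineq[of "x t - y k t" "y k t - y k s"]
        norm_triangle_ineq[of "x t - y k s" "y k s - x s"] by simp
    also have "\<dots> \<le> e + M * (t - s + e) + e"
      using k y_lip[OF st, of k] mult_left_mono[of "t - s + h k" "t - s + e" M] \<open>0 \<le> M\<close>
      by (intro add_mono) (auto simp: dist_norm norm_minus_commute)
    finally show "norm (x t - x s) \<le> M * (t - s) + (M + 2) * e" by (simp add: algebra_simps)
  qed simp
  have "near \<tau> t (\<lambda>s s'. p \<bullet> (x s' - x s) \<le> c * (s' - s))"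
    if t: "t \<in> {0..<\<tau>}" and eb: "essential_bound f (x t) p c" for t p c
  proof -
    obtain \<delta> where \<delta>: "0 < \<delta>" "\<And>w. w \<in> ball (x t) \<delta> \<Longrightarrow> essential_bound f w p c"
      using essential_bound_ball[OF eb] by metis
    \<comment> \<open>The Euler nodes between \<open>s\<close> and \<open>s'\<close> have times
      within \<open>3 * \<eta>\<close> of \<open>t\<close>, one step included. They are thus within
      \<open>3 * (\<delta> / 8)\<close> of \<open>y k t\<close>, which is within
      \<open>\<delta> / 8\<close> of \<open>x t\<close>, and so stay in the ball where the bound
      \<open>c\<close> is valid.\<close>
    define \<eta> where "\<eta> = \<delta> / (8 * (M + 1))"
    have \<eta>: "0 < \<eta>" "M * \<eta> \<le> \<delta> / 8" "\<eta> \<le> \<delta> / 8"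
      using \<delta>(1) \<open>0 \<le> M\<close> by (auto simp: \<eta>_def field_simps)
    have "p \<bullet> (x s' - x s) \<le> c * (s' - s)"
      if s: "0 \<le> s \<and> s \<le> s' \<and> s' < \<tau> \<and> t - \<eta> < s \<and> s' < t + \<eta>" for s s'
    proof (rule le_if_le_add_small[OF \<open>0 < \<eta>\<close>])
      fix e assume e: "0 < e" "e < \<eta>"
      then obtain k where k: "h k < e" "dist (y k s') (x s') < e" "dist (y k s) (x s) < e" "dist (y k t) (x t) < e"
        using close[of "{s, s', t}" e] by auto
      have step: "p \<bullet> (X k (Suc j) - X k j) \<le> h k * c" if j: "J k s \<le> j" "j < J k s'" for j
      proof -
        define u where "u = real j * h k"
        have "real (J k s) * h k \<le> u" "u + h k \<le> real (J k s') * h k"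
          using mult_right_mono[of "real (J k s)" "real j" "h k"]
            mult_right_mono[of "real (Suc j)" "real (J k s')" "h k"] j h[of k]
          by (simp_all add: u_def distrib_right)
        moreover have "0 \<le> u" using h[of k] by (simp add: u_def)
        ultimately have u: "s - h k < u" "u < s'" "0 \<le> u"
          using J[of s k] J[of s' k] s h[of k] by linarith+
        have "u * real (Suc k) = real j" by (simp add: u_def h_def)
        then have "J k u = j" by (simp only: J_def floor_of_nat nat_int)
        then have yu: "y k u = X k j" by (simp add: y_def)
        have "norm (X k j - z0) \<le> M * u"
          using y_z0[of k u] u yu by simp
        also have "\<dots> \<le> M * \<tau>" using u s \<open>0 \<le> M\<close> by (intro mult_left_mono) auto
        finally have "norm (X k j - z0) < R" using \<tau> by simp
        then have "X k j \<in> ball z0 R" by (simp add: dist_norm norm_minus_commute)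
        then have *: "\<phi> (X k j) \<in> filippov f (X k j)" by (rule \<phi>)
        have "norm (X k j - y k t) \<le> M * (\<bar>u - t\<bar> + h k)"
          using y_lip[of u t k] y_lip[of t u k] u(3) t unfolding yu
          by (cases "u \<le> t") (auto simp: norm_minus_commute)
        also have "\<dots> \<le> M * (3 * \<eta>)"
          using u s k(1) e \<open>0 \<le> M\<close> by (intro mult_left_mono) auto
        finally have "norm (X k j - y k t) \<le> 3 * (\<delta> / 8)" using \<eta>(2) by simp
        then have "dist (x t) (X k j) < \<delta>"
          using dist_triangle[of "x t" "X k j" "y k t"] k(4) e \<eta>(3) \<delta>(1)
          by (simp add: dist_norm norm_minus_commute)
        then have "p \<bullet> \<phi> (X k j) \<le> c"
          using filippov_le[OF \<delta>(2) *] by simp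
        then show ?thesis using h[of k] by (simp add: X mult_left_mono)
      qed
      have "p \<bullet> (X k (J k s + i) - X k (J k s)) \<le> real i * h k * c" if "J k s + i \<le> J k s'" for i
        using that
      proof (induction i)
        case (Suc i)
        have "p \<bullet> (X k (J k s + Suc i) - X k (J k s)) =
            p \<bullet> (X k (J k s + i) - X k (J k s)) + p \<bullet> (X k (Suc (J k s + i)) - X k (J k s + i))"
          by (simp add: inner_diff_right)
        also have "\<dots> \<le> real i * h k * c + h k * c"
          using Suc by (intro add_mono step) auto
        finally show ?case by (simp add: algebra_simps)
      qed simp
      from this[of "J k s' - J k s"] have "p \<bullet> (y k s' - y k s) \<le> real (J k s' - J k s) * h k * c"
        using J_mono[of s s' k] s by (simp add: y_def)
      also have "real (J k s' - J k s) * h k = real (J k s') * h k - real (J k s) * h k"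
        using J_mono[of s s' k] s by (simp add: of_nat_diff algebra_simps)
      \<comment> \<open>The Euler steps between \<open>s\<close> and \<open>s'\<close> take the time
        \<open>s' - s\<close> up to an error of one step; the correction costs
        \<open>\<bar>c\<bar> * e\<close> for either sign of \<open>c\<close>.\<close>
      also have "(real (J k s') * h k - real (J k s) * h k) * c \<le> c * (s' - s) + \<bar>c\<bar> * e"
      proof -
        let ?d = "real (J k s') * h k - real (J k s) * h k"
        have "\<bar>?d - (s' - s)\<bar> \<le> e"
          using J[of s k] J[of s' k] s k(1) by auto
        then have "\<bar>c\<bar> * \<bar>?d - (s' - s)\<bar> \<le> \<bar>c\<bar> * e" by (intro mult_left_mono) auto
        then have "c * (?d - (s' - s)) \<le> \<bar>c\<bar> * e"
          using abs_ge_self[of "c * (?d - (s' - s))"] by (simp only: abs_mult)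
        then show ?thesis by (simp add: algebra_simps)
      qed
      finally have 1: "p \<bullet> (y k s' - y k s) \<le> c * (s' - s) + \<bar>c\<bar> * e" .
      have "p \<bullet> (x s' - y k s') \<le> norm p * e" "p \<bullet> (y k s - x s) \<le> norm p * e"
        using k(2,3) by (auto intro!: order_trans[OF norm_cauchy_schwarz] mult_left_mono simp: dist_norm norm_minus_commute)
      with 1 show "p \<bullet> (x s' - x s) \<le> c * (s' - s) + (\<bar>c\<bar> + 2 * norm p) * e"
        by (simp add: inner_diff_right algebra_simps)
    qed
    with \<eta>(1) show ?thesis unfolding near_def by blast
  qed
  moreover have "near \<tau> t (\<lambda>s s'. norm (x s' - x s) \<le> M * (s' - s))" for t
    unfolding near_def using x_lip by (intro exI[of _ 1]) auto
  ultimately have "slope_solution f \<tau> x"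
    unfolding slope_solution_def by blast
  then show thesis
    using that[of x] x0 x_lip[of 0] by simp
qed

section \<open>Gluing and maximal solutions\<close>

lemma slope_solution_near_lipschitz:
  assumes "slope_solution f \<tau> x" "t \<in> {0..<\<tau>}"
  obtains L where "near \<tau> t (\<lambda>s s'. norm (x s' - x s) \<le> L * (s' - s))"
  using assms unfolding slope_solution_def by blast

lemma near_extend:
  assumes "near \<sigma> t P" "t < \<sigma>" and "\<And>s s'. 0 \<le> s \<Longrightarrow> s \<le> s' \<Longrightarrow> s' < \<sigma> \<Longrightarrow> P s s' \<Longrightarrow> Q s s'"
  shows "near \<tau> t Q"
proof -
  obtain \<eta> where "0 < \<eta>" "\<And>s s'. 0 \<le> s \<and> s \<le> s' \<and> s' < \<sigma> \<and> t - \<eta> < s \<and> s' < t + \<eta> \<Longrightarrow> P s s'"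
    using assms(1) unfolding near_def by blast
  then have "Q s s'" if "0 \<le> s" "s \<le> s'" "t - \<eta> < s" "s' < t + \<eta>" "s' < \<sigma>" for s s'
    using assms(3)[of s s'] that by blast
  with \<open>0 < \<eta>\<close> assms(2) show ?thesis
    unfolding near_def by (intro exI[of _ "min \<eta> (\<sigma> - t)"]) (auto simp: min_less_iff_disj)
qed

text \<open>The slope condition at \<open>t\<close> only looks at a neighbourhood of
  \<open>t\<close>, and there \<open>x\<close> coincides with a solution that lives beyond
  \<open>t\<close>. This serves to unite the solutions of a chain.\<close>

lemma slope_solution_local:
  fixes f :: "'a::euclidean_space \<Rightarrow> 'a"
  assumes "\<And>t. t \<in> {0..<\<tau>} \<Longrightarrow> \<exists>\<sigma> w. t < \<sigma> \<and> slope_solution f \<sigma> w \<and> (\<forall>s\<in>{0..<\<sigma>}. x s = w s)"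
  shows "slope_solution f \<tau> x"
  unfolding slope_solution_def
proof (intro ballI)
  fix t assume t: "t \<in> {0..<\<tau>}"
  obtain \<sigma> w where w: "t < \<sigma>" "slope_solution f \<sigma> w" "\<And>s. s \<in> {0..<\<sigma>} \<Longrightarrow> x s = w s"
    using assms[OF t] by blast
  have t': "t \<in> {0..<\<sigma>}" using t w(1) by simp
  obtain L where "near \<sigma> t (\<lambda>s s'. norm (w s' - w s) \<le> L * (s' - s))"
    using slope_solution_near_lipschitz[OF w(2) t'] .
  then have "near \<tau> t (\<lambda>s s'. norm (x s' - x s) \<le> L * (s' - s))"
    by (rule near_extend[OF _ w(1)]) (simp add: w(3))
  moreover have "near \<tau> t (\<lambda>s s'. p \<bullet> (x s' - x s) \<le> c * (s' - s))" if "essential_bound f (x t) p c" for p c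
  proof (rule near_extend[OF _ w(1)])
    show "near \<sigma> t (\<lambda>s s'. p \<bullet> (w s' - w s) \<le> c * (s' - s))"
      using slope_solution_slope[OF w(2) t', of p c] that w(3)[OF t'] by simp
  qed (simp add: w(3))
  ultimately show "(\<exists>L. near \<tau> t (\<lambda>s s'. norm (x s' - x s) \<le> L * (s' - s))) \<and>
      (\<forall>p c. essential_bound f (x t) p c \<longrightarrow> near \<tau> t (\<lambda>s s'. p \<bullet> (x s' - x s) \<le> c * (s' - s)))"
    by blast
qed

text \<open>It suffices to test the slope condition in the single direction
  \<open>x b - x a\<close>, where the increment becomes the square of its own norm.\<close>

lemma slope_solution_speed:
  fixes f :: "'a::euclidean_space \<Rightarrow> 'a"
  assumes x: "slope_solution f \<tau> x" and ab: "0 \<le> a" "a \<le> b" "b < \<tau>"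
    and M: "0 \<le> M" "\<And>t. a \<le> t \<Longrightarrow> t \<le> b \<Longrightarrow> \<exists>\<delta>>0. \<forall>w\<in>ball (x t) \<delta>. norm (f w) \<le> M"
  shows "norm (x b - x a) \<le> M * (b - a)"
proof -
  let ?p = "x b - x a"
  have "?p \<bullet> (x b - x a) \<le> norm ?p * M * (b - a)"
  proof (rule slope_near_interval[OF ab])
    fix t assume t: "a \<le> t" "t \<le> b"
    then obtain \<delta> where "0 < \<delta>" "\<And>w. w \<in> ball (x t) \<delta> \<Longrightarrow> norm (f w) \<le> M"
      using M(2) by blast
    then have "essential_bound f (x t) ?p (norm ?p * M)" by (rule essential_bound_norm)
    then show "near \<tau> t (\<lambda>s s'. ?p \<bullet> (x s' - x s) \<le> norm ?p * M * (s' - s))"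
      using slope_solution_slope[OF x] t ab by auto
  qed
  then have "norm ?p * norm ?p \<le> norm ?p * (M * (b - a))"
    by (simp add: power2_norm_eq_inner[symmetric] power2_eq_square mult.assoc)
  then show ?thesis
    using M(1) ab by (cases "norm ?p = 0") auto
qed

text \<open>Both the Lipschitz and the slope conditions say that \<open>(x s' - x s, s' - s)\<close> lies in a closed
  set \<open>K\<close> that is stable under addition.\<close>

lemma near_junction:
  fixes x y :: "real \<Rightarrow> 'a::euclidean_space"
  assumes K: "closed K" "\<And>a b. a \<in> K \<Longrightarrow> b \<in> K \<Longrightarrow> a + b \<in> K"
    and \<tau>: "0 < \<tau>" and lim: "(x \<longlongrightarrow> z) (at_left \<tau>)" and y0: "y 0 = z"
    and left: "0 < \<eta>" "\<And>s s'. 0 \<le> s \<Longrightarrow> s \<le> s' \<Longrightarrow> s' < \<tau> \<Longrightarrow> \<tau> - \<eta> < s \<Longrightarrow> (x s' - x s, s' - s) \<in> K"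
    and right: "near \<rho> 0 (\<lambda>s s'. (y s' - y s, s' - s) \<in> K)"
  defines "w \<equiv> \<lambda>t. if t < \<tau> then x t else y (t - \<tau>)"
  shows "near (\<tau> + \<rho>) \<tau> (\<lambda>s s'. (w s' - w s, s' - s) \<in> K)"
proof -
  obtain \<eta>' where \<eta>': "0 < \<eta>'" and
    r: "\<And>s s'. 0 \<le> s \<and> s \<le> s' \<and> s' < \<rho> \<and> 0 - \<eta>' < s \<and> s' < 0 + \<eta>' \<Longrightarrow> (y s' - y s, s' - s) \<in> K"
    using right unfolding near_def by blast
  \<comment> \<open>The condition on \<open>x\<close> stops before \<tau>; closedness of
    \<open>K\<close> carries it to the end value \<open>z\<close>, and additivity then joins it to
    the increments of \<open>y\<close>.\<close>
  have l: "(z - x s, \<tau> - s) \<in> K" if s: "0 \<le> s" "s < \<tau>" "\<tau> - \<eta> < s" for s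
  proof (rule Lim_in_closed_set[OF K(1)])
    show "((\<lambda>s'. (x s' - x s, s' - s)) \<longlongrightarrow> (z - x s, \<tau> - s)) (at_left \<tau>)"
      by (intro tendsto_intros lim)
    have "\<forall>\<^sub>F s' in at_left \<tau>. s' \<in> {s<..<\<tau>}"
      unfolding eventually_at_left_field using s(2) by (intro exI[of _ s]) auto
    then show "\<forall>\<^sub>F s' in at_left \<tau>. (x s' - x s, s' - s) \<in> K"
      by eventually_elim (use s in \<open>auto intro: left(2)\<close>)
  qed simp
  have "(w s' - w s, s' - s) \<in> K"
    if s: "0 \<le> s" "s \<le> s'" "s' < \<tau> + \<rho>" "\<tau> - min \<eta> \<eta>' < s" "s' < \<tau> + min \<eta> \<eta>'" for s s'
  proof -
    consider "s' < \<tau>" | "\<tau> \<le> s" | "s < \<tau>" "\<tau> \<le> s'" by linarith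
    then show ?thesis
    proof cases
      case 1
      then show ?thesis using left(2)[of s s'] s by (auto simp: w_def)
    next
      case 2
      then show ?thesis using r[of "s - \<tau>" "s' - \<tau>"] \<eta>' s by (auto simp: w_def)
    next
      case 3
      have "(z - x s, \<tau> - s) + (y (s' - \<tau>) - y 0, s' - \<tau> - 0) \<in> K"
        using 3 s \<eta>' by (intro K(2) l r) auto
      then show ?thesis using 3 by (simp add: w_def y0)
    qed
  qed
  with left(1) \<eta>' show ?thesis unfolding near_def by (intro exI[of _ "min \<eta> \<eta>'"]) auto
qed

lemma near_shift:
  assumes "near \<rho> (t - \<tau>) (\<lambda>s s'. P s s')" "\<tau> < t"
  shows "near (\<tau> + \<rho>) t (\<lambda>s s'. \<tau> \<le> s \<and> \<tau> \<le> s' \<and> P (s - \<tau>) (s' - \<tau>))"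
proof -
  obtain \<eta> where "0 < \<eta>" "\<And>s s'. 0 \<le> s \<and> s \<le> s' \<and> s' < \<rho> \<and> t - \<tau> - \<eta> < s \<and> s' < t - \<tau> + \<eta> \<Longrightarrow> P s s'"
    using assms(1) unfolding near_def by blast
  then have "P (s - \<tau>) (s' - \<tau>)"
    if "\<tau> < s" "s \<le> s'" "s' < \<tau> + \<rho>" "t - \<eta> < s" "s' < t + \<eta>" for s s'
    using that by simp
  with \<open>0 < \<eta>\<close> assms(2) show ?thesis
    unfolding near_def by (intro exI[of _ "min \<eta> (t - \<tau>)"]) auto
qed

text \<open>The delicate time is the junction \<tau>, since the Lipschitz constants of
  \<open>x\<close> are uniform only on compact parts of \<open>[0, \<tau>)\<close>. The bound on
  \<open>f\<close> near the limit \<open>z\<close> limits the speed up to \<tau>, and an essential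
  bound at \<open>z\<close> is also one at the nearby points of \<open>x\<close>.\<close>

lemma slope_solution_concat:
  fixes f :: "'a::euclidean_space \<Rightarrow> 'a"
  assumes x: "slope_solution f \<tau> x" and y: "slope_solution f \<rho> y" and pos: "0 < \<tau>" "0 < \<rho>"
    and lim: "(x \<longlongrightarrow> z) (at_left \<tau>)" and y0: "y 0 = z"
    and R: "0 < R" "\<And>w. w \<in> ball z R \<Longrightarrow> norm (f w) \<le> M"
  defines "w \<equiv> \<lambda>t. if t < \<tau> then x t else y (t - \<tau>)"
  shows "slope_solution f (\<tau> + \<rho>) w"
proof -
  have M: "0 \<le> M" using order_trans[OF norm_ge_zero R(2)[of z]] R(1) by simp
  have lim_ball: "\<exists>\<eta>>0. \<forall>s. \<tau> - \<eta> < s \<longrightarrow> s < \<tau> \<longrightarrow> x s \<in> ball z \<delta>" if "0 < \<delta>" for \<delta>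
  proof -
    have "\<forall>\<^sub>F s in at_left \<tau>. x s \<in> ball z \<delta>"
      using tendstoD[OF lim that] by (simp add: dist_commute)
    then obtain b where b: "b < \<tau>" "\<And>s. b < s \<Longrightarrow> s < \<tau> \<Longrightarrow> x s \<in> ball z \<delta>"
      unfolding eventually_at_left_field by blast
    then show ?thesis by (intro exI[of _ "\<tau> - b"]) auto
  qed
  have below: "near (\<tau> + \<rho>) t (\<lambda>s s'. P (w s' - w s) (s' - s))"
    if "near \<tau> t (\<lambda>s s'. P (x s' - x s) (s' - s))" "t < \<tau>" for P t
    by (rule near_extend[OF that]) (simp add: w_def)
  have above: "near (\<tau> + \<rho>) t (\<lambda>s s'. P (w s' - w s) (s' - s))"
    if "near \<rho> (t - \<tau>) (\<lambda>s s'. P (y s' - y s) (s' - s))" "\<tau> < t" for P t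
    by (rule near_mono[OF near_shift[OF that]]) (auto simp: w_def near_def)
  have junction: "near (\<tau> + \<rho>) \<tau> (\<lambda>s s'. P (w s' - w s) (s' - s))"
    if "closed {(u, a). P u a}" "\<And>u a v b. P u a \<Longrightarrow> P v b \<Longrightarrow> P (u + v) (a + b)"
      "0 < \<eta>" "\<And>s s'. 0 \<le> s \<Longrightarrow> s \<le> s' \<Longrightarrow> s' < \<tau> \<Longrightarrow> \<tau> - \<eta> < s \<Longrightarrow> P (x s' - x s) (s' - s)"
      "near \<rho> 0 (\<lambda>s s'. P (y s' - y s) (s' - s))" for P \<eta>
  proof -
    have "near (\<tau> + \<rho>) \<tau> (\<lambda>s s'. (w s' - w s, s' - s) \<in> {(u, a). P u a})"
      unfolding w_def by (rule near_junction[where z = z and \<eta> = \<eta>]) (use that pos lim y0 in auto)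
    then show ?thesis by simp
  qed
  have Lip: "\<exists>L. near (\<tau> + \<rho>) t (\<lambda>s s'. norm (w s' - w s) \<le> L * (s' - s))" if t: "t \<in> {0..<\<tau> + \<rho>}" for t
  proof -
    consider "t < \<tau>" | "\<tau> < t" | "t = \<tau>" by linarith
    then show ?thesis
    proof cases
      case 1
      then obtain L where "near \<tau> t (\<lambda>s s'. norm (x s' - x s) \<le> L * (s' - s))"
        using slope_solution_near_lipschitz[OF x, of t] t by auto
      from below[OF this 1] show ?thesis by blast
    next
      case 2
      then obtain L where "near \<rho> (t - \<tau>) (\<lambda>s s'. norm (y s' - y s) \<le> L * (s' - s))"
        using slope_solution_near_lipschitz[OF y, of "t - \<tau>"] t by auto
      from above[OF this 2] show ?thesis by blast
    next
      case 3
      obtain L where L: "near \<rho> 0 (\<lambda>s s'. norm (y s' - y s) \<le> L * (s' - s))"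
        using slope_solution_near_lipschitz[OF y, of 0] pos by auto
      let ?L = "max L M"
      obtain \<eta> where \<eta>: "0 < \<eta>" "\<And>s. \<tau> - \<eta> < s \<Longrightarrow> s < \<tau> \<Longrightarrow> x s \<in> ball z R"
        using lim_ball[OF R(1)] by blast
      have left: "norm (x s' - x s) \<le> ?L * (s' - s)" if s: "0 \<le> s" "s \<le> s'" "s' < \<tau>" "\<tau> - \<eta> < s" for s s'
      proof -
        have "norm (x s' - x s) \<le> M * (s' - s)"
        proof (rule slope_solution_speed[OF x s(1-3) M])
          fix t assume "s \<le> t" "t \<le> s'"
          then have "x t \<in> ball z R" using s by (intro \<eta>(2)) auto
          then obtain e where "0 < e" "ball (x t) e \<subseteq> ball z R" using openE[OF open_ball] by blast
          with R(2) show "\<exists>\<delta>>0. \<forall>w\<in>ball (x t) \<delta>. norm (f w) \<le> M" by blast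
        qed
        also have "\<dots> \<le> ?L * (s' - s)" using s by (intro mult_right_mono) auto
        finally show ?thesis .
      qed
      have right: "near \<rho> 0 (\<lambda>s s'. norm (y s' - y s) \<le> ?L * (s' - s))"
      proof (rule near_extend[OF L pos(2)])
        fix s s' assume "s \<le> s'" "norm (y s' - y s) \<le> L * (s' - s)"
        then show "norm (y s' - y s) \<le> ?L * (s' - s)"
          using mult_right_mono[of L ?L "s' - s"] by simp
      qed
      have "near (\<tau> + \<rho>) \<tau> (\<lambda>s s'. norm (w s' - w s) \<le> ?L * (s' - s))"
      proof (rule junction[OF _ _ \<eta>(1) left right])
        show "closed {(u::'a, a). norm u \<le> ?L * a}"
          unfolding case_prod_beta by (intro closed_Collect_le continuous_intros)
        show "norm (u + v) \<le> ?L * (a + b)" if "norm u \<le> ?L * a" "norm v \<le> ?L * b" for u v :: 'a and a b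
          using norm_triangle_ineq[of u v] that by (simp add: distrib_left)
      qed auto
      with 3 show ?thesis by blast
    qed
  qed
  have slope: "near (\<tau> + \<rho>) t (\<lambda>s s'. p \<bullet> (w s' - w s) \<le> c * (s' - s))"
    if t: "t \<in> {0..<\<tau> + \<rho>}" and eb: "essential_bound f (w t) p c" for t p c
  proof -
    consider "t < \<tau>" | "\<tau> < t" | "t = \<tau>" by linarith
    then show ?thesis
    proof cases
      case 1
      then show ?thesis
        using slope_solution_slope[OF x, of t p c] eb t by (intro below) (auto simp: w_def)
    next
      case 2
      then show ?thesis
        using slope_solution_slope[OF y, of "t - \<tau>" p c] eb t by (intro above) (auto simp: w_def)
    next
      case 3
      then have eb': "essential_bound f z p c" using eb y0 by (simp add: w_def)
      obtain \<delta> where \<delta>: "0 < \<delta>" "\<And>u. u \<in> ball z \<delta> \<Longrightarrow> essential_bound f u p c"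
        using essential_bound_ball[OF eb'] by metis
      obtain \<eta> where \<eta>: "0 < \<eta>" "\<And>s. \<tau> - \<eta> < s \<Longrightarrow> s < \<tau> \<Longrightarrow> x s \<in> ball z \<delta>"
        using lim_ball[OF \<delta>(1)] by blast
      have left: "p \<bullet> (x s' - x s) \<le> c * (s' - s)" if s: "0 \<le> s" "s \<le> s'" "s' < \<tau>" "\<tau> - \<eta> < s" for s s'
        using s by (intro slope_near_interval[OF s(1-3)] slope_solution_slope[OF x] \<delta>(2) \<eta>(2)) auto
      have right: "near \<rho> 0 (\<lambda>s s'. p \<bullet> (y s' - y s) \<le> c * (s' - s))"
        using slope_solution_slope[OF y, of 0 p c] eb' y0 pos by auto
      have "near (\<tau> + \<rho>) \<tau> (\<lambda>s s'. p \<bullet> (w s' - w s) \<le> c * (s' - s))"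
      proof (rule junction[OF _ _ \<eta>(1) left right])
        show "closed {(u::'a, a). p \<bullet> u \<le> c * a}"
          unfolding case_prod_beta by (intro closed_Collect_le continuous_intros)
        show "p \<bullet> (u + v) \<le> c * (a + b)" if "p \<bullet> u \<le> c * a" "p \<bullet> v \<le> c * b" for u v :: 'a and a b
          using that by (simp add: distrib_left inner_add_right)
      qed auto
      with 3 show ?thesis by simp
    qed
  qed
  show ?thesis
    unfolding slope_solution_def using Lip slope by blast
qed

text \<open>Solutions are ordered by inclusion of their graphs. The bound \<open>B\<close> on the
  lifetimes gives a chain a finite supremum as lifetime of its union; a maximal solution with a
  limit in \<open>U\<close> could be prolonged by a local solution that starts at this
  limit.\<close>

theorem maximal_slope_solution:
  fixes f :: "'a::euclidean_space \<Rightarrow> 'a"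
  assumes U: "open U" "z0 \<in> U"
    and bd: "\<And>z. z \<in> U \<Longrightarrow> \<exists>\<delta>>0. \<exists>M. \<forall>w\<in>ball z \<delta>. norm (f w) \<le> M"
    and B: "\<And>\<tau> x. slope_solution f \<tau> x \<Longrightarrow> x 0 = z0 \<Longrightarrow> \<forall>t\<in>{0..<\<tau>}. x t \<in> U \<Longrightarrow> \<tau> \<le> B"
  shows "\<exists>\<tau> x. 0 < \<tau> \<and> slope_solution f \<tau> x \<and> x 0 = z0 \<and> (\<forall>t\<in>{0..<\<tau>}. x t \<in> U) \<and>
    (\<forall>z. (x \<longlongrightarrow> z) (at_left \<tau>) \<longrightarrow> z \<notin> U)"
proof -
  define sol where "sol \<tau> x \<longleftrightarrow> 0 < \<tau> \<and> slope_solution f \<tau> x \<and> x 0 = z0 \<and> (\<forall>t\<in>{0..<\<tau>}. x t \<in> U)" for \<tau> x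
  define graph where "graph \<tau> x = (\<lambda>t. (t, x t)) ` {0..<\<tau>}" for \<tau> :: real and x :: "real \<Rightarrow> 'a"
  define \<A> where "\<A> = {graph \<tau> x |\<tau> x. sol \<tau> x}"
  have graph_iff: "(t, z) \<in> graph \<tau> x \<longleftrightarrow> 0 \<le> t \<and> t < \<tau> \<and> z = x t" for t z \<tau> x
    by (auto simp: graph_def)
  have local: "\<exists>R M \<rho> y. 0 < R \<and> (\<forall>w\<in>ball z R. norm (f w) \<le> M) \<and> 0 < \<rho> \<and> slope_solution f \<rho> y \<and>
      y 0 = z \<and> (\<forall>t\<in>{0..<\<rho>}. y t \<in> U)" if "z \<in> U" for z
  proof -
    obtain \<delta> M where \<delta>: "0 < \<delta>" "\<And>w. w \<in> ball z \<delta> \<Longrightarrow> norm (f w) \<le> M"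
      using bd[OF \<open>z \<in> U\<close>] by blast
    obtain e where e: "0 < e" "ball z e \<subseteq> U"
      using openE[OF U(1) \<open>z \<in> U\<close>] .
    define R where "R = min \<delta> e"
    have R: "0 < R" "\<And>w. w \<in> ball z R \<Longrightarrow> norm (f w) \<le> M" "ball z R \<subseteq> U"
      using \<delta> e by (auto simp: R_def)
    have M: "0 \<le> M" using order_trans[OF norm_ge_zero R(2)[of z]] R(1) by simp
    define \<rho> where "\<rho> = R / (M + 1)"
    have \<rho>: "0 < \<rho>" "M * \<rho> < R"
      using R(1) M by (auto simp: \<rho>_def field_simps)
    obtain y where y: "slope_solution f \<rho> y" "y 0 = z" "\<forall>t\<ge>0. norm (y t - z) \<le> M * t"
      by (rule local_slope_solution[OF R(1,2) \<rho>(2)])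
    have "y t \<in> U" if t: "t \<in> {0..<\<rho>}" for t
    proof -
      have "norm (y t - z) \<le> M * \<rho>"
        using y(3) t mult_left_mono[of t \<rho> M] M by auto
      then have "y t \<in> ball z R" using \<rho> by (simp add: dist_norm norm_minus_commute)
      with R(3) show ?thesis by blast
    qed
    with R \<rho> y show ?thesis by blast
  qed
  have "\<exists>G\<in>\<A>. \<forall>X\<in>\<A>. G \<subseteq> X \<longrightarrow> X = G"
  proof (rule subset_Zorn_nonempty)
    show "\<A> \<noteq> {}"
      using local[OF U(2)] unfolding \<A>_def sol_def by blast
    fix C assume C: "C \<noteq> {}" "subset.chain \<A> C"
    have mem: "\<exists>\<sigma> w. G = graph \<sigma> w \<and> sol \<sigma> w" if "G \<in> C" for G
      using C(2) that unfolding subset.chain_def \<A>_def by blast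
    have unique: "z = z'" if zz: "(t, z) \<in> \<Union>C" "(t, z') \<in> \<Union>C" for t z z'
    proof -
      obtain G G' where G: "G \<in> C" "(t, z) \<in> G" "G' \<in> C" "(t, z') \<in> G'" using zz by blast
      then have "G \<subseteq> G' \<or> G' \<subseteq> G" using C(2) unfolding subset.chain_def by blast
      with G mem[OF G(1)] mem[OF G(3)] graph_iff show ?thesis by auto
    qed
    define Ts where "Ts = {\<sigma>. \<exists>w. sol \<sigma> w \<and> graph \<sigma> w \<in> C}"
    define \<tau> where "\<tau> = Sup Ts"
    define x where "x t = (SOME z. (t, z) \<in> \<Union>C)" for t
    have bdd: "bdd_above Ts"
      using B unfolding Ts_def sol_def by (intro bdd_aboveI[of _ B]) blast
    have "Ts \<noteq> {}"
      using C(1) mem unfolding Ts_def by blast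
    have x: "x t = w t" if "graph \<sigma> w \<in> C" "0 \<le> t" "t < \<sigma>" for \<sigma> w t
    proof -
      have "(t, w t) \<in> \<Union>C" using that graph_iff by blast
      moreover have "(t, x t) \<in> \<Union>C" unfolding x_def by (rule someI) fact
      ultimately show ?thesis by (metis unique)
    qed
    have cover: "\<exists>\<sigma> w. t < \<sigma> \<and> sol \<sigma> w \<and> graph \<sigma> w \<in> C" if "t < \<tau>" for t
      using that less_cSup_iff[OF \<open>Ts \<noteq> {}\<close> bdd] unfolding \<tau>_def Ts_def by blast
    have le: "\<sigma> \<le> \<tau>" if "sol \<sigma> w" "graph \<sigma> w \<in> C" for \<sigma> w
      unfolding \<tau>_def by (rule cSup_upper[OF _ bdd]) (use that in \<open>auto simp: Ts_def\<close>)
    have "\<Union>C = graph \<tau> x"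
    proof (intro set_eqI iffI)
      fix p assume "p \<in> \<Union>C"
      then obtain \<sigma> w where "p \<in> graph \<sigma> w" "sol \<sigma> w" "graph \<sigma> w \<in> C" using mem by blast
      with x le show "p \<in> graph \<tau> x" by (cases p) (fastforce simp: graph_iff)
    next
      fix p assume p: "p \<in> graph \<tau> x"
      obtain t where t: "p = (t, x t)" "0 \<le> t" "t < \<tau>" using p by (auto simp: graph_def)
      obtain \<sigma> w where w: "t < \<sigma>" "graph \<sigma> w \<in> C" using cover[OF t(3)] by blast
      then have "p \<in> graph \<sigma> w" using x[OF w(2) t(2) w(1)] t by (simp add: graph_iff)
      with w(2) show "p \<in> \<Union>C" by blast
    qed
    moreover have "sol \<tau> x"
      unfolding sol_def
    proof (intro conjI ballI)
      obtain \<sigma> w where w: "sol \<sigma> w" "graph \<sigma> w \<in> C" using C(1) mem by blast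
      then show "0 < \<tau>" using le[OF w] by (simp add: sol_def)
      show "x 0 = z0" using w x[OF w(2), of 0] by (simp add: sol_def)
      show "slope_solution f \<tau> x"
      proof (rule slope_solution_local)
        fix t assume "t \<in> {0..<\<tau>}"
        then have "t < \<tau>" by simp
        then obtain \<sigma> w where w: "t < \<sigma>" "sol \<sigma> w" "graph \<sigma> w \<in> C" using cover by blast
        have "\<forall>s\<in>{0..<\<sigma>}. x s = w s" using x[OF w(3)] by simp
        with w show "\<exists>\<sigma> w. t < \<sigma> \<and> slope_solution f \<sigma> w \<and> (\<forall>s\<in>{0..<\<sigma>}. x s = w s)"
          unfolding sol_def by blast
      qed
      fix t assume t: "t \<in> {0..<\<tau>}"
      then have "t < \<tau>" by simp
      then obtain \<sigma> w where w: "t < \<sigma>" "sol \<sigma> w" "graph \<sigma> w \<in> C" using cover by blast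
      then show "x t \<in> U" using t x[OF w(3), of t] by (simp add: sol_def)
    qed
    ultimately show "\<Union>C \<in> \<A>" unfolding \<A>_def by blast
  qed
  then obtain G where G: "G \<in> \<A>" "\<forall>X\<in>\<A>. G \<subseteq> X \<longrightarrow> X = G" by blast
  obtain \<tau> x where x: "sol \<tau> x" and "G = graph \<tau> x"
    using G(1) unfolding \<A>_def by blast
  with G(2) have max: "\<And>X. X \<in> \<A> \<Longrightarrow> graph \<tau> x \<subseteq> X \<Longrightarrow> X = graph \<tau> x" by blast
  have "z \<notin> U" if lim: "(x \<longlongrightarrow> z) (at_left \<tau>)" for z
  proof
    assume "z \<in> U"
    then obtain R M \<rho> y where R: "0 < R" "\<forall>w\<in>ball z R. norm (f w) \<le> M"
      and y: "0 < \<rho>" "slope_solution f \<rho> y" "y 0 = z" "\<forall>t\<in>{0..<\<rho>}. y t \<in> U"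
      using local by blast
    define w where "w t = (if t < \<tau> then x t else y (t - \<tau>))" for t
    have "slope_solution f (\<tau> + \<rho>) w"
      unfolding w_def using x y(1) by (intro slope_solution_concat[OF _ y(2) _ _ lim y(3) R(1) R(2)[rule_format]]) (auto simp: sol_def)
    then have "sol (\<tau> + \<rho>) w"
      using x y(1) unfolding sol_def by (auto simp: w_def y(4))
    moreover have "graph \<tau> x \<subseteq> graph (\<tau> + \<rho>) w"
      using y(1) by (auto simp: graph_def w_def)
    ultimately have "graph (\<tau> + \<rho>) w = graph \<tau> x"
      using max unfolding \<A>_def by blast
    moreover have "(\<tau>, w \<tau>) \<in> graph (\<tau> + \<rho>) w" "(\<tau>, w \<tau>) \<notin> graph \<tau> x"
      using x y(1) by (auto simp: graph_iff sol_def)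
    ultimately show False by simp
  qed
  with x show ?thesis unfolding sol_def by blast
qed

text \<open>First exit argument: until the ball is left the speed is at most \<open>M\<close>, and
  in the remaining time \<open>\<tau> - t0\<close> this is too slow to reach the sphere. Continuity
  extends the estimate to the exit time.\<close>

lemma slope_solution_trapped:
  fixes f :: "'a::euclidean_space \<Rightarrow> 'a"
  assumes x: "slope_solution f \<tau> x" and t0: "0 \<le> t0" "t0 \<le> t" "t < \<tau>" and R: "0 < R"
    and M: "\<And>w. w \<in> ball z R \<Longrightarrow> norm (f w) \<le> M"
    and dist: "dist (x t0) z + M * (\<tau> - t0) < R"
  shows "dist (x t) z < R"
proof (rule ccontr)
  assume neg: "\<not> dist (x t) z < R"
  have M0: "0 \<le> M" using order_trans[OF norm_ge_zero M[of z]] R by simp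
  have cont: "continuous_on {t0..t} x"
    by (rule continuous_on_subset[OF slope_solution_continuous_on[OF x]]) (use t0 in auto)
  define S where "S = {s \<in> {t0..t}. R \<le> dist (x s) z}"
  have "closed S"
    unfolding S_def by (intro continuous_on_closed_Collect_le continuous_intros cont)
  moreover have "bounded S"
    by (rule bounded_subset[of "{t0..t}"]) (auto simp: S_def)
  ultimately have "compact S" by (simp add: compact_eq_bounded_closed)
  moreover have "S \<noteq> {}" using neg t0 by (auto simp: S_def)
  ultimately obtain t1 where t1: "t1 \<in> S" "\<forall>s\<in>S. t1 \<le> s"
    using compact_attains_inf[of S] by blast
  have "dist (x t0) z < R"
    using dist M0 t0 mult_nonneg_nonneg[of M "\<tau> - t0"] by linarith
  then have t01: "t0 < t1" "t1 \<le> t"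
    using t1(1) by (auto simp: S_def le_less)
  have inside: "x s \<in> ball z R" if "t0 \<le> s" "s < t1" for s
    using t1(2) that t01 by (auto simp: S_def dist_commute not_le[symmetric])
  have speed: "norm (x s - x t0) \<le> M * (\<tau> - t0)" if s: "t0 < s" "s < t1" for s
  proof -
    have "norm (x s - x t0) \<le> M * (s - t0)"
    proof (rule slope_solution_speed[OF x t0(1) _ _ M0])
      fix r assume "t0 \<le> r" "r \<le> s"
      then have "x r \<in> ball z R" using inside s by simp
      then obtain e where "0 < e" "ball (x r) e \<subseteq> ball z R" using openE[OF open_ball] by blast
      with M show "\<exists>\<delta>>0. \<forall>w\<in>ball (x r) \<delta>. norm (f w) \<le> M" by blast
    qed (use s t01 t0 in auto)
    also have "\<dots> \<le> M * (\<tau> - t0)" using M0 s t01 t0 by (intro mult_left_mono) auto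
    finally show ?thesis .
  qed
  have "continuous_on {t0..t1} x"
    by (rule continuous_on_subset[OF cont]) (use t01 in auto)
  then have "(x \<longlongrightarrow> x t1) (at_left t1)"
    using t01(1) by (simp add: continuous_on_Icc_at_leftD)
  then have lim: "((\<lambda>s. norm (x s - x t0)) \<longlongrightarrow> norm (x t1 - x t0)) (at_left t1)"
    by (intro tendsto_intros)
  have "\<forall>\<^sub>F s in at_left t1. norm (x s - x t0) \<le> M * (\<tau> - t0)"
    unfolding eventually_at_left_field using t01(1) speed by (intro exI[of _ t0]) auto
  then have "norm (x t1 - x t0) \<le> M * (\<tau> - t0)"
    by (intro tendsto_upperbound[OF lim]) auto
  then have "dist (x t1) z < R"
    using dist_triangle[of "x t1" z "x t0"] dist by (simp add: dist_norm)
  with t1(1) show False by (simp add: S_def)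
qed

text \<open>Near a cluster point other than 0 the field is bounded, so a solution that comes close
  to it late enough has no time left to move away. If there is no such cluster point, boundedness
  leaves 0 as the only possible limit, although the speed there is not controlled.\<close>

lemma bounded_slope_solution_converges:
  fixes f :: "'a::euclidean_space \<Rightarrow> 'a"
  assumes x: "slope_solution f \<tau> x" and \<tau>: "0 < \<tau>" and bounded: "bounded (x ` {0..<\<tau>})"
    and bd: "\<And>z. z \<noteq> 0 \<Longrightarrow> \<exists>\<delta>>0. \<exists>M. \<forall>w\<in>ball z \<delta>. norm (f w) \<le> M"
  shows "\<exists>z. (x \<longlongrightarrow> z) (at_left \<tau>)"
proof (cases "\<exists>z. z \<noteq> 0 \<and> (\<forall>\<eta>>0. \<forall>e>0. \<exists>t. 0 \<le> t \<and> \<tau> - \<eta> < t \<and> t < \<tau> \<and> dist (x t) z < e)")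
  case True
  then obtain z where "z \<noteq> 0"
    and z: "\<forall>\<eta>>0. \<forall>e>0. \<exists>t. 0 \<le> t \<and> \<tau> - \<eta> < t \<and> t < \<tau> \<and> dist (x t) z < e"
    by blast
  obtain R M where R: "0 < R" and "\<forall>w\<in>ball z R. norm (f w) \<le> M"
    using bd[OF \<open>z \<noteq> 0\<close>] by blast
  then have M: "\<And>w. w \<in> ball z R \<Longrightarrow> norm (f w) \<le> M" by blast
  have M0: "0 \<le> M" using order_trans[OF norm_ge_zero M[of z]] R by simp
  have "(x \<longlongrightarrow> z) (at_left \<tau>)"
  proof (rule tendstoI)
    fix e :: real assume "0 < e"
    define e' where "e' = min e R"
    have e': "0 < e'" "e' \<le> e" "e' \<le> R" using \<open>0 < e\<close> R by (auto simp: e'_def)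
    \<comment> \<open>In the remaining time, less than \<eta>, a solution of speed at most
      \<open>M\<close> moves by at most \<open>e' / 2\<close>.\<close>
    define \<eta> where "\<eta> = e' / (2 * (M + 1))"
    have \<eta>: "0 < \<eta>" "M * \<eta> \<le> e' / 2" using e'(1) M0 by (auto simp: \<eta>_def field_simps)
    obtain t0 where t0: "0 \<le> t0" "\<tau> - \<eta> < t0" "t0 < \<tau>" "dist (x t0) z < e' / 2"
      using z[rule_format, OF \<eta>(1), of "e' / 2"] e'(1) by auto
    have "M * (\<tau> - t0) \<le> M * \<eta>" using M0 t0 by (intro mult_left_mono) auto
    then have less: "dist (x t0) z + M * (\<tau> - t0) < e'" using t0(4) \<eta>(2) by linarith
    have "dist (x t) z < e" if t: "t0 < t" "t < \<tau>" for t
    proof -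
      have "dist (x t) z < e'"
        by (rule slope_solution_trapped[OF x t0(1) _ t(2) e'(1) _ less]) (use t M e'(3) in auto)
      with e'(2) show ?thesis by simp
    qed
    then show "\<forall>\<^sub>F t in at_left \<tau>. dist (x t) z < e"
      unfolding eventually_at_left_field using t0(3) by blast
  qed
  then show ?thesis by blast
next
  case False
  have "(x \<longlongrightarrow> 0) (at_left \<tau>)"
  proof (rule tendstoI, rule ccontr)
    fix e :: real assume e: "0 < e" and neg: "\<not> (\<forall>\<^sub>F t in at_left \<tau>. dist (x t) 0 < e)"
    have "\<exists>t. 0 \<le> t \<and> \<tau> - inverse (real (Suc n)) < t \<and> t < \<tau> \<and> e \<le> norm (x t)" for n
    proof (rule ccontr)
      assume "\<not> ?thesis"
      then have "\<forall>t. max 0 (\<tau> - inverse (real (Suc n))) < t \<longrightarrow> t < \<tau> \<longrightarrow> dist (x t) 0 < e"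
        by (auto simp: not_le)
      moreover have "max 0 (\<tau> - inverse (real (Suc n))) < \<tau>" using \<tau> by simp
      ultimately show False using neg unfolding eventually_at_left_field by blast
    qed
    then obtain t where t: "\<And>n. 0 \<le> t n" "\<And>n. \<tau> - inverse (real (Suc n)) < t n" "\<And>n. t n < \<tau>"
      "\<And>n. e \<le> norm (x (t n))" by metis
    have "bounded (range (x \<circ> t))"
      by (rule bounded_subset[OF bounded]) (use t in auto)
    then obtain l r where r: "strict_mono r" "((x \<circ> t) \<circ> r) \<longlonglongrightarrow> l"
      using bounded_imp_convergent_subsequence by blast
    have "e \<le> norm l"
      by (rule tendsto_lowerbound[OF tendsto_norm[OF r(2)]]) (auto simp: t(4))
    then have "l \<noteq> 0" using e by auto
    moreover have "\<exists>s. 0 \<le> s \<and> \<tau> - \<eta> < s \<and> s < \<tau> \<and> dist (x s) l < \<epsilon>" if "0 < \<eta>" "0 < \<epsilon>" for \<eta> \<epsilon>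
    proof -
      have "\<forall>\<^sub>F n in sequentially. inverse (real (Suc (r n))) < \<eta>"
        using order_tendstoD(2)[OF LIMSEQ_subseq_LIMSEQ[OF LIMSEQ_inverse_real_of_nat r(1)] that(1)]
        by (simp add: o_def)
      moreover have "\<forall>\<^sub>F n in sequentially. dist (x (t (r n))) l < \<epsilon>"
        using tendstoD[OF r(2) that(2)] by simp
      ultimately have "\<forall>\<^sub>F n in sequentially. inverse (real (Suc (r n))) < \<eta> \<and> dist (x (t (r n))) l < \<epsilon>"
        by eventually_elim simp
      then obtain n where "inverse (real (Suc (r n))) < \<eta>" "dist (x (t (r n))) l < \<epsilon>"
        using eventually_happens by fastforce
      with t(1)[of "r n"] t(2)[of "r n"] t(3)[of "r n"] show ?thesis
        by (intro exI[of _ "t (r n)"]) auto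
    qed
    ultimately show False using False by blast
  qed
  then show ?thesis by blast
qed

section \<open>The Gram matrix\<close>

locale chain =
  fixes pos :: "'k::finite \<Rightarrow> nat"
  assumes bij: "bij_betw pos (UNIV :: 'k set) {1..CARD('k)}"
begin

text \<open>The exponents of the problem: the coordinate \<open>p\<close> of exp(-tA) b is a
  multiple of \<open>t ^ deg p\<close>, and the degrees are the weights with respect to which the
  Gram matrix is homogeneous.\<close>

definition deg :: "'k \<Rightarrow> nat" where
  "deg p = CARD('k) - pos p"

lemma pos_range: "1 \<le> pos p" "pos p \<le> CARD('k)"
  using bij by (auto simp: bij_betw_def)

lemma deg_less: "deg p < CARD('k)"
  using pos_range[of p] by (simp add: deg_def)

lemma deg_eq_iff: "deg p = deg q \<longleftrightarrow> p = q"
proof -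
  have "pos p = pos q \<longleftrightarrow> p = q"
    using bij by (auto simp: bij_betw_def inj_on_def)
  then show ?thesis
    using pos_range[of p] pos_range[of q] by (auto simp: deg_def)
qed

lemma ex_deg:
  assumes "j < CARD('k)"
  obtains p where "deg p = j"
proof -
  have "CARD('k) - j \<in> pos ` UNIV"
    using bij assms by (auto simp: bij_betw_def)
  then obtain p where "pos p = CARD('k) - j" by force
  then have "deg p = j" using assms by (simp add: deg_def)
  then show thesis by (rule that)
qed

lemma superdiag_nth: "superdiag pos $ p $ q = (if deg p = deg q + 1 then 1 else 0)"
  using pos_range[of p] pos_range[of q] by (auto simp: superdiag_def deg_def)

lemma transpose_superdiag_nth:
  "transpose (superdiag pos) $ p $ q = (if deg q = deg p + 1 then 1 else 0)"
  by (simp add: transpose_def superdiag_nth)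

lemma last_unit_nth: "last_unit pos $ p = (if deg p = 0 then 1 else 0)"
  using pos_range[of p] by (auto simp: last_unit_def deg_def)

lemma superdiag_power_nth:
  "((**) (s *\<^sub>R superdiag pos) ^^ l) (mat 1) $ p $ q = (if deg p = deg q + l then s ^ l else 0)"
proof (induction l arbitrary: p)
  case 0
  then show ?case by (simp add: mat_def deg_eq_iff)
next
  case (Suc l)
  have "((**) (s *\<^sub>R superdiag pos) ^^ Suc l) (mat 1) $ p $ q =
      (\<Sum>r\<in>UNIV. (s * (if deg p = deg r + 1 then 1 else 0)) * (if deg r = deg q + l then s ^ l else 0))"
    by (simp add: matrix_matrix_mult_def Suc superdiag_nth del: mult_cancel_left)
  also have "\<dots> = (if deg p = deg q + Suc l then s ^ Suc l else 0)"
  proof (cases "deg p = deg q + Suc l")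
    case True
    then obtain r0 where r0: "deg r0 = deg q + l"
      using ex_deg[of "deg q + l"] deg_less[of p] by auto
    have "(\<Sum>r\<in>UNIV. (s * (if deg p = deg r + 1 then 1 else 0)) * (if deg r = deg q + l then s ^ l else 0))
        = (\<Sum>r\<in>UNIV. if r = r0 then s ^ Suc l else 0)"
    proof (intro sum.cong refl)
      fix r
      show "(s * (if deg p = deg r + 1 then 1 else 0)) * (if deg r = deg q + l then s ^ l else 0)
          = (if r = r0 then s ^ Suc l else 0)"
        using True r0 deg_eq_iff[of r r0] by (cases "r = r0") auto
    qed
    with True show ?thesis by simp
  next
    case False
    then have "(\<Sum>r\<in>UNIV. (s * (if deg p = deg r + 1 then 1 else 0)) * (if deg r = deg q + l then s ^ l else 0)) = 0"
      by (intro sum.neutral) auto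
    with False show ?thesis by simp
  qed
  finally show ?case .
qed

lemma transpose_superdiag_power_nth:
  "((**) (s *\<^sub>R transpose (superdiag pos)) ^^ l) (mat 1) $ p $ q = (if deg q = deg p + l then s ^ l else 0)"
proof (induction l arbitrary: p)
  case 0
  then show ?case by (auto simp: mat_def deg_eq_iff)
next
  case (Suc l)
  have "((**) (s *\<^sub>R transpose (superdiag pos)) ^^ Suc l) (mat 1) $ p $ q =
      (\<Sum>r\<in>UNIV. (s * (if deg r = deg p + 1 then 1 else 0)) * (if deg q = deg r + l then s ^ l else 0))"
    by (simp add: matrix_matrix_mult_def Suc transpose_superdiag_nth)
  also have "\<dots> = (if deg q = deg p + Suc l then s ^ Suc l else 0)"
  proof (cases "deg q = deg p + Suc l")
    case True
    then obtain r0 where r0: "deg r0 = deg p + 1"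
      using ex_deg[of "deg p + 1"] deg_less[of q] by auto
    have "(\<Sum>r\<in>UNIV. (s * (if deg r = deg p + 1 then 1 else 0)) * (if deg q = deg r + l then s ^ l else 0))
        = (\<Sum>r\<in>UNIV. if r = r0 then s ^ Suc l else 0)"
    proof (intro sum.cong refl)
      fix r
      show "(s * (if deg r = deg p + 1 then 1 else 0)) * (if deg q = deg r + l then s ^ l else 0)
          = (if r = r0 then s ^ Suc l else 0)"
        using True r0 deg_eq_iff[of r r0] by (cases "r = r0") auto
    qed
    with True show ?thesis by simp
  next
    case False
    then have "(\<Sum>r\<in>UNIV. (s * (if deg r = deg p + 1 then 1 else 0)) * (if deg q = deg r + l then s ^ l else 0)) = 0"
      by (intro sum.neutral) auto
    with False show ?thesis by simp
  qed
  finally show ?case .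
qed

text \<open>Each entry is fed by at most one power of \<open>M\<close>, with exponent below
  \<open>CARD('k)\<close>, so the exponential series is a finite sum. The parameters
  \<open>P\<close> and \<open>n\<close> allow for both the shift matrix and its transpose.\<close>

lemma matrix_exp_nilpotent_nth:
  fixes M :: "real ^ 'k ^ 'k"
  assumes M: "\<And>l p q. ((**) M ^^ l) (mat 1) $ p $ q = (if P p q \<and> l = n p q then s ^ l else 0)"
    and n: "\<And>p q. n p q < CARD('k)"
  shows "matrix_exp M $ p $ q = (if P p q then s ^ n p q / fact (n p q) else 0)"
proof -
  have "((**) M ^^ l) (mat 1) = 0" if "l \<notin> {..<CARD('k)}" for l
    using n that by (auto simp: vec_eq_iff M)
  then have "matrix_exp M = (\<Sum>l<CARD('k). (1 / fact l) *\<^sub>R (((**) M ^^ l) (mat 1)))"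
    unfolding matrix_exp_def by (intro suminf_finite) auto
  then have "matrix_exp M $ p $ q = (\<Sum>l<CARD('k). 1 / fact l * (if P p q \<and> l = n p q then s ^ l else 0))"
    by (simp add: M)
  also have "\<dots> = (\<Sum>l<CARD('k). if l = n p q then (if P p q then s ^ n p q / fact (n p q) else 0) else 0)"
    by (intro sum.cong) auto
  also have "\<dots> = (if P p q then s ^ n p q / fact (n p q) else 0)"
    using n[of p q] by simp
  finally show ?thesis .
qed

lemma matrix_exp_superdiag_nth:
  "matrix_exp (s *\<^sub>R superdiag pos) $ p $ q =
     (if deg q \<le> deg p then s ^ (deg p - deg q) / fact (deg p - deg q) else 0)"
  by (rule matrix_exp_nilpotent_nth[where n = "\<lambda>p q. deg p - deg q"])
     (auto simp: superdiag_power_nth less_imp_diff_less deg_less)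

lemma matrix_exp_transpose_superdiag_nth:
  "matrix_exp (s *\<^sub>R transpose (superdiag pos)) $ p $ q =
     (if deg p \<le> deg q then s ^ (deg q - deg p) / fact (deg q - deg p) else 0)"
  by (rule matrix_exp_nilpotent_nth[where n = "\<lambda>p q. deg q - deg p"])
     (auto simp: transpose_superdiag_power_nth less_imp_diff_less deg_less)

text \<open>The vector exp(-tA) b has the coordinates \<open>cf p * t ^ deg p\<close>.\<close>

definition cf :: "'k \<Rightarrow> real" where
  "cf p = (- 1) ^ deg p / fact (deg p)"

lemma gram_integrand_nth:
  "(matrix_exp (- t *\<^sub>R superdiag pos)
       ** ((columnvector (last_unit pos) :: real ^ 1 ^ 'k) ** rowvector (last_unit pos))
       ** matrix_exp (- t *\<^sub>R transpose (superdiag pos))) $ p $ q = cf p * cf q * t ^ (deg p + deg q)"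
proof -
  obtain z where z: "deg z = 0" using ex_deg[of 0] by auto
  have unit: "last_unit pos $ r = (if r = z then 1 else 0)" for r
    using deg_eq_iff[of r z] by (auto simp: last_unit_nth z)
  have E: "matrix_exp (- t *\<^sub>R superdiag pos) $ p $ z = cf p * t ^ deg p" for p
    unfolding matrix_exp_superdiag_nth by (simp add: z cf_def power_minus[of t])
  have E': "matrix_exp (- t *\<^sub>R transpose (superdiag pos)) $ z $ q = cf q * t ^ deg q" for q
    unfolding matrix_exp_transpose_superdiag_nth by (simp add: z cf_def power_minus[of t])
  let ?C = "(columnvector (last_unit pos) :: real ^ 1 ^ 'k) ** rowvector (last_unit pos)"
  have C: "?C $ r $ s = (if r = z then if s = z then 1 else 0 else 0)" for r s
    by (simp add: matrix_matrix_mult_def columnvector_def rowvector_def unit)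
  have AC: "(A ** ?C) $ p $ s = (if s = z then A $ p $ z else 0)" for A :: "real ^ 'k ^ 'k" and s
  proof -
    have "(A ** ?C) $ p $ s = (\<Sum>r\<in>UNIV. if r = z then (if s = z then A $ p $ z else 0) else 0)"
      unfolding matrix_matrix_mult_def[of A] vec_lambda_beta C by (intro sum.cong) auto
    then show ?thesis by simp
  qed
  have "(A ** ?C ** B) $ p $ q = A $ p $ z * B $ z $ q" for A B :: "real ^ 'k ^ 'k"
  proof -
    have "(A ** ?C ** B) $ p $ q = (\<Sum>s\<in>UNIV. if s = z then A $ p $ z * B $ z $ q else 0)"
      unfolding matrix_matrix_mult_def[of _ B] vec_lambda_beta AC by (intro sum.cong) auto
    then show ?thesis by simp
  qed
  from this[of "matrix_exp (- t *\<^sub>R superdiag pos)" "matrix_exp (- t *\<^sub>R transpose (superdiag pos))"]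
  show ?thesis unfolding E E' power_add by (simp only: mult_ac)
qed

lemma has_integral_tent_monomial:
  assumes "0 < \<Theta>"
  shows "((\<lambda>t. (1 - t / \<Theta>) * t ^ s) has_integral \<Theta> ^ (s + 1) / (real (s + 1) * real (s + 2))) {0..\<Theta>}"
proof -
  let ?F = "\<lambda>t. t ^ (s + 1) / real (s + 1) - t ^ (s + 2) / (\<Theta> * real (s + 2))"
  have "((\<lambda>t. (1 - t / \<Theta>) * t ^ s) has_integral ?F \<Theta> - ?F 0) {0..\<Theta>}"
  proof (rule fundamental_theorem_of_calculus)
    fix t assume "t \<in> {0..\<Theta>}"
    have "(?F has_real_derivative (real (s + 1) * t ^ s / real (s + 1) - real (s + 2) * t ^ (s + 1) / (\<Theta> * real (s + 2)))) (at t within {0..\<Theta>})"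
      using assms by (intro derivative_eq_intros refl) auto
    also have "real (s + 1) * t ^ s / real (s + 1) = t ^ s"
      by (rule nonzero_mult_div_cancel_left) linarith
    also have "real (s + 2) * t ^ (s + 1) / (\<Theta> * real (s + 2)) = t ^ (s + 1) / \<Theta>"
      unfolding mult.commute[of \<Theta>] by (rule mult_divide_mult_cancel_left) linarith
    also have "t ^ s - t ^ (s + 1) / \<Theta> = (1 - t / \<Theta>) * t ^ s"
      using assms by (simp add: field_simps)
    finally show "(?F has_vector_derivative (1 - t / \<Theta>) * t ^ s) (at t within {0..\<Theta>})"
      by (simp only: has_real_derivative_iff_has_vector_derivative)
  qed (use assms in auto)
  also have "?F \<Theta> - ?F 0 = \<Theta> ^ (s + 1) / (real (s + 1) * real (s + 2))"
    using assms by (simp add: divide_simps) (simp add: algebra_simps)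
  finally show ?thesis .
qed

text \<open>The power of \<Theta> splits as
  \<open>\<Theta> * \<Theta> ^ deg p * \<Theta> ^ deg q\<close>, so the matrix is a diagonal
  rescaling of its value at 1. The denominators come from the moments of the weight
  \<open>1 - t\<close> on the unit interval.\<close>

lemma gram_nth:
  assumes "0 < \<Theta>"
  shows "gram pos \<Theta> $ p $ q = cf p * cf q * \<Theta> ^ (deg p + deg q + 1) /
           (real (deg p + deg q + 1) * real (deg p + deg q + 2))"
proof -
  let ?G = "\<lambda>t. (1 - t / \<Theta>) *\<^sub>R
     (matrix_exp (- t *\<^sub>R superdiag pos)
       ** ((columnvector (last_unit pos) :: real ^ 1 ^ 'k) ** rowvector (last_unit pos))
       ** matrix_exp (- t *\<^sub>R transpose (superdiag pos)))"
  have G: "?G t $ p $ q = cf p * cf q * ((1 - t / \<Theta>) * t ^ (deg p + deg q))" for t p q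
    unfolding vector_scaleR_component gram_integrand_nth by simp
  have "?G = (\<lambda>t. \<chi> p q. cf p * cf q * ((1 - t / \<Theta>) * t ^ (deg p + deg q)))"
    unfolding fun_eq_iff vec_eq_iff using G by simp
  moreover have "continuous_on {0..\<Theta>} (\<lambda>t. \<chi> p q. cf p * cf q * ((1 - t / \<Theta>) * t ^ (deg p + deg q)))"
    using assms by (intro continuous_intros) auto
  ultimately have "?G integrable_on {0..\<Theta>}"
    by (simp only: integrable_continuous_real)
  moreover have "bounded_linear (\<lambda>A :: real ^ 'k ^ 'k. A $ p $ q)"
    using bounded_linear_compose[OF bounded_linear_vec_nth[of q] bounded_linear_vec_nth[of p]] .
  ultimately have "gram pos \<Theta> $ p $ q = integral {0..\<Theta>} (\<lambda>t. ?G t $ p $ q)"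
    unfolding gram_def using integral_linear[of ?G "{0..\<Theta>}" "\<lambda>A. A $ p $ q"] by (simp only: o_def)
  also have "\<dots> = integral {0..\<Theta>} (\<lambda>t. cf p * cf q * ((1 - t / \<Theta>) * t ^ (deg p + deg q)))"
    unfolding G ..
  also have "\<dots> = cf p * cf q * (\<Theta> ^ (deg p + deg q + 1) / (real (deg p + deg q + 1) * real (deg p + deg q + 2)))"
    by (intro integral_unique has_integral_mult_right has_integral_tent_monomial assms)
  finally show ?thesis by simp
qed

text \<open>The form is the integral of \<omega> times the square of the polynomial with
  coefficients \<open>y\<close>. If it vanished, so would the polynomial on the open unit interval;
  but distinct indices have distinct degrees, and a nonzero polynomial has finitely many
  roots.\<close>

lemma moment_form_pos:
  fixes y :: "'k \<Rightarrow> real"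
  assumes moment: "\<And>j. ((\<lambda>t. \<omega> t * t ^ j) has_integral \<mu> j) {0..1}"
    and cont: "continuous_on {0..1} \<omega>" and nonneg: "\<And>t. t \<in> {0..1} \<Longrightarrow> 0 \<le> \<omega> t"
    and pos: "\<And>t. 0 < t \<Longrightarrow> t < 1 \<Longrightarrow> 0 < \<omega> t"
    and y: "y r \<noteq> 0"
  shows "0 < (\<Sum>p\<in>UNIV. \<Sum>q\<in>UNIV. y p * y q * \<mu> (deg p + deg q))"
proof -
  let ?g = "\<lambda>t. \<omega> t * (\<Sum>p\<in>UNIV. y p * t ^ deg p)\<^sup>2"
  have "?g = (\<lambda>t. \<Sum>p\<in>UNIV. \<Sum>q\<in>UNIV. y p * y q * (\<omega> t * t ^ (deg p + deg q)))"
    by (simp add: fun_eq_iff power2_eq_square sum_product sum_distrib_left power_add mult_ac)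
  moreover have "((\<lambda>t. \<Sum>p\<in>UNIV. \<Sum>q\<in>UNIV. y p * y q * (\<omega> t * t ^ (deg p + deg q))) has_integral
      (\<Sum>p\<in>UNIV. \<Sum>q\<in>UNIV. y p * y q * \<mu> (deg p + deg q))) {0..1}"
    by (intro has_integral_sum has_integral_mult_right moment finite)
  ultimately have int: "(?g has_integral (\<Sum>p\<in>UNIV. \<Sum>q\<in>UNIV. y p * y q * \<mu> (deg p + deg q))) {0..1}"
    by simp
  have g: "continuous_on {0..1} ?g" "\<And>t. t \<in> {0..1} \<Longrightarrow> 0 \<le> ?g t"
    using nonneg by (auto intro!: continuous_intros cont)
  have "integral {0..1} ?g \<noteq> 0"
  proof
    assume "integral {0..1} ?g = 0"
    then have zero: "?g t = 0" if "t \<in> {0..1}" for t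
      using integral_eq_0_iff[OF g(1) _ g(2)] that by simp
    define c where "c i = (\<Sum>p\<in>UNIV. if deg p = i then y p else 0)" for i
    have poly: "(\<Sum>i\<le>CARD('k). c i * t ^ i) = (\<Sum>p\<in>UNIV. y p * t ^ deg p)" for t
    proof -
      have "(\<Sum>i\<le>CARD('k). c i * t ^ i) = (\<Sum>i\<le>CARD('k). \<Sum>p\<in>UNIV. if i = deg p then y p * t ^ deg p else 0)"
        unfolding c_def sum_distrib_right by (intro sum.cong refl) auto
      also have "\<dots> = (\<Sum>p\<in>UNIV. \<Sum>i\<le>CARD('k). if i = deg p then y p * t ^ deg p else 0)"
        by (rule sum.swap)
      also have "\<dots> = (\<Sum>p\<in>UNIV. y p * t ^ deg p)"
        using deg_less by (intro sum.cong refl) (simp add: less_imp_le)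
      finally show ?thesis .
    qed
    have "(\<Sum>i\<le>CARD('k). c i * t ^ i) = 0" if "t \<in> {0<..<1}" for t
      using zero[of t] pos[of t] that unfolding poly by auto
    then have "{0<..<1} \<subseteq> {t :: real. (\<Sum>i\<le>CARD('k). c i * t ^ i) = 0}" by blast
    then have "infinite {t :: real. (\<Sum>i\<le>CARD('k). c i * t ^ i) = 0}"
      by (rule infinite_super) (simp add: infinite_Ioo)
    then have "c (deg r) = 0"
      using polyfun_finite_roots[of c "CARD('k)"] deg_less[of r] by auto
    moreover have "c (deg r) = y r"
      unfolding c_def deg_eq_iff by simp
    ultimately show False using y by simp
  qed
  moreover have "0 \<le> integral {0..1} ?g"
    by (rule integral_nonneg) (use int g(2) in auto)
  ultimately show ?thesis using int by (simp add: has_integral_iff)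
qed

end

section \<open>The quadratic form of the inverse Gram matrix\<close>

lemma inner_transpose_matrix:
  fixes A :: "real ^ 'n ^ 'm"
  shows "(A *v x) \<bullet> y = x \<bullet> (transpose A *v y)"
  using dot_lmul_matrix[of x "transpose A" y] by simp

lemma inner_matrix_vector:
  fixes A :: "real ^ 'n ^ 'm"
  shows "x \<bullet> (A *v y) = (\<Sum>p\<in>UNIV. \<Sum>q\<in>UNIV. x $ p * y $ q * A $ p $ q)"
  by (simp add: inner_vec_def matrix_vector_mult_def sum_distrib_left mult_ac)

text \<open>The discriminant of the form along the line \<open>u + r *\<^sub>R v\<close>.
  Semidefiniteness allows the quadratic to degenerate to an affine function of \<open>r\<close>,
  which is then constant.\<close>

lemma psd_Cauchy_Schwarz:
  fixes A :: "real ^ 'n ^ 'n"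
  assumes sym: "transpose A = A" and psd: "\<And>x. 0 \<le> x \<bullet> (A *v x)"
  shows "(u \<bullet> (A *v v))\<^sup>2 \<le> (u \<bullet> (A *v u)) * (v \<bullet> (A *v v))"
proof -
  define a where "a = v \<bullet> (A *v v)"
  define b where "b = u \<bullet> (A *v v)"
  define c where "c = u \<bullet> (A *v u)"
  have vu: "v \<bullet> (A *v u) = b"
    using inner_transpose_matrix[of A v u] by (simp add: sym b_def inner_commute)
  have quad: "0 \<le> c + 2 * r * b + r\<^sup>2 * a" for r
    using psd[of "u + r *\<^sub>R v"] vu
    by (simp add: a_def b_def c_def matrix_vector_right_distrib matrix_vector_mult_scaleR inner_add_left inner_add_right
        power2_eq_square algebra_simps)
  have "0 \<le> a" unfolding a_def by (rule psd)
  have "b\<^sup>2 \<le> c * a"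
  proof (cases "a = 0")
    case True
    have "b = 0"
    proof (rule ccontr)
      assume "b \<noteq> 0"
      \<comment> \<open>At this \<open>r\<close> the affine function would take the value
        -1.\<close>
      then show False using quad[of "- (c + 1) / (2 * b)"] True by (simp add: field_simps)
    qed
    with True show ?thesis by simp
  next
    case False
    with \<open>0 \<le> a\<close> have "0 < a" by simp
    have "0 \<le> a * (c + 2 * (- b / a) * b + (- b / a)\<^sup>2 * a)"
      using quad[of "- b / a"] \<open>0 \<le> a\<close> by (rule mult_nonneg_nonneg[rotated])
    also have "\<dots> = c * a - b\<^sup>2"
      using \<open>0 < a\<close> by (simp add: power2_eq_square field_simps)
    finally show ?thesis by simp
  qed
  then show ?thesis by (simp add: a_def b_def c_def)
qed

context chain
begin

abbreviation C :: "real ^ 'k ^ 'k" where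
  "C \<equiv> gram pos 1"

abbreviation K :: "real ^ 'k ^ 'k" where
  "K \<equiv> matrix_inv C"

text \<open>This is N'(1). Differentiating the weight \<open>1 - t / \<Theta>\<close> at \<Theta> =
  1 leaves the weight \<open>t\<close>, with the moments \<open>1 / (j + 2)\<close>; hence
  \<open>D\<close> is positive definite for the same reason as \<open>C\<close>.\<close>

definition D :: "real ^ 'k ^ 'k" where
  "D = (\<chi> p q. cf p * cf q / real (deg p + deg q + 2))"

lemma cf_nonzero: "cf p \<noteq> 0"
  by (simp add: cf_def)

lemma C_nth: "C $ p $ q = cf p * cf q / (real (deg p + deg q + 1) * real (deg p + deg q + 2))"
  by (simp add: gram_nth)

lemma D_nth: "D $ p $ q = real (deg p + deg q + 1) * C $ p $ q"
  by (simp add: D_def C_nth del: of_nat_add)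

lemma transpose_C: "transpose C = C"
  by (simp add: vec_eq_iff transpose_def C_nth add_ac mult_ac)

lemma C_pos:
  assumes "x \<noteq> 0"
  shows "0 < x \<bullet> (C *v x)"
proof -
  obtain r where r: "x $ r \<noteq> 0" using assms by (auto simp: vec_eq_iff)
  have "0 < (\<Sum>p\<in>UNIV. \<Sum>q\<in>UNIV. (x $ p * cf p) * (x $ q * cf q) *
      (1 ^ (deg p + deg q + 1) / (real (deg p + deg q + 1) * real (deg p + deg q + 2))))"
  proof (rule moment_form_pos[where \<omega> = "\<lambda>t. 1 - t / 1"])
    show "((\<lambda>t. (1 - t / 1) * t ^ j) has_integral 1 ^ (j + 1) / (real (j + 1) * real (j + 2))) {0..1}" for j
      by (rule has_integral_tent_monomial) simp
  qed (use r cf_nonzero in \<open>auto intro!: continuous_intros\<close>)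
  then show ?thesis
    unfolding inner_matrix_vector C_nth by (simp add: mult_ac)
qed

lemma D_pos:
  assumes "x \<noteq> 0"
  shows "0 < x \<bullet> (D *v x)"
proof -
  obtain r where r: "x $ r \<noteq> 0" using assms by (auto simp: vec_eq_iff)
  have "0 < (\<Sum>p\<in>UNIV. \<Sum>q\<in>UNIV. (x $ p * cf p) * (x $ q * cf q) * (1 / real (deg p + deg q + 2)))"
  proof (rule moment_form_pos[where \<omega> = "\<lambda>t. t"])
    show "((\<lambda>t. t * t ^ j) has_integral 1 / real (j + 2)) {0..1}" for j
    proof -
      have "((\<lambda>t. t ^ (j + 1)) has_integral 1 ^ (j + 2) / real (j + 2) - 0 ^ (j + 2) / real (j + 2)) {0..1::real}"
      proof (rule fundamental_theorem_of_calculus)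
        fix t :: real
        have "((\<lambda>t. t ^ (j + 2) / real (j + 2)) has_real_derivative real (j + 2) * t ^ (j + 1) / real (j + 2)) (at t within {0..1})"
          by (intro derivative_eq_intros refl) auto
        also have "real (j + 2) * t ^ (j + 1) / real (j + 2) = t ^ (j + 1)"
          by (rule nonzero_mult_div_cancel_left) linarith
        finally show "((\<lambda>t. t ^ (j + 2) / real (j + 2)) has_vector_derivative t ^ (j + 1)) (at t within {0..1})"
          by (simp only: has_real_derivative_iff_has_vector_derivative)
      qed simp
      then show ?thesis by simp
    qed
  qed (use r cf_nonzero in \<open>auto intro!: continuous_intros\<close>)
  then show ?thesis
    unfolding inner_matrix_vector D_def vec_lambda_beta by (simp add: mult_ac)
qed

lemma C_nonneg: "0 \<le> x \<bullet> (C *v x)" and D_nonneg: "0 \<le> x \<bullet> (D *v x)"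
  using C_pos[of x] D_pos[of x] by (cases "x = 0"; simp)+

lemma C_inverse: "C ** K = mat 1" "K ** C = mat 1"
proof -
  have "invertible C"
    unfolding invertible_left_inverse matrix_left_invertible_ker
    using C_pos by (metis inner_zero_right less_irrefl)
  then have "C ** K = mat 1 \<and> K ** C = mat 1"
    unfolding invertible_def matrix_inv_def by (rule someI_ex)
  then show "C ** K = mat 1" "K ** C = mat 1" by auto
qed

lemma CK_vec: "C *v (K *v x) = x"
  by (simp add: matrix_vector_mul_assoc C_inverse)

text \<open>With S the diagonal matrix of the powers \<open>\<Theta> ^ deg p\<close>, the Gram
  matrix is \<Theta> S C S for positive \<Theta>. So \<open>scaled \<Theta> y\<close> is S^(-1) y,
  \<open>om \<Theta> y\<close> solves the system with matrix \<open>C\<close> for this right-hand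
  side, and \<open>wv \<Theta> y\<close> is N(\<Theta>)^(-1) y.\<close>

definition scaled :: "real \<Rightarrow> real ^ 'k \<Rightarrow> real ^ 'k" where
  "scaled \<Theta> y = (\<chi> p. y $ p / \<Theta> ^ deg p)"

definition om :: "real \<Rightarrow> real ^ 'k \<Rightarrow> real ^ 'k" where
  "om \<Theta> y = K *v scaled \<Theta> y"

definition wv :: "real \<Rightarrow> real ^ 'k \<Rightarrow> real ^ 'k" where
  "wv \<Theta> y = (\<chi> p. om \<Theta> y $ p / \<Theta> ^ (deg p + 1))"

lemma C_om: "C *v om \<Theta> y = scaled \<Theta> y"
  by (simp add: om_def CK_vec)

lemma gram_inverse_vec:
  assumes \<Theta>: "0 < \<Theta>"
  shows "matrix_inv (gram pos \<Theta>) *v y = wv \<Theta> y"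
proof -
  define G :: "real ^ 'k ^ 'k" where "G = (\<chi> p q. K $ p $ q / \<Theta> ^ (deg p + deg q + 1))"
  have "gram pos \<Theta> ** G = mat 1"
  proof (intro vec_eq_iff[THEN iffD2] allI)
    fix p q
    have "gram pos \<Theta> $ p $ r * G $ r $ q = \<Theta> ^ deg p / \<Theta> ^ deg q * (C $ p $ r * K $ r $ q)" for r
    proof -
      have "gram pos \<Theta> $ p $ r = C $ p $ r * (\<Theta> ^ deg p * \<Theta> ^ (deg r + 1))"
        using \<Theta> by (simp add: gram_nth power_add)
      moreover have "G $ r $ q = K $ r $ q / (\<Theta> ^ deg q * \<Theta> ^ (deg r + 1))"
        by (simp add: G_def power_add mult_ac)
      ultimately show ?thesis using \<Theta> by simp
    qed
    then have "(gram pos \<Theta> ** G) $ p $ q = \<Theta> ^ deg p / \<Theta> ^ deg q * (C ** K) $ p $ q"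
      by (simp add: matrix_matrix_mult_def sum_distrib_left)
    then show "(gram pos \<Theta> ** G) $ p $ q = (mat 1 :: real ^ 'k ^ 'k) $ p $ q"
      using \<Theta> by (simp add: C_inverse mat_def)
  qed
  moreover from this have "G ** gram pos \<Theta> = mat 1"
    by (simp only: matrix_left_right_inverse)
  ultimately have G: "gram pos \<Theta> ** G = mat 1 \<and> G ** gram pos \<Theta> = mat 1" ..
  then have inv: "gram pos \<Theta> ** matrix_inv (gram pos \<Theta>) = mat 1 \<and> matrix_inv (gram pos \<Theta>) ** gram pos \<Theta> = mat 1"
    unfolding matrix_inv_def by (rule someI)
  have "matrix_inv (gram pos \<Theta>) = (G ** gram pos \<Theta>) ** matrix_inv (gram pos \<Theta>)"
    using G by simp
  also have "\<dots> = G"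
    using inv by (simp flip: matrix_mul_assoc)
  finally have inv_eq: "matrix_inv (gram pos \<Theta>) = G" .
  have "(G *v y) $ p = wv \<Theta> y $ p" for p
  proof -
    have "(G *v y) $ p = (\<Sum>q\<in>UNIV. K $ p $ q * (y $ q / \<Theta> ^ deg q) / \<Theta> ^ (deg p + 1))"
      by (simp add: G_def matrix_vector_mult_def power_add mult_ac)
    also have "\<dots> = wv \<Theta> y $ p"
      by (simp add: wv_def om_def scaled_def matrix_vector_mult_def sum_divide_distrib)
    finally show ?thesis .
  qed
  then show ?thesis unfolding inv_eq vec_eq_iff by blast
qed

lemma inner_wv: "wv \<Theta> y \<bullet> x = om \<Theta> y \<bullet> scaled \<Theta> x / \<Theta>"
  by (simp add: inner_vec_def wv_def scaled_def sum_divide_distrib mult_ac)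

definition Phi :: "real \<Rightarrow> real \<Rightarrow> real ^ 'k \<Rightarrow> real" where
  "Phi a0 \<Theta> y = 2 * a0 * \<Theta> - om \<Theta> y \<bullet> scaled \<Theta> y / \<Theta>"

lemma Phi_eq_0_iff:
  "0 < \<Theta> \<Longrightarrow> 2 * a0 * \<Theta> = (matrix_inv (gram pos \<Theta>) *v y) \<bullet> y \<longleftrightarrow> Phi a0 \<Theta> y = 0"
  by (simp add: gram_inverse_vec inner_wv Phi_def)

text \<open>For positive \<Theta> this is the partial derivative of \<open>Phi\<close> in \<Theta>:
  the second summand is (N'(\<Theta>) w, w) with w = \<open>wv \<Theta> y\<close>, expressed through
  the matrix at \<Theta> = 1.\<close>

definition dPhi :: "real \<Rightarrow> real \<Rightarrow> real ^ 'k \<Rightarrow> real" where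
  "dPhi a0 \<Theta> y = 2 * a0 + om \<Theta> y \<bullet> (D *v om \<Theta> y) / \<Theta>\<^sup>2"

lemma dPhi_pos: "0 < a0 \<Longrightarrow> 0 < dPhi a0 \<Theta> y"
  using D_nonneg[of "om \<Theta> y"] by (simp add: dPhi_def add_pos_nonneg)

text \<open>\<open>\<Lambda> C + C \<Lambda> + C = D\<close> for the diagonal matrix \<open>\<Lambda>\<close> of the degrees; this is the derivative of
  \<open>gram pos \<Theta>\<close> at \<open>\<Theta> = 1\<close>.\<close>

lemma deg_form:
  "2 * (\<Sum>p\<in>UNIV. x $ p * (real (deg p) * (C *v x) $ p)) + x \<bullet> (C *v x) = x \<bullet> (D *v x)"
proof -
  let ?S = "\<lambda>g. \<Sum>p\<in>UNIV. \<Sum>q\<in>UNIV. x $ p * x $ q * (g p q * C $ p $ q)"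
  have 1: "(\<Sum>p\<in>UNIV. x $ p * (real (deg p) * (C *v x) $ p)) = ?S (\<lambda>p q. real (deg p))"
    by (simp add: matrix_vector_mult_def sum_distrib_left mult_ac)
  have "?S (\<lambda>p q. real (deg p)) = ?S (\<lambda>p q. real (deg q))"
    by (subst sum.swap) (simp add: C_nth add_ac mult_ac)
  then have "2 * ?S (\<lambda>p q. real (deg p)) + x \<bullet> (C *v x)
      = ?S (\<lambda>p q. real (deg p)) + ?S (\<lambda>p q. real (deg q)) + x \<bullet> (C *v x)"
    by simp
  also have "\<dots> = x \<bullet> (D *v x)"
    unfolding inner_matrix_vector D_nth sum.distrib[symmetric]
    by (intro sum.cong refl) (simp add: algebra_simps)
  finally show ?thesis using 1 by simp
qed

lemma transpose_K: "transpose K = K"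
proof -
  have "transpose K ** C = mat 1"
    using arg_cong[OF C_inverse(1), of transpose] by (simp add: matrix_transpose_mul transpose_C)
  then show ?thesis
    by (metis C_inverse(1) matrix_mul_assoc matrix_mul_lid matrix_mul_rid)
qed

text \<open>One computation along a pair of curves yields both the monotonicity in \<Theta>, with
  \<open>y\<close> constant, and the mean value theorem, with both varying. Differentiating the
  powers of \<Theta> in \<open>scaled\<close> produces the degrees, which \<open>deg_form\<close>
  turns into \<open>D\<close>.\<close>

lemma DERIV_Phi:
  assumes y: "\<And>p. ((\<lambda>r. y r $ p) has_real_derivative y' $ p) (at r within S)"
    and \<theta>: "(\<theta> has_real_derivative \<theta>') (at r within S)" and pos: "0 < \<theta> r"
  shows "((\<lambda>r. Phi a0 (\<theta> r) (y r)) has_real_derivative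
     dPhi a0 (\<theta> r) (y r) * \<theta>' - 2 * (wv (\<theta> r) (y r) \<bullet> y')) (at r within S)"
proof -
  let ?s = "scaled (\<theta> r) (y r)" and ?o = "om (\<theta> r) (y r)"
  define s' :: "real ^ 'k" where "s' = scaled (\<theta> r) y' - (\<theta>' / \<theta> r) *\<^sub>R (\<chi> p. real (deg p) * ?s $ p)"
  have s: "((\<lambda>r. scaled (\<theta> r) (y r) $ p) has_real_derivative s' $ p) (at r within S)" for p
  proof -
    have "((\<lambda>r. y r $ p / \<theta> r ^ deg p) has_real_derivative
        (y' $ p * \<theta> r ^ deg p - y r $ p * (real (deg p) * (\<theta>' * \<theta> r ^ (deg p - Suc 0)))) / (\<theta> r ^ deg p * \<theta> r ^ deg p)) (at r within S)"
      using pos by (intro derivative_intros y \<theta>) auto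
    also have "(y' $ p * \<theta> r ^ deg p - y r $ p * (real (deg p) * (\<theta>' * \<theta> r ^ (deg p - Suc 0)))) / (\<theta> r ^ deg p * \<theta> r ^ deg p) = s' $ p"
      using pos by (cases "deg p") (auto simp: s'_def scaled_def field_simps)
    finally show ?thesis by (simp add: scaled_def)
  qed
  have Q: "((\<lambda>r. om (\<theta> r) (y r) \<bullet> scaled (\<theta> r) (y r)) has_real_derivative 2 * (?o \<bullet> s')) (at r within S)"
  proof -
    have eq: "om (\<theta> r) (y r) \<bullet> scaled (\<theta> r) (y r)
        = (\<Sum>p\<in>UNIV. \<Sum>q\<in>UNIV. scaled (\<theta> r) (y r) $ p * scaled (\<theta> r) (y r) $ q * K $ p $ q)" for r
      by (simp add: om_def inner_commute[of "K *v _"] inner_matrix_vector)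
    have "((\<lambda>r. \<Sum>p\<in>UNIV. \<Sum>q\<in>UNIV. scaled (\<theta> r) (y r) $ p * scaled (\<theta> r) (y r) $ q * K $ p $ q)
        has_real_derivative (\<Sum>p\<in>UNIV. \<Sum>q\<in>UNIV. (s' $ p * ?s $ q + s' $ q * ?s $ p) * K $ p $ q)) (at r within S)"
      by (intro DERIV_sum DERIV_cmult_right DERIV_mult s)
    also have "(\<Sum>p\<in>UNIV. \<Sum>q\<in>UNIV. (s' $ p * ?s $ q + s' $ q * ?s $ p) * K $ p $ q)
        = s' \<bullet> (K *v ?s) + ?s \<bullet> (K *v s')"
      unfolding inner_matrix_vector sum.distrib[symmetric] by (intro sum.cong refl) (simp add: algebra_simps)
    also have "?s \<bullet> (K *v s') = ?o \<bullet> s'"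
      using inner_transpose_matrix[of K ?s s'] by (simp add: transpose_K om_def)
    also have "s' \<bullet> (K *v ?s) + ?o \<bullet> s' = 2 * (?o \<bullet> s')"
      by (simp add: om_def inner_commute)
    finally show ?thesis unfolding eq .
  qed
  have "((\<lambda>r. Phi a0 (\<theta> r) (y r)) has_real_derivative
      2 * a0 * \<theta>' - (2 * (?o \<bullet> s') * \<theta> r - ?o \<bullet> ?s * \<theta>') / (\<theta> r * \<theta> r)) (at r within S)"
    unfolding Phi_def using pos by (intro DERIV_diff DERIV_cmult DERIV_divide Q \<theta>) auto
  also have "2 * a0 * \<theta>' - (2 * (?o \<bullet> s') * \<theta> r - ?o \<bullet> ?s * \<theta>') / (\<theta> r * \<theta> r)
      = dPhi a0 (\<theta> r) (y r) * \<theta>' - 2 * (wv (\<theta> r) (y r) \<bullet> y')"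
  proof -
    let ?S = "\<Sum>p\<in>UNIV. ?o $ p * (real (deg p) * ?s $ p)"
    have 1: "?o \<bullet> s' = ?o \<bullet> scaled (\<theta> r) y' - \<theta>' / \<theta> r * ?S"
      by (simp add: s'_def inner_vec_def sum_distrib_left right_diff_distrib sum_subtractf mult_ac)
    have 2: "?o \<bullet> (D *v ?o) - ?o \<bullet> ?s = 2 * ?S"
      using deg_form[of ?o] unfolding C_om by simp
    have "2 * (?o \<bullet> s') = 2 * (?o \<bullet> scaled (\<theta> r) y') - \<theta>' / \<theta> r * (?o \<bullet> (D *v ?o) - ?o \<bullet> ?s)"
      unfolding 1 2 by (simp only: right_diff_distrib mult.left_commute)
    from this show ?thesis
      unfolding dPhi_def inner_wv \<open>2 * (?o \<bullet> s') = _\<close> using pos by (simp add: field_simps power2_eq_square)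
  qed
  finally show ?thesis .
qed

lemma Phi_strict_mono:
  assumes "0 < a0" "0 < \<Theta>1" "\<Theta>1 < \<Theta>2"
  shows "Phi a0 \<Theta>1 y < Phi a0 \<Theta>2 y"
proof (rule DERIV_pos_imp_increasing[OF assms(3)])
  fix \<Theta> assume \<Theta>: "\<Theta>1 \<le> \<Theta>" "\<Theta> \<le> \<Theta>2"
  have "((\<lambda>r. Phi a0 r y) has_real_derivative dPhi a0 \<Theta> y * 1 - 2 * (wv \<Theta> y \<bullet> 0)) (at \<Theta>)"
    using assms \<Theta> by (intro DERIV_Phi[where \<theta> = "\<lambda>r. r" and y = "\<lambda>_. y"]) auto
  then show "\<exists>z. ((\<lambda>r. Phi a0 r y) has_real_derivative z) (at \<Theta>) \<and> 0 < z"
    using dPhi_pos[OF assms(1), of \<Theta> y] by auto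
qed

end

section \<open>The controllability function\<close>

context chain
begin

lemma om_scaled: "om \<Theta> y \<bullet> scaled \<Theta> y = om \<Theta> y \<bullet> (C *v om \<Theta> y)"
  by (simp add: C_om)

lemma inner_C_om: "om \<Theta> y \<bullet> (C *v v) = scaled \<Theta> y \<bullet> v"
  using inner_transpose_matrix[of C "om \<Theta> y" v] by (simp add: transpose_C C_om)

text \<open>Cauchy-Schwarz for the form of \<open>C\<close> at \<open>om \<Theta> y\<close> and
  \<open>v\<close>. Two test vectors matter: a coordinate axis, for the behaviour of
  \<open>Phi\<close> near \<Theta> = 0, and \<open>K *v last_unit pos\<close>, for the bound on the
  switching function.\<close>

lemma scaled_Cauchy_Schwarz: "(scaled \<Theta> y \<bullet> v)\<^sup>2 \<le> (om \<Theta> y \<bullet> scaled \<Theta> y) * (v \<bullet> (C *v v))"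
  using psd_Cauchy_Schwarz[OF transpose_C C_nonneg, of "om \<Theta> y" v]
  unfolding C_om inner_C_om .

lemma tendsto_scaled:
  assumes "(g \<longlongrightarrow> \<Theta>) F" "(h \<longlongrightarrow> y) F" "0 < \<Theta>"
  shows "((\<lambda>x. scaled (g x) (h x)) \<longlongrightarrow> scaled \<Theta> y) F"
  unfolding scaled_def using assms
  by (intro tendsto_vec_lambda tendsto_divide tendsto_power tendsto_vec_nth) auto

lemma tendsto_om:
  assumes "(g \<longlongrightarrow> \<Theta>) F" "(h \<longlongrightarrow> y) F" "0 < \<Theta>"
  shows "((\<lambda>x. om (g x) (h x)) \<longlongrightarrow> om \<Theta> y) F"
  unfolding om_def
  by (intro bounded_linear.tendsto[OF matrix_vector_mul_bounded_linear] tendsto_scaled assms)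

lemma tendsto_wv:
  assumes "(g \<longlongrightarrow> \<Theta>) F" "(h \<longlongrightarrow> y) F" "0 < \<Theta>"
  shows "((\<lambda>x. wv (g x) (h x)) \<longlongrightarrow> wv \<Theta> y) F"
  unfolding wv_def using assms
  by (intro tendsto_vec_lambda tendsto_divide tendsto_power tendsto_vec_nth tendsto_om) auto

lemma tendsto_Phi:
  assumes "(g \<longlongrightarrow> \<Theta>) F" "(h \<longlongrightarrow> y) F" "0 < \<Theta>"
  shows "((\<lambda>x. Phi a0 (g x) (h x)) \<longlongrightarrow> Phi a0 \<Theta> y) F"
  unfolding Phi_def using assms
  by (intro tendsto_intros tendsto_om tendsto_scaled) auto

lemma tendsto_dPhi:
  assumes "(g \<longlongrightarrow> \<Theta>) F" "(h \<longlongrightarrow> y) F" "0 < \<Theta>"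
  shows "((\<lambda>x. dPhi a0 (g x) (h x)) \<longlongrightarrow> dPhi a0 \<Theta> y) F"
  unfolding dPhi_def using assms
  by (intro tendsto_intros tendsto_om bounded_linear.tendsto[OF matrix_vector_mul_bounded_linear]) auto

text \<open>For \<open>\<Theta> \<le> 1\<close> the rescaling does not shrink coordinates, so one
  nonzero coordinate of \<open>y\<close> keeps the quadratic form above a constant \<open>e\<close>,
  while \<open>2 * a0 * \<Theta>\<close> tends to 0.\<close>

lemma Phi_neg_near_0:
  assumes "y \<noteq> 0" "0 < a0"
  obtains \<Theta> where "0 < \<Theta>" "\<Theta> \<le> 1" "Phi a0 \<Theta> y < 0"
proof -
  obtain p where p: "y $ p \<noteq> 0" using assms by (auto simp: vec_eq_iff)
  let ?v = "axis p 1 :: real ^ 'k"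
  define \<kappa> where "\<kappa> = ?v \<bullet> (C *v ?v)"
  have \<kappa>: "0 < \<kappa>" unfolding \<kappa>_def by (rule C_pos) (simp add: axis_eq_0_iff)
  define e where "e = (y $ p)\<^sup>2 / \<kappa>"
  have e: "0 < e" using p \<kappa> by (simp add: e_def)
  \<comment> \<open>With this choice \<open>2 * a0 * \<Theta>\<^sup>2\<close> is at most
    \<open>e / 2\<close>.\<close>
  define \<Theta> where "\<Theta> = min 1 (e / (4 * a0))"
  have \<Theta>: "0 < \<Theta>" "\<Theta> \<le> 1" "\<Theta> \<le> e / (4 * a0)" using e assms(2) by (auto simp: \<Theta>_def)
  have "\<bar>y $ p\<bar> \<le> \<bar>scaled \<Theta> y $ p\<bar>"
    using \<Theta> by (simp add: scaled_def abs_divide pos_le_divide_eq mult_left_le power_le_one)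
  then have "(y $ p)\<^sup>2 \<le> (scaled \<Theta> y $ p)\<^sup>2" by (simp only: abs_le_square_iff)
  also have "\<dots> \<le> (om \<Theta> y \<bullet> scaled \<Theta> y) * \<kappa>"
    using scaled_Cauchy_Schwarz[of \<Theta> y ?v] by (simp add: \<kappa>_def inner_axis)
  finally have Q: "e \<le> om \<Theta> y \<bullet> scaled \<Theta> y" using \<kappa> by (simp add: e_def pos_divide_le_eq)
  have "2 * a0 * \<Theta> * \<Theta> \<le> 2 * a0 * \<Theta> * 1" using \<Theta> assms(2) by (intro mult_left_mono) auto
  also have "\<dots> < e" using \<Theta>(3) assms(2) e by (simp add: pos_le_divide_eq mult.commute)
  also note Q
  finally have "Phi a0 \<Theta> y < 0" using \<Theta>(1) by (simp add: Phi_def pos_less_divide_eq)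
  with \<Theta>(1,2) show thesis by (rule that)
qed

text \<open>For \<open>1 \<le> \<Theta>\<close> the rescaling does not enlarge coordinates, so the
  quadratic form stays below a bound \<open>B\<close> that does not depend on \<Theta>.\<close>

lemma Phi_pos_at_top:
  assumes "0 < a0"
  obtains \<Theta> where "1 \<le> \<Theta>" "0 < Phi a0 \<Theta> y"
proof -
  define B where "B = (\<Sum>p\<in>UNIV. \<Sum>q\<in>UNIV. \<bar>y $ p\<bar> * \<bar>y $ q\<bar> * \<bar>K $ p $ q\<bar>)"
  have "0 \<le> B" unfolding B_def by (intro sum_nonneg) auto
  define \<Theta> where "\<Theta> = 1 + B / a0"
  have \<Theta>: "1 \<le> \<Theta>" "B < 2 * a0 * \<Theta>"
    using \<open>0 \<le> B\<close> assms by (auto simp: \<Theta>_def distrib_left)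
  have s: "\<bar>scaled \<Theta> y $ p\<bar> \<le> \<bar>y $ p\<bar>" for p
    using \<Theta>(1) by (simp add: scaled_def abs_divide pos_divide_le_eq mult_le_cancel_left1 one_le_power)
  have "om \<Theta> y \<bullet> scaled \<Theta> y = (\<Sum>p\<in>UNIV. \<Sum>q\<in>UNIV. scaled \<Theta> y $ p * scaled \<Theta> y $ q * K $ p $ q)"
    unfolding om_def inner_commute[of "K *v _"] inner_matrix_vector ..
  also have "\<dots> \<le> B"
    unfolding B_def
  proof (intro sum_mono)
    fix p q
    have "scaled \<Theta> y $ p * scaled \<Theta> y $ q * K $ p $ q \<le> \<bar>scaled \<Theta> y $ p\<bar> * \<bar>scaled \<Theta> y $ q\<bar> * \<bar>K $ p $ q\<bar>"
      unfolding abs_mult[symmetric] by (rule abs_ge_self)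
    also have "\<dots> \<le> \<bar>y $ p\<bar> * \<bar>y $ q\<bar> * \<bar>K $ p $ q\<bar>"
      by (intro mult_mono s) auto
    finally show "scaled \<Theta> y $ p * scaled \<Theta> y $ q * K $ p $ q \<le> \<bar>y $ p\<bar> * \<bar>y $ q\<bar> * \<bar>K $ p $ q\<bar>" .
  qed
  also have "B \<le> B * \<Theta>" using \<Theta>(1) \<open>0 \<le> B\<close> by (simp add: mult_le_cancel_left1)
  finally have "om \<Theta> y \<bullet> scaled \<Theta> y / \<Theta> \<le> B" using \<Theta>(1) by (simp add: pos_divide_le_eq)
  then have "0 < Phi a0 \<Theta> y" using \<Theta>(2) by (simp add: Phi_def)
  with \<Theta>(1) show thesis by (rule that)
qed

lemma ex_Phi_eq_0:
  assumes "y \<noteq> 0" "0 < a0"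
  shows "\<exists>\<Theta>>0. Phi a0 \<Theta> y = 0"
proof -
  obtain \<Theta>1 where 1: "0 < \<Theta>1" "\<Theta>1 \<le> 1" "Phi a0 \<Theta>1 y < 0" by (rule Phi_neg_near_0[OF assms])
  obtain \<Theta>2 where 2: "1 \<le> \<Theta>2" "0 < Phi a0 \<Theta>2 y" by (rule Phi_pos_at_top[OF assms(2)])
  have "continuous_on {\<Theta>1..\<Theta>2} (\<lambda>\<Theta>. Phi a0 \<Theta> y)"
    unfolding continuous_on_def using 1 by (intro ballI tendsto_Phi tendsto_intros) auto
  then obtain \<Theta> where "\<Theta>1 \<le> \<Theta>" "Phi a0 \<Theta> y = 0"
    using IVT'[of "\<lambda>\<Theta>. Phi a0 \<Theta> y" \<Theta>1 0 \<Theta>2] 1 2 by auto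
  with 1(1) show ?thesis by (intro exI[of _ \<Theta>]) auto
qed

lemma Phi_eq_0_unique:
  assumes "0 < a0" "0 < \<Theta>" "Phi a0 \<Theta> y = 0" "0 < \<Theta>'" "Phi a0 \<Theta>' y = 0"
  shows "\<Theta>' = \<Theta>"
  using Phi_strict_mono[OF assms(1,2), of \<Theta>' y] Phi_strict_mono[OF assms(1,4), of \<Theta> y] assms
  by (cases \<Theta> \<Theta>' rule: linorder_cases) auto

lemma controllability_fun:
  assumes "y \<noteq> 0" "0 < a0"
  shows controllability_fun_pos: "0 < controllability_fun pos a0 y"
    and Phi_controllability_fun: "Phi a0 (controllability_fun pos a0 y) y = 0"
proof -
  obtain \<Theta> where \<Theta>: "0 < \<Theta>" "Phi a0 \<Theta> y = 0" using ex_Phi_eq_0[OF assms] by blast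
  have "controllability_fun pos a0 y = \<Theta>"
    unfolding controllability_fun_def using assms(1)
  proof (simp, intro the_equality conjI)
    show "2 * a0 * \<Theta> = (matrix_inv (gram pos \<Theta>) *v y) \<bullet> y"
      using Phi_eq_0_iff[OF \<Theta>(1)] \<Theta>(2) by blast
    show "\<Theta>' = \<Theta>" if "0 < \<Theta>' \<and> 2 * a0 * \<Theta>' = (matrix_inv (gram pos \<Theta>') *v y) \<bullet> y" for \<Theta>'
      using Phi_eq_0_unique[OF assms(2) \<Theta>] Phi_eq_0_iff[of \<Theta>' a0 y] that by blast
  qed (rule \<Theta>(1))
  with \<Theta> show "0 < controllability_fun pos a0 y" "Phi a0 (controllability_fun pos a0 y) y = 0" by simp_all
qed

text \<open>The signs of \<open>Phi\<close> slightly below and slightly above its root persist when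
  \<open>y\<close> is perturbed, and strict monotonicity in \<Theta> traps the perturbed root
  between these two values.\<close>

lemma isCont_controllability_fun:
  assumes "y \<noteq> 0" and a0: "0 < a0"
  shows "isCont (controllability_fun pos a0) y"
  unfolding isCont_def
proof (rule tendstoI)
  fix e0 :: real assume "0 < e0"
  let ?\<Theta> = "controllability_fun pos a0 y"
  have pos: "0 < ?\<Theta>" and zero: "Phi a0 ?\<Theta> y = 0"
    using controllability_fun[OF assms] by auto
  define e where "e = min e0 (?\<Theta> / 2)"
  have e: "0 < e" "e \<le> e0" "0 < ?\<Theta> - e" using pos \<open>0 < e0\<close> by (auto simp: e_def)
  have "Phi a0 (?\<Theta> - e) y < 0" "0 < Phi a0 (?\<Theta> + e) y"
    using Phi_strict_mono[OF a0 e(3), of ?\<Theta> y] Phi_strict_mono[OF a0 pos, of "?\<Theta> + e" y] e(1) zero by auto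
  moreover have lim: "((\<lambda>x. Phi a0 \<Theta> x) \<longlongrightarrow> Phi a0 \<Theta> y) (at y)" if "0 < \<Theta>" for \<Theta>
    using that by (intro tendsto_Phi tendsto_intros)
  ultimately have "\<forall>\<^sub>F x in at y. Phi a0 (?\<Theta> - e) x < 0" "\<forall>\<^sub>F x in at y. 0 < Phi a0 (?\<Theta> + e) x"
    using e pos by (auto intro: order_tendstoD[OF lim])
  moreover have "\<forall>\<^sub>F x in at y. x \<noteq> 0"
    using assms(1) by (intro tendsto_imp_eventually_ne[OF tendsto_ident_at])
  ultimately show "\<forall>\<^sub>F x in at y. dist (controllability_fun pos a0 x) ?\<Theta> < e0"
  proof eventually_elim
    case (elim x)
    let ?\<Theta>' = "controllability_fun pos a0 x"
    have pos': "0 < ?\<Theta>'" and zero': "Phi a0 ?\<Theta>' x = 0"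
      using controllability_fun[OF elim(3) a0] by auto
    have "?\<Theta> - e < ?\<Theta>'"
    proof (rule ccontr)
      assume "\<not> ?thesis"
      then show False
        using Phi_strict_mono[OF a0 pos', of "?\<Theta> - e" x] zero' elim(1) by (cases "?\<Theta>' = ?\<Theta> - e") auto
    qed
    moreover have "?\<Theta>' < ?\<Theta> + e"
    proof (rule ccontr)
      assume "\<not> ?thesis"
      then show False
        using Phi_strict_mono[OF a0, of "?\<Theta> + e" ?\<Theta>' x] zero' elim(2) pos e(1) by (cases "?\<Theta>' = ?\<Theta> + e") auto
    qed
    ultimately show ?case using e(2) by (simp add: dist_real_def abs_less_iff)
  qed
qed

lemma switching_fun_eq:
  assumes "y \<noteq> 0" "0 < a0"
  shows "switching_fun pos a0 y = last_unit pos \<bullet> wv (controllability_fun pos a0 y) y"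
  by (simp add: switching_fun_def gram_inverse_vec controllability_fun_pos[OF assms])

lemma isCont_switching_fun:
  assumes "y \<noteq> 0" "0 < a0"
  shows "isCont (switching_fun pos a0) y"
proof -
  have "((\<lambda>x. last_unit pos \<bullet> wv (controllability_fun pos a0 x) x) \<longlongrightarrow> switching_fun pos a0 y) (at y)"
    unfolding switching_fun_eq[OF assms]
    by (intro tendsto_inner tendsto_const tendsto_wv tendsto_ident_at controllability_fun_pos assms
        isCont_controllability_fun[OF assms, unfolded isCont_def])
  moreover have "\<forall>\<^sub>F x in at y. last_unit pos \<bullet> wv (controllability_fun pos a0 x) x = switching_fun pos a0 x"
    using tendsto_imp_eventually_ne[OF tendsto_ident_at assms(1)]
    by eventually_elim (simp add: switching_fun_eq assms(2))
  ultimately show ?thesis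
    unfolding isCont_def by (rule Lim_transform_eventually)
qed

section \<open>The Lyapunov identity of the Gram matrix and the decay estimate\<close>

lemma superdiag_C_nth:
  "(superdiag pos ** C) $ p $ q =
     - real (deg p) * cf p * cf q / (real (deg p + deg q) * real (deg p + deg q + 1))"
proof (cases "deg p")
  \<comment> \<open>When \<open>deg q\<close> is 0 too, numerator and denominator on the right both
    vanish; the quotient is then 0, in agreement with the zero row of the shift matrix.\<close>
  case 0
  then show ?thesis by (simp add: matrix_matrix_mult_def superdiag_nth)
next
  case (Suc j)
  then obtain r0 where r0: "deg r0 = j" using ex_deg[of j] deg_less[of p] by auto
  have "cf r0 = - real (deg p) * cf p"
    by (simp add: cf_def r0 Suc divide_simps) (simp add: algebra_simps)
  have "(superdiag pos ** C) $ p $ q = (\<Sum>r\<in>UNIV. if r = r0 then C $ r0 $ q else 0)"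
    unfolding matrix_matrix_mult_def vec_lambda_beta
    using r0 Suc deg_eq_iff by (intro sum.cong) (auto simp: superdiag_nth)
  also have "\<dots> = - real (deg p) * cf p * cf q / (real (deg p + deg q) * real (deg p + deg q + 1))"
    using \<open>cf r0 = _\<close> by (simp add: C_nth r0 Suc)
  finally show ?thesis .
qed

text \<open>The Lyapunov identity at \<Theta> = 1, entry by entry. The rank one term is present only
  where both degrees are 0; there the left-hand side vanishes and \<open>C\<close> and
  \<open>D\<close> contribute 1/2 each. Elsewhere it is a partial fraction identity in the sum of
  the degrees.\<close>

lemma Lyapunov_nth:
  "(superdiag pos ** C) $ p $ q + (superdiag pos ** C) $ q $ p
     = last_unit pos $ p * last_unit pos $ q - C $ p $ q - D $ p $ q"
proof (cases "deg p + deg q = 0")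
  case True
  then show ?thesis
    by (simp add: superdiag_C_nth last_unit_nth C_nth D_def cf_def)
next
  case False
  define j where "j = deg p + deg q"
  have "(superdiag pos ** C) $ p $ q + (superdiag pos ** C) $ q $ p
      = - (cf p * cf q) * (real j / (real j * real (j + 1)))"
  proof -
    have "- real (deg p) * cf p * cf q / X + - real (deg q) * cf q * cf p / X = - (cf p * cf q) * (real j / X)" for X
      unfolding add_divide_distrib[symmetric] times_divide_eq_right
      by (rule arg_cong[where f = "\<lambda>u. u / X"]) (simp add: j_def algebra_simps)
    then show ?thesis
      unfolding superdiag_C_nth add.commute[of "deg q"] j_def[symmetric] .
  qed
  also have "\<dots> = - (cf p * cf q) / real (j + 1)"
  proof -
    have "real j \<noteq> 0" using False by (simp only: j_def of_nat_eq_0_iff not_False_eq_True)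
    then show ?thesis by simp
  qed
  also have "\<dots> = - (cf p * cf q) * (1 / (real (j + 1) * real (j + 2)) + 1 / real (j + 2))"
    by (simp add: divide_simps)
  also have "\<dots> = last_unit pos $ p * last_unit pos $ q - C $ p $ q - D $ p $ q"
    using False by (auto simp: C_nth D_def j_def last_unit_nth algebra_simps)
  finally show ?thesis .
qed

lemma Lyapunov_form:
  "2 * (x \<bullet> (superdiag pos *v (C *v x))) = (last_unit pos \<bullet> x)\<^sup>2 - x \<bullet> (C *v x) - x \<bullet> (D *v x)"
proof -
  let ?S = "\<lambda>M. \<Sum>p\<in>UNIV. \<Sum>q\<in>UNIV. x $ p * x $ q * M p q"
  have "x \<bullet> (superdiag pos *v (C *v x)) = ?S (\<lambda>p q. (superdiag pos ** C) $ p $ q)"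
    unfolding matrix_vector_mul_assoc inner_matrix_vector ..
  moreover have "?S (\<lambda>p q. (superdiag pos ** C) $ p $ q) = ?S (\<lambda>p q. (superdiag pos ** C) $ q $ p)"
    by (subst sum.swap) (simp add: mult.commute)
  ultimately have "2 * (x \<bullet> (superdiag pos *v (C *v x)))
      = ?S (\<lambda>p q. (superdiag pos ** C) $ p $ q + (superdiag pos ** C) $ q $ p)"
    by (simp add: distrib_left sum.distrib)
  also have "\<dots> = ?S (\<lambda>p q. last_unit pos $ p * last_unit pos $ q) - x \<bullet> (C *v x) - x \<bullet> (D *v x)"
    unfolding Lyapunov_nth inner_matrix_vector by (simp add: right_diff_distrib sum_subtractf)
  also have "?S (\<lambda>p q. last_unit pos $ p * last_unit pos $ q) = (last_unit pos \<bullet> x)\<^sup>2"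
    by (simp add: power2_eq_square inner_vec_def sum_product mult_ac)
  finally show ?thesis .
qed

text \<open>The shift links coordinates whose degrees differ by exactly one, so it commutes with the
  rescaling up to one factor \<Theta>. This reduces the decay estimate to the identity at \<Theta> =
  1.\<close>

lemma scaled_superdiag:
  assumes "0 < \<Theta>"
  shows "scaled \<Theta> (superdiag pos *v y) = (1 / \<Theta>) *\<^sub>R (superdiag pos *v scaled \<Theta> y)"
proof (intro vec_eq_iff[THEN iffD2] allI)
  fix p
  have "superdiag pos $ p $ q * y $ q / \<Theta> ^ deg p = superdiag pos $ p $ q * (y $ q / \<Theta> ^ deg q) / \<Theta>" for q
    by (simp add: superdiag_nth)
  then have "(\<Sum>q\<in>UNIV. superdiag pos $ p $ q * y $ q / \<Theta> ^ deg p)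
      = (\<Sum>q\<in>UNIV. superdiag pos $ p $ q * (y $ q / \<Theta> ^ deg q) / \<Theta>)"
    by (intro sum.cong refl)
  then show "scaled \<Theta> (superdiag pos *v y) $ p = ((1 / \<Theta>) *\<^sub>R (superdiag pos *v scaled \<Theta> y)) $ p"
    by (simp add: scaled_def matrix_vector_mult_def sum_divide_distrib)
qed

lemma last_unit_wv: "last_unit pos \<bullet> wv \<Theta> y = last_unit pos \<bullet> om \<Theta> y / \<Theta>"
  unfolding inner_vec_def sum_divide_distrib
  by (intro sum.cong) (auto simp: last_unit_nth wv_def)

text \<open>The origin of the upper bound on \<open>a0\<close>: Cauchy-Schwarz with
  \<open>K *v last_unit pos\<close> bounds the square of
  \<open>last_unit pos \<bullet> om \<Theta> y\<close> by \<open>2 * a0 * \<Theta>\<^sup>2\<close>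
  times the very form that divides \<open>2 * d\<^sup>2\<close> in that bound, hence by
  \<open>(2 * d * \<Theta>)\<^sup>2\<close>.\<close>

lemma switching_fun_bound:
  assumes y: "y \<noteq> 0" and a0: "0 < a0" and d: "0 < d"
    and a0_le: "a0 \<le> 2 * d\<^sup>2 / ((K *v last_unit pos) \<bullet> last_unit pos)"
  shows "\<bar>switching_fun pos a0 y\<bar> \<le> 2 * d"
proof -
  let ?b = "last_unit pos"
  let ?\<Theta> = "controllability_fun pos a0 y"
  have pos: "0 < ?\<Theta>" and "Phi a0 ?\<Theta> y = 0"
    using controllability_fun[OF y a0] by auto
  then have Q: "om ?\<Theta> y \<bullet> scaled ?\<Theta> y = 2 * a0 * ?\<Theta>\<^sup>2"
    by (simp add: Phi_def field_simps power2_eq_square)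
  obtain z where "deg z = 0" using ex_deg[of 0] by auto
  then have "?b \<noteq> 0" by (auto simp: vec_eq_iff last_unit_nth)
  then have "K *v ?b \<noteq> 0" by (metis CK_vec matrix_vector_mult_0_right)
  define N where "N = (K *v ?b) \<bullet> ?b"
  have N: "0 < N" "(K *v ?b) \<bullet> (C *v (K *v ?b)) = N"
    using C_pos[OF \<open>K *v ?b \<noteq> 0\<close>] by (simp_all add: N_def CK_vec)
  have "?b \<bullet> om ?\<Theta> y = scaled ?\<Theta> y \<bullet> (K *v ?b)"
    using inner_C_om[of ?\<Theta> y "K *v ?b"] by (simp add: CK_vec inner_commute)
  then have "(?b \<bullet> om ?\<Theta> y)\<^sup>2 \<le> 2 * a0 * ?\<Theta>\<^sup>2 * N"
    using scaled_Cauchy_Schwarz[of ?\<Theta> y "K *v ?b"] N(2) Q by simp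
  also have "\<dots> = 2 * (a0 * N) * ?\<Theta>\<^sup>2" by simp
  also have "\<dots> \<le> 2 * (2 * d\<^sup>2) * ?\<Theta>\<^sup>2"
    using a0_le N(1) by (intro mult_right_mono mult_left_mono) (auto simp: N_def pos_le_divide_eq)
  also have "\<dots> = (2 * d * ?\<Theta>)\<^sup>2" by (simp add: power2_eq_square)
  finally have "\<bar>?b \<bullet> om ?\<Theta> y\<bar> \<le> 2 * d * ?\<Theta>"
    using d pos by (simp add: abs_le_square_iff[symmetric] abs_mult)
  then show ?thesis
    using pos by (simp add: switching_fun_eq[OF y a0] last_unit_wv abs_divide pos_divide_le_eq)
qed

text \<open>By \<open>DERIV_Phi\<close> this says that the controllability function decreases at least at unit speed
  along the velocity \<open>superdiag pos *v y + h *\<^sub>R last_unit pos\<close>.\<close>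

lemma decay:
  assumes y: "y \<noteq> 0" and a0: "0 < a0" and d: "0 < d"
    and a0_le: "a0 \<le> 2 * d\<^sup>2 / ((K *v last_unit pos) \<bullet> last_unit pos)"
    and h: "0 < switching_fun pos a0 y \<Longrightarrow> h \<le> - d" "switching_fun pos a0 y < 0 \<Longrightarrow> d \<le> h"
  defines "\<Theta> \<equiv> controllability_fun pos a0 y"
  shows "2 * (wv \<Theta> y \<bullet> (superdiag pos *v y + h *\<^sub>R last_unit pos)) \<le> - dPhi a0 \<Theta> y"
proof -
  define \<sigma> where "\<sigma> = switching_fun pos a0 y"
  have pos: "0 < \<Theta>" and "Phi a0 \<Theta> y = 0"
    using controllability_fun[OF y a0] by (auto simp: \<Theta>_def)
  then have Q: "om \<Theta> y \<bullet> scaled \<Theta> y = 2 * a0 * \<Theta>\<^sup>2"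
    by (simp add: Phi_def field_simps power2_eq_square)
  have \<sigma>: "\<sigma> = last_unit pos \<bullet> wv \<Theta> y" "\<sigma> = last_unit pos \<bullet> om \<Theta> y / \<Theta>"
    by (simp_all add: \<sigma>_def \<Theta>_def switching_fun_eq[OF y a0] last_unit_wv)
  \<comment> \<open>The motion without input: homogeneity brings it to \<Theta> = 1, the Lyapunov
    identity evaluates it, and \<open>Q\<close> replaces the form of \<open>C\<close> by
    \<open>2 * a0 * \<Theta>\<^sup>2\<close>.\<close>
  have "2 * (wv \<Theta> y \<bullet> (superdiag pos *v y)) = 2 * (om \<Theta> y \<bullet> (superdiag pos *v (C *v om \<Theta> y))) / \<Theta>\<^sup>2"
    using pos by (simp add: inner_wv scaled_superdiag C_om power2_eq_square)
  also have "\<dots> = \<sigma>\<^sup>2 - dPhi a0 \<Theta> y"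
    unfolding Lyapunov_form om_scaled[symmetric] Q \<sigma>(2) dPhi_def using pos
    by (simp add: field_simps)
  finally have *: "2 * (wv \<Theta> y \<bullet> (superdiag pos *v y)) = \<sigma>\<^sup>2 - dPhi a0 \<Theta> y" .
  have "\<bar>\<sigma>\<bar> \<le> 2 * d"
    unfolding \<sigma>_def by (rule switching_fun_bound[OF y a0 d a0_le])
  have "\<sigma> * (\<sigma> + 2 * h) \<le> 0"
  proof (cases \<sigma> "0 :: real" rule: linorder_cases)
    case less
    then show ?thesis using h(2) \<open>\<bar>\<sigma>\<bar> \<le> 2 * d\<close> by (intro mult_nonpos_nonneg) (auto simp: \<sigma>_def)
  next
    case greater
    then show ?thesis using h(1) \<open>\<bar>\<sigma>\<bar> \<le> 2 * d\<close> by (intro mult_nonneg_nonpos) (auto simp: \<sigma>_def)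
  qed simp
  moreover have "2 * (wv \<Theta> y \<bullet> (superdiag pos *v y + h *\<^sub>R last_unit pos))
      = 2 * (wv \<Theta> y \<bullet> (superdiag pos *v y)) + 2 * h * \<sigma>"
    by (simp add: inner_add_right \<sigma>(1) inner_commute distrib_left)
  ultimately show ?thesis unfolding * by (simp add: power2_eq_square algebra_simps)
qed

end

section \<open>Decrease along trajectories\<close>

lemma has_integral_le_off_negligible:
  fixes g h :: "real \<Rightarrow> real"
  assumes "(g has_integral a) S" "(h has_integral b) S" "negligible N"
    and le: "\<And>t. t \<in> S - N \<Longrightarrow> g t \<le> h t"
  shows "a \<le> b"
proof (rule has_integral_le)
  show "((\<lambda>t. if t \<in> N then h t else g t) has_integral a) S"
    by (rule has_integral_spike[OF assms(3) _ assms(1)]) auto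
qed (use assms in auto)

context chain
begin

definition slope_vec :: "real \<Rightarrow> real \<Rightarrow> real ^ 'k \<Rightarrow> real ^ 'k" where
  "slope_vec a0 \<Theta> y = (2 / dPhi a0 \<Theta> y) *\<^sub>R wv \<Theta> y"

lemma tendsto_slope_vec:
  assumes "(g \<longlongrightarrow> \<Theta>) F" "(h \<longlongrightarrow> y) F" "0 < \<Theta>" "0 < a0"
  shows "((\<lambda>x. slope_vec a0 (g x) (h x)) \<longlongrightarrow> slope_vec a0 \<Theta> y) F"
  unfolding slope_vec_def using dPhi_pos[OF assms(4), of \<Theta> y]
  by (intro tendsto_intros tendsto_dPhi tendsto_wv assms) auto

text \<open>\<open>slope_vec\<close> is the gradient of the controllability function. Instead of the implicit function
  theorem we apply the mean value theorem to \<open>Phi\<close>.\<close>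

lemma controllability_fun_mean_value:
  assumes y: "y1 \<noteq> 0" "y2 \<noteq> 0" and a0: "0 < a0"
  defines "\<Theta> \<equiv> controllability_fun pos a0"
  shows "\<exists>w\<in>closed_segment (\<Theta> y1, y1) (\<Theta> y2, y2).
    \<Theta> y2 - \<Theta> y1 = slope_vec a0 (fst w) (snd w) \<bullet> (y2 - y1)"
proof -
  \<comment> \<open>\<open>Phi\<close> vanishes at both ends of this segment. In between,
    \<open>\<upsilon> r\<close> may pass through 0; for the differentiability of \<open>Phi\<close>
    it is enough that \<open>\<theta> r\<close> stays positive.\<close>
  define \<theta> where "\<theta> r = \<Theta> y1 + r * (\<Theta> y2 - \<Theta> y1)" for r
  define \<upsilon> where "\<upsilon> r = y1 + r *\<^sub>R (y2 - y1)" for r :: real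
  have pos: "0 < \<Theta> y1" "0 < \<Theta> y2"
    using controllability_fun_pos[OF _ a0] y by (auto simp: \<Theta>_def)
  have \<theta>_pos: "0 < \<theta> r" if "0 \<le> r" "r \<le> 1" for r
  proof -
    have "\<theta> r = (1 - r) * \<Theta> y1 + r * \<Theta> y2" by (simp add: \<theta>_def algebra_simps)
    moreover have "0 < (1 - r) * \<Theta> y1 + r * \<Theta> y2"
      using that pos by (cases "r = 0") (auto intro!: add_nonneg_pos)
    ultimately show ?thesis by simp
  qed
  have deriv: "((\<lambda>r. Phi a0 (\<theta> r) (\<upsilon> r)) has_real_derivative
      dPhi a0 (\<theta> r) (\<upsilon> r) * (\<Theta> y2 - \<Theta> y1) - 2 * (wv (\<theta> r) (\<upsilon> r) \<bullet> (y2 - y1))) (at r)"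
    if "0 \<le> r" "r \<le> 1" for r
  proof (rule DERIV_Phi)
    show "0 < \<theta> r" by (rule \<theta>_pos[OF that])
    show "((\<lambda>r. \<upsilon> r $ p) has_real_derivative (y2 - y1) $ p) (at r)" for p
      unfolding \<upsilon>_def by (auto intro!: derivative_eq_intros)
    show "(\<theta> has_real_derivative \<Theta> y2 - \<Theta> y1) (at r)"
      unfolding \<theta>_def by (auto intro!: derivative_eq_intros)
  qed
  have "\<exists>r>0. r < 1 \<and> Phi a0 (\<theta> 1) (\<upsilon> 1) - Phi a0 (\<theta> 0) (\<upsilon> 0) = (1 - 0) *
      (dPhi a0 (\<theta> r) (\<upsilon> r) * (\<Theta> y2 - \<Theta> y1) - 2 * (wv (\<theta> r) (\<upsilon> r) \<bullet> (y2 - y1)))"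
    by (rule MVT2) (use deriv in auto)
  then obtain r where r: "0 < r" "r < 1" and "Phi a0 (\<theta> 1) (\<upsilon> 1) - Phi a0 (\<theta> 0) (\<upsilon> 0) =
      dPhi a0 (\<theta> r) (\<upsilon> r) * (\<Theta> y2 - \<Theta> y1) - 2 * (wv (\<theta> r) (\<upsilon> r) \<bullet> (y2 - y1))"
    by auto
  moreover have "Phi a0 (\<theta> 1) (\<upsilon> 1) = 0" "Phi a0 (\<theta> 0) (\<upsilon> 0) = 0"
    using Phi_controllability_fun[OF _ a0] y by (auto simp: \<theta>_def \<upsilon>_def \<Theta>_def)
  ultimately have "dPhi a0 (\<theta> r) (\<upsilon> r) * (\<Theta> y2 - \<Theta> y1) = 2 * (wv (\<theta> r) (\<upsilon> r) \<bullet> (y2 - y1))"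
    by simp
  then have "\<Theta> y2 - \<Theta> y1 = slope_vec a0 (\<theta> r) (\<upsilon> r) \<bullet> (y2 - y1)"
    using dPhi_pos[OF a0, of "\<theta> r" "\<upsilon> r"] by (simp add: slope_vec_def field_simps)
  moreover have "(\<theta> r, \<upsilon> r) \<in> closed_segment (\<Theta> y1, y1) (\<Theta> y2, y2)"
    unfolding in_segment using r by (intro exI[of _ r]) (auto simp: \<theta>_def \<upsilon>_def algebra_simps)
  ultimately show ?thesis by force
qed

text \<open>The velocity is merely integrable, so the chain rule is replaced by estimates of
  increments. On short intervals the gradient varies by less than \<epsilon>, which gives slope -1
  up to \<epsilon> times the integral of \<open>norm (v t)\<close>. This error is additive over
  adjacent intervals, hence survives the bisection, and finally \<epsilon> tends to 0.\<close>

theorem controllability_fun_decreases: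
  assumes a0: "0 < a0" and d: "0 < d"
    and a0_le: "a0 \<le> 2 * d\<^sup>2 / ((K *v last_unit pos) \<bullet> last_unit pos)"
    and v: "\<And>t. t \<in> {0..<\<tau>} \<Longrightarrow> v absolutely_integrable_on {0..t} \<and> y t = y 0 + integral {0..t} v"
    and y: "\<And>t. t \<in> {0..<\<tau>} \<Longrightarrow> y t \<noteq> 0"
    and AE: "AE t in lebesgue. t \<in> {0..<\<tau>} \<longrightarrow> (\<exists>h. v t = superdiag pos *v y t + h *\<^sub>R last_unit pos \<and>
      (0 < switching_fun pos a0 (y t) \<longrightarrow> h \<le> - d) \<and> (switching_fun pos a0 (y t) < 0 \<longrightarrow> d \<le> h))"
    and T: "0 \<le> T" "T < \<tau>"
  shows "controllability_fun pos a0 (y T) \<le> controllability_fun pos a0 (y 0) - T"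
proof -
  define \<theta> where "\<theta> t = controllability_fun pos a0 (y t)" for t
  define I where "I t = integral {0..t} (\<lambda>t. norm (v t))" for t
  have \<theta>_pos: "0 < \<theta> t" if "t \<in> {0..<\<tau>}" for t
    unfolding \<theta>_def by (rule controllability_fun_pos[OF y[OF that] a0])
  have slope: "AE t in lebesgue. t \<in> {0..<\<tau>} \<longrightarrow> slope_vec a0 (\<theta> t) (y t) \<bullet> v t \<le> - 1"
    using AE
  proof eventually_elim
    case (elim t)
    show ?case
    proof
      assume t: "t \<in> {0..<\<tau>}"
      then obtain h where h: "v t = superdiag pos *v y t + h *\<^sub>R last_unit pos"
        "0 < switching_fun pos a0 (y t) \<longrightarrow> h \<le> - d" "switching_fun pos a0 (y t) < 0 \<longrightarrow> d \<le> h"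
        using elim by blast
      have "2 * (wv (\<theta> t) (y t) \<bullet> v t) \<le> - dPhi a0 (\<theta> t) (y t)"
        unfolding \<theta>_def h(1) by (rule decay[OF y[OF t] a0 d a0_le]) (use h in auto)
      then show "slope_vec a0 (\<theta> t) (y t) \<bullet> v t \<le> - 1"
        using dPhi_pos[OF a0, of "\<theta> t" "y t"] by (simp add: slope_vec_def pos_divide_le_eq)
    qed
  qed
  then obtain N where N: "negligible N"
    and slopeN: "\<And>t. t \<in> {0..<\<tau>} - N \<Longrightarrow> slope_vec a0 (\<theta> t) (y t) \<bullet> v t \<le> - 1"
    unfolding eventually_ae_filter_negligible by blast
  have lim_y: "(y \<longlongrightarrow> y r) (at r within {0..S})" if r: "r \<in> {0..S}" and S: "S < \<tau>" for r S
  proof -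
    have "S \<in> {0..<\<tau>}" using r S by auto
    then have "v integrable_on {0..S}"
      using v[of S] unfolding absolutely_integrable_on_def by blast
    then have "continuous_on {0..S} (\<lambda>t. y 0 + integral {0..t} v)"
      by (intro continuous_intros indefinite_integral_continuous_1)
    then have "continuous_on {0..S} y"
    proof (rule continuous_on_eq)
      fix t assume "t \<in> {0..S}"
      then have "t \<in> {0..<\<tau>}" using S by auto
      from v[OF this] show "y 0 + integral {0..t} v = y t" by (rule conjunct2[THEN sym])
    qed
    then show ?thesis using r by (simp add: continuous_on_def)
  qed
  have main: "\<theta> T - \<theta> 0 \<le> - (T - 0) + \<epsilon> * (I T - I 0)" if \<epsilon>: "0 < \<epsilon>" for \<epsilon>
  proof (rule near_interval[OF order_refl T, where P = "\<lambda>s s'. \<theta> s' - \<theta> s \<le> - (s' - s) + \<epsilon> * (I s' - I s)"])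
    fix r assume r: "0 \<le> r" "r \<le> T"
    \<comment> \<open>A time strictly between \<open>T\<close> and \<tau>, so that times just after
      \<open>r = T\<close> are covered by continuity on a closed interval as well.\<close>
    define S where "S = (T + \<tau>) / 2"
    have S: "T < S" "S < \<tau>" using T by (auto simp: S_def)
    have r': "r \<in> {0..<\<tau>}" "r \<in> {0..S}" using r T S by auto
    define Q where "Q w = slope_vec a0 (fst w) (snd w)" for w
    have "((\<lambda>w. slope_vec a0 (fst w) (snd w)) \<longlongrightarrow> slope_vec a0 (\<theta> r) (y r)) (at (\<theta> r, y r))"
      using tendsto_fst[OF tendsto_ident_at[of "(\<theta> r, y r)" UNIV]] tendsto_snd[OF tendsto_ident_at[of "(\<theta> r, y r)" UNIV]]
      by (intro tendsto_slope_vec a0 \<theta>_pos[OF r'(1)]) simp_all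
    then have "(Q \<longlongrightarrow> Q (\<theta> r, y r)) (at (\<theta> r, y r))"
      unfolding Q_def by simp
    from metric_LIM_D[OF this, of "\<epsilon> / 2"] \<epsilon>
    obtain \<delta> where \<delta>0: "0 < \<delta>"
      "\<forall>w. w \<noteq> (\<theta> r, y r) \<and> dist w (\<theta> r, y r) < \<delta> \<longrightarrow> dist (Q w) (Q (\<theta> r, y r)) < \<epsilon> / 2"
      by auto
    have \<delta>: "dist (Q w) (Q (\<theta> r, y r)) < \<epsilon> / 2" if "dist w (\<theta> r, y r) < \<delta>" for w
    proof (cases "w = (\<theta> r, y r)")
      case True
      with \<epsilon> show ?thesis by simp
    next
      case False
      with \<delta>0(2) that show ?thesis by blast
    qed
    have "((\<lambda>t. (\<theta> t, y t)) \<longlongrightarrow> (\<theta> r, y r)) (at r within {0..S})"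
      unfolding \<theta>_def
      by (rule tendsto_Pair[OF isCont_tendsto_compose[OF
            isCont_controllability_fun[OF y[OF r'(1)] a0] lim_y[OF r'(2) S(2)]] lim_y[OF r'(2) S(2)]])
    then have "\<forall>\<^sub>F t in at r within {0..S}. dist (\<theta> t, y t) (\<theta> r, y r) < \<delta>"
      by (rule tendstoD[OF _ \<delta>0(1)])
    then obtain \<eta>0 where \<eta>0: "0 < \<eta>0"
      "\<forall>t\<in>{0..S}. t \<noteq> r \<and> dist t r < \<eta>0 \<longrightarrow> dist (\<theta> t, y t) (\<theta> r, y r) < \<delta>"
      unfolding eventually_at by auto
    define \<eta> where "\<eta> = min \<eta>0 (S - T)"
    have "0 < \<eta>" using \<eta>0(1) S by (simp add: \<eta>_def)
    have close: "dist (\<theta> t, y t) (\<theta> r, y r) < \<delta>" if "0 \<le> t" "r - \<eta> < t" "t < r + \<eta>" for t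
    proof (cases "t = r")
      case False
      with that r \<eta>0(2) show ?thesis by (auto simp: \<eta>_def dist_real_def)
    qed (use \<delta>0(1) in simp)
    have "\<theta> s' - \<theta> s \<le> - (s' - s) + \<epsilon> * (I s' - I s)"
      if s: "0 \<le> s" "s \<le> s'" "s' < \<tau>" "r - \<eta> < s" "s' < r + \<eta>" for s s'
    proof -
      have ss: "s \<in> {0..<\<tau>}" "s' \<in> {0..<\<tau>}" using s by auto
      obtain w where w: "w \<in> closed_segment (\<theta> s, y s) (\<theta> s', y s')"
        "\<theta> s' - \<theta> s = Q w \<bullet> (y s' - y s)"
        using controllability_fun_mean_value[OF y[OF ss(1)] y[OF ss(2)] a0] unfolding \<theta>_def Q_def by blast
      have "closed_segment (\<theta> s, y s) (\<theta> s', y s') \<subseteq> ball (\<theta> r, y r) \<delta>"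
        using close[of s] close[of s'] s
        by (intro closed_segment_subset convex_ball) (auto simp: dist_commute)
      then have Qw: "dist (Q w) (Q (\<theta> r, y r)) < \<epsilon> / 2"
        using w(1) by (intro \<delta>) (auto simp: dist_commute)
      have int: "v integrable_on {0..s'}" "(\<lambda>t. norm (v t)) integrable_on {0..s'}"
        using v[OF ss(2)] unfolding absolutely_integrable_on_def by blast+
      have int_s: "v integrable_on {s..s'}" "(\<lambda>t. norm (v t)) integrable_on {s..s'}"
        using integrable_on_subinterval[OF int(1), of s s'] integrable_on_subinterval[OF int(2), of s s'] s by auto
      have "y s' - y s = integral {0..s'} v - integral {0..s} v"
        using arg_cong2[where f = "(-)", OF conjunct2[OF v[OF ss(2)]] conjunct2[OF v[OF ss(1)]]]
        by (simp only: add_diff_cancel_left)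
      also have "\<dots> = integral {s..s'} v"
        using Henstock_Kurzweil_Integration.integral_combine[OF s(1,2) int(1), symmetric] by simp
      finally have diff: "y s' - y s = integral {s..s'} v" .
      have diff_I: "I s' - I s = integral {s..s'} (\<lambda>t. norm (v t))"
        using Henstock_Kurzweil_Integration.integral_combine[OF s(1,2) int(2), symmetric] by (simp add: I_def)
      show ?thesis
      \<comment> \<open>The mean value theorem supplies one gradient \<open>Q w\<close> for the
        whole interval; at almost every time it is compared with the gradient at
        \<open>(\<theta> t, y t)\<close>, for which the decay estimate holds.\<close>
      proof (rule has_integral_le_off_negligible[OF _ _ N])
        show "((\<lambda>t. Q w \<bullet> v t) has_integral \<theta> s' - \<theta> s) {s..s'}"
          unfolding w(2) diff
          using has_integral_linear[OF integrable_integral[OF int_s(1)] bounded_linear_inner_right[of "Q w"]]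
          by (simp add: o_def)
        show "((\<lambda>t. - 1 + \<epsilon> * norm (v t)) has_integral - (s' - s) + \<epsilon> * (I s' - I s)) {s..s'}"
          unfolding diff_I
          using has_integral_const_real[of "- 1 :: real" s s'] s(2)
          by (intro has_integral_add has_integral_mult_right integrable_integral int_s) simp
        fix t assume t: "t \<in> {s..s'} - N"
        have "dist (Q (\<theta> t, y t)) (Q (\<theta> r, y r)) < \<epsilon> / 2"
          using close[of t] t s by (intro \<delta>) auto
        with Qw have "dist (Q w) (Q (\<theta> t, y t)) < \<epsilon>"
          by (rule dist_triangle_half_l)
        then have "(Q w - Q (\<theta> t, y t)) \<bullet> v t \<le> \<epsilon> * norm (v t)"
          by (intro order_trans[OF norm_cauchy_schwarz] mult_right_mono) (auto simp: dist_norm)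
        moreover have "Q (\<theta> t, y t) \<bullet> v t \<le> - 1"
          using slopeN[of t] t s by (simp add: Q_def)
        ultimately show "Q w \<bullet> v t \<le> - 1 + \<epsilon> * norm (v t)"
          by (simp add: inner_diff_left)
      qed
    qed
    with \<open>0 < \<eta>\<close> show "near \<tau> r (\<lambda>s s'. \<theta> s' - \<theta> s \<le> - (s' - s) + \<epsilon> * (I s' - I s))"
      unfolding near_def by blast
  qed (simp add: algebra_simps)
  have "\<theta> T - \<theta> 0 \<le> - T"
  proof (rule le_if_le_add_small[of 1])
    show "\<theta> T - \<theta> 0 \<le> - T + (I T - I 0) * e" if "0 < e" for e
      using main[OF that] by (simp add: mult.commute)
  qed simp
  then show ?thesis by (simp add: \<theta>_def)
qed

end

section \<open>The closed-loop system\<close>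

lemma bounded_linear_block: "bounded_linear (block coord pos i)"
  unfolding linear_conv_bounded_linear[symmetric]
  by (rule linearI) (simp_all add: block_def vec_eq_iff)

lemma continuously_differentiable_imp_continuous_on:
  "continuously_differentiable h \<Longrightarrow> continuous_on S h"
  unfolding continuously_differentiable_def
  by (meson continuous_at_imp_continuous_on has_derivative_continuous)

lemma filippov_solution_cong:
  assumes "filippov_solution f \<tau> x" "\<And>t. t \<in> {0..<\<tau>} \<Longrightarrow> x' t = x t"
  shows "filippov_solution f \<tau> x'"
proof -
  obtain v where v: "\<forall>t\<in>{0..<\<tau>}. v absolutely_integrable_on {0..t} \<and> x t = x 0 + integral {0..t} v"
    "AE t in lebesgue. t \<in> {0..<\<tau>} \<longrightarrow> v t \<in> filippov f (x t)"
    using assms(1) unfolding filippov_solution_def by blast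
  have "v absolutely_integrable_on {0..t} \<and> x' t = x' 0 + integral {0..t} v" if "t \<in> {0..<\<tau>}" for t
  proof -
    have "x' t = x t" "x' 0 = x 0" using assms(2) that by auto
    with v(1) that show ?thesis by metis
  qed
  moreover have "AE t in lebesgue. t \<in> {0..<\<tau>} \<longrightarrow> v t \<in> filippov f (x' t)"
    using v(2) by eventually_elim (use assms(2) in simp)
  ultimately show ?thesis unfolding filippov_solution_def by blast
qed

locale closed_loop = chain pos
  for pos :: "'k::finite \<Rightarrow> nat" +
  fixes m i :: nat and ns :: "nat \<Rightarrow> nat"
    and coord :: "nat \<Rightarrow> nat \<Rightarrow> 'n::finite"
    and H :: "nat \<Rightarrow> real ^ 'n \<Rightarrow> real \<Rightarrow> real"
    and a0 d :: real
    and uplus uminus u :: "real ^ 'n \<Rightarrow> real"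
  assumes coord: "bij_betw (\<lambda>(j, k). coord j k) (block_indices m ns) (UNIV :: 'n set)"
    and H: "\<And>j. j \<in> {1..m} \<Longrightarrow> continuously_differentiable (\<lambda>(z, w). H j z w)"
    and i: "i \<in> {1..m}"
    and pos: "bij_betw pos (UNIV :: 'k set) {1..ns i}"
    and d: "0 < d" and a0: "0 < a0"
    and a0_le: "a0 \<le> 2 * d\<^sup>2 / ((K *v last_unit pos) \<bullet> last_unit pos)"
    and uplus: "lipschitz_on_annuli uplus" and uminus: "lipschitz_on_annuli uminus"
    and H_plus: "\<And>z. z \<noteq> 0 \<Longrightarrow> d \<le> H i z (uplus z)"
    and H_minus: "\<And>z. z \<noteq> 0 \<Longrightarrow> H i z (uminus z) \<le> - d"
    and u_minus: "\<And>z. 0 < switching_fun pos a0 (block coord pos i z) \<Longrightarrow> u z = uminus z"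
    and u_plus: "\<And>z. switching_fun pos a0 (block coord pos i z) < 0 \<Longrightarrow> u z = uplus z"
    and u_zero: "\<And>z. switching_fun pos a0 (block coord pos i z) = 0 \<Longrightarrow>
              u z \<in> closed_segment (uminus z) (uplus z)"
begin

abbreviation blk :: "real ^ 'n \<Rightarrow> real ^ 'k" where
  "blk \<equiv> block coord pos i"

abbreviation \<Theta> :: "real ^ 'n \<Rightarrow> real" where
  "\<Theta> z \<equiv> controllability_fun pos a0 (blk z)"

abbreviation f :: "real ^ 'n \<Rightarrow> real ^ 'n" where
  "f z \<equiv> system_rhs m ns coord H z (u z)"

lemma blk_0: "blk 0 = 0"
  by (rule linear_simps(3)[OF bounded_linear_block])

lemma continuous_on_blk: "continuous_on S blk"
  by (rule linear_continuous_on[OF bounded_linear_block])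

lemma blk_nth: "blk v $ p = axis (coord i (pos p)) 1 \<bullet> v"
  by (simp add: block_def inner_axis')

lemma blk_f: "blk (f z) = superdiag pos *v blk z + H i z (u z) *\<^sub>R last_unit pos"
  by (rule block_system_rhs[OF coord pos i])

lemma u_between: "u z \<in> closed_segment (uminus z) (uplus z)"
  using u_minus[of z] u_plus[of z] u_zero[of z]
  by (cases "switching_fun pos a0 (blk z)" "0 :: real" rule: linorder_cases) auto

text \<open>A nonempty compact set off the origin lies in an annulus, with the extreme norms of its
  points as radii.\<close>

lemma bounded_image_lipschitz_on_annuli:
  assumes "lipschitz_on_annuli (w :: real ^ 'n \<Rightarrow> real)" "compact S" "0 \<notin> S"
  obtains W where "\<forall>z\<in>S. \<bar>w z\<bar> \<le> W"
proof (cases "S = {}")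
  case False
  obtain z1 where z1: "z1 \<in> S" "\<forall>z\<in>S. norm z1 \<le> norm z"
    using continuous_attains_inf[OF assms(2) False, of norm] by (auto intro: continuous_intros)
  obtain z2 where z2: "z2 \<in> S" "\<forall>z\<in>S. norm z \<le> norm z2"
    using continuous_attains_sup[OF assms(2) False, of norm] by (auto intro: continuous_intros)
  have "0 < norm z1" "norm z1 \<le> norm z2" using z1 z2 assms(3) by auto
  then obtain L where L: "L-lipschitz_on {z. norm z1 \<le> norm z \<and> norm z \<le> norm z2} w"
    using assms(1) unfolding lipschitz_on_annuli_def by blast
  have "continuous_on S w"
    by (rule continuous_on_subset[OF lipschitz_on_continuous_on[OF L]]) (use z1 z2 in auto)
  then have "bounded (w ` S)"
    using assms(2) by (intro compact_imp_bounded compact_continuous_image)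
  then obtain W where "\<forall>y\<in>w ` S. norm y \<le> W"
    unfolding bounded_iff by blast
  then have "\<forall>z\<in>S. \<bar>w z\<bar> \<le> W" by simp
  then show thesis by (rule that)
qed (use that in simp)

text \<open>On all three regions \<open>u\<close> lies between \<open>uminus\<close> and
  \<open>uplus\<close>, which are bounded on a closed ball that avoids the origin; continuity of the
  \<open>H j\<close> on a compact product does the rest.\<close>

lemma f_locally_bounded:
  assumes "z \<noteq> 0"
  shows "\<exists>\<delta>>0. \<exists>M. \<forall>w\<in>ball z \<delta>. norm (f w) \<le> M"
proof -
  define S where "S = cball z (norm z / 2)"
  have S: "compact S" "0 \<notin> S" using assms by (auto simp: S_def dist_norm)
  obtain W1 where W1: "\<forall>w\<in>S. \<bar>uplus w\<bar> \<le> W1" by (rule bounded_image_lipschitz_on_annuli[OF uplus S])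
  obtain W2 where W2: "\<forall>w\<in>S. \<bar>uminus w\<bar> \<le> W2" by (rule bounded_image_lipschitz_on_annuli[OF uminus S])
  define W where "W = max W1 W2"
  have u: "u w \<in> {- W..W}" if "w \<in> S" for w
  proof -
    have "closed_segment (uminus w) (uplus w) \<subseteq> {- W..W}"
      using W1[rule_format, OF that] W2[rule_format, OF that]
      by (intro closed_segment_subset convex_real_interval) (auto simp: W_def)
    with u_between show ?thesis by blast
  qed
  have "\<exists>M. \<forall>w\<in>S. \<bar>f w $ p\<bar> \<le> M" for p
  proof -
    let ?inv = "inv_into (block_indices m ns) (\<lambda>(j, k). coord j k) p"
    obtain j k where jk: "?inv = (j, k)" by fastforce
    have "p \<in> (\<lambda>(j, k). coord j k) ` block_indices m ns"
      using coord by (auto simp: bij_betw_def)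
    then have "?inv \<in> block_indices m ns" by (rule inv_into_into)
    then have j: "j \<in> {1..m}" using jk by (auto simp: block_indices_def)
    have fp: "f w $ p = (if k < ns j then w $ coord j (k + 1) else H j w (u w))" for w
      by (simp add: system_rhs_def jk)
    have "continuous_on (S \<times> {- W..W}) (\<lambda>(z, w). H j z w)"
      by (rule continuously_differentiable_imp_continuous_on[OF H[OF j]])
    then have "bounded ((\<lambda>(z, w). H j z w) ` (S \<times> {- W..W}))"
      using S(1) by (intro compact_imp_bounded compact_continuous_image compact_Times) auto
    then obtain M where M: "\<forall>y\<in>(\<lambda>(z, w). H j z w) ` (S \<times> {- W..W}). norm y \<le> M"
      unfolding bounded_iff by blast
    obtain M' where M': "\<forall>w\<in>S. norm w \<le> M'"
      using compact_imp_bounded[OF S(1)] unfolding bounded_iff by blast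
    have "\<bar>f w $ p\<bar> \<le> max M M'" if w: "w \<in> S" for w
    proof (cases "k < ns j")
      case True
      then have "\<bar>f w $ p\<bar> \<le> norm w" unfolding fp by (simp add: component_le_norm_cart)
      with M' w show ?thesis by fastforce
    next
      case False
      have "(w, u w) \<in> S \<times> {- W..W}" using u[OF w] w by blast
      then have "norm (H j w (u w)) \<le> M" using M by force
      with False show ?thesis unfolding fp by simp
    qed
    then show ?thesis by blast
  qed
  then obtain M where M: "\<forall>p. \<forall>w\<in>S. \<bar>f w $ p\<bar> \<le> M p" by metis
  have "norm (f w) \<le> (\<Sum>p\<in>UNIV. M p)" if "w \<in> S" for w
    by (rule order_trans[OF norm_le_l1_cart]) (use M that in \<open>auto intro: sum_mono\<close>)
  moreover have "ball z (norm z / 2) \<subseteq> S" by (auto simp: S_def)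
  ultimately have "\<forall>w\<in>ball z (norm z / 2). norm (f w) \<le> (\<Sum>p\<in>UNIV. M p)" by blast
  with assms show ?thesis by (intro exI[of _ "norm z / 2"]) auto
qed

lemma essential_bound_nbhd:
  assumes "open U" "z \<in> U" "\<And>w. w \<in> U \<Longrightarrow> p \<bullet> f w \<le> c"
  shows "essential_bound f z p c"
proof -
  obtain e where "0 < e" "ball z e \<subseteq> U" using openE[OF assms(1,2)] .
  then show ?thesis
    unfolding essential_bound_def using assms(3) by (intro exI[of _ e] conjI exI[of _ "{}"]) auto
qed

text \<open>Rows of the block other than the last contain no input and depend continuously on the
  state, so regularisation adds nothing: two opposite half-spaces squeeze the component of
  \<open>v\<close>.\<close>

lemma blk_filippov_nth:
  assumes v: "v \<in> filippov f z" and p: "deg p \<noteq> 0"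
  shows "blk v $ p = (superdiag pos *v blk z) $ p"
proof -
  let ?g = "\<lambda>z. (superdiag pos *v blk z) $ p"
  let ?e = "axis (coord i (pos p)) 1 :: real ^ 'n"
  have g: "?e \<bullet> f w = ?g w" for w
    using p by (simp add: blk_nth[symmetric] blk_f last_unit_nth)
  have cont: "continuous_on UNIV ?g"
    using bounded_linear.continuous_on[OF matrix_vector_mul_bounded_linear continuous_on_blk]
    by (intro continuous_intros)
  have "\<bar>?e \<bullet> v - ?g z\<bar> \<le> 0"
  proof (rule field_le_epsilon)
    fix \<epsilon> :: real assume "0 < \<epsilon>"
    let ?U = "{w. \<bar>?g w - ?g z\<bar> < \<epsilon>}"
    have U: "open ?U" "z \<in> ?U"
      using cont \<open>0 < \<epsilon>\<close> by (auto intro!: open_Collect_less continuous_intros)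
    have "?e \<bullet> v \<le> ?g z + \<epsilon>"
      by (rule filippov_le[OF essential_bound_nbhd[OF U] v]) (auto simp: g)
    moreover have "(- ?e) \<bullet> v \<le> - ?g z + \<epsilon>"
      by (rule filippov_le[OF essential_bound_nbhd[OF U] v]) (auto simp: g)
    ultimately show "\<bar>?e \<bullet> v - ?g z\<bar> \<le> 0 + \<epsilon>" by (simp add: abs_le_iff)
  qed
  then show ?thesis by (simp add: blk_nth)
qed

text \<open>A Filippov velocity of the block is again drift plus a scalar input. Where the switching
  function is nonzero its sign is locally constant, so the scalar inherits the bound there; on the
  switching surface it is left free, as \<open>decay\<close> permits.\<close>

lemma blk_filippov:
  assumes v: "v \<in> filippov f z" and z: "blk z \<noteq> 0"
  shows "\<exists>h. blk v = superdiag pos *v blk z + h *\<^sub>R last_unit pos \<and>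
    (0 < switching_fun pos a0 (blk z) \<longrightarrow> h \<le> - d) \<and> (switching_fun pos a0 (blk z) < 0 \<longrightarrow> d \<le> h)"
proof -
  obtain q where q: "deg q = 0" using ex_deg[of 0] by auto
  let ?e = "axis (coord i (pos q)) 1 :: real ^ 'n"
  have row: "(superdiag pos *v x) $ q = 0" for x
    by (simp add: matrix_vector_mult_def superdiag_nth q)
  have eH: "?e \<bullet> f w = H i w (u w)" for w
    by (simp add: blk_nth[symmetric] blk_f row last_unit_nth q)
  define h where "h = ?e \<bullet> v"
  let ?s = "\<lambda>w. switching_fun pos a0 (blk w)"
  let ?U = "{w. blk w \<noteq> 0}"
  have U: "open ?U" by (intro open_Collect_neq continuous_on_blk continuous_intros)
  have cont: "continuous_on ?U ?s"
    using isCont_o2[OF linear_continuous_at[OF bounded_linear_block] isCont_switching_fun[OF _ a0]]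
    by (intro continuous_at_imp_continuous_on) auto
  have nz: "w \<noteq> 0" if "blk w \<noteq> 0" for w using that blk_0 by auto
  have "blk v $ p = (superdiag pos *v blk z + h *\<^sub>R last_unit pos) $ p" for p
  proof (cases "deg p = 0")
    case True
    then have "p = q" using deg_eq_iff[of p q] q by simp
    then show ?thesis by (simp add: row last_unit_nth q h_def blk_nth)
  next
    case False
    then show ?thesis using blk_filippov_nth[OF v False] by (simp add: last_unit_nth)
  qed
  then have "blk v = superdiag pos *v blk z + h *\<^sub>R last_unit pos"
    unfolding vec_eq_iff by blast
  moreover have "h \<le> - d" if "0 < ?s z"
    unfolding h_def
  proof (rule filippov_le[OF essential_bound_nbhd v])
    show "open {w \<in> ?U. 0 < ?s w}"
      using continuous_open_preimage[OF cont U, of "{0<..}"] by (simp add: vimage_def Int_def conj_commute)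
    fix w assume "w \<in> {w \<in> ?U. 0 < ?s w}"
    then show "?e \<bullet> f w \<le> - d" unfolding eH using H_minus[OF nz] u_minus[of w] by simp
  qed (use that z in simp)
  moreover have "d \<le> h" if "?s z < 0"
  proof -
    have "(- ?e) \<bullet> v \<le> - d"
    proof (rule filippov_le[OF essential_bound_nbhd v])
      show "open {w \<in> ?U. ?s w < 0}"
        using continuous_open_preimage[OF cont U, of "{..<0}"] by (simp add: vimage_def Int_def conj_commute)
      fix w assume "w \<in> {w \<in> ?U. ?s w < 0}"
      then show "(- ?e) \<bullet> f w \<le> - d"
        unfolding inner_minus_left eH using H_plus[OF nz] u_plus[of w] by simp
    qed (use that z in simp)
    then show ?thesis by (simp add: h_def)
  qed
  ultimately show ?thesis by blast
qed

lemma Theta_decreases: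
  assumes x: "filippov_solution f \<tau> x" and nz: "\<And>t. t \<in> {0..<\<tau>} \<Longrightarrow> blk (x t) \<noteq> 0"
    and t: "0 \<le> t" "t < \<tau>"
  shows "\<Theta> (x t) \<le> \<Theta> (x 0) - t"
proof -
  obtain v where v: "\<forall>t\<in>{0..<\<tau>}. v absolutely_integrable_on {0..t} \<and> x t = x 0 + integral {0..t} v"
    and AE: "AE t in lebesgue. t \<in> {0..<\<tau>} \<longrightarrow> v t \<in> filippov f (x t)"
    using x unfolding filippov_solution_def by blast
  show ?thesis
  proof (rule controllability_fun_decreases[OF a0 d a0_le _ nz _ t, where v = "\<lambda>t. blk (v t)"])
    fix s assume s: "s \<in> {0..<\<tau>}"
    have int: "v absolutely_integrable_on {0..s}" and xs: "x s = x 0 + integral {0..s} v"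
      using v s by blast+
    have "(\<lambda>t. blk (v t)) absolutely_integrable_on {0..s}"
      using absolutely_integrable_linear[OF int bounded_linear_block] by (simp add: o_def)
    moreover have "blk (x s) = blk (x 0) + integral {0..s} (\<lambda>t. blk (v t))"
    proof -
      have "blk (x s) = blk (x 0) + blk (integral {0..s} v)"
        by (simp only: xs linear_simps(1)[OF bounded_linear_block])
      also have "blk (integral {0..s} v) = integral {0..s} (blk \<circ> v)"
        using int unfolding absolutely_integrable_on_def
        by (intro integral_linear[OF _ bounded_linear_block, symmetric]) blast
      finally show ?thesis by (simp only: o_def)
    qed
    ultimately show "(\<lambda>t. blk (v t)) absolutely_integrable_on {0..s} \<and>
        blk (x s) = blk (x 0) + integral {0..s} (\<lambda>t. blk (v t))" ..
  next
    show "AE t in lebesgue. t \<in> {0..<\<tau>} \<longrightarrow> (\<exists>h. blk (v t) = superdiag pos *v blk (x t) + h *\<^sub>R last_unit pos \<and>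
      (0 < switching_fun pos a0 (blk (x t)) \<longrightarrow> h \<le> - d) \<and> (switching_fun pos a0 (blk (x t)) < 0 \<longrightarrow> d \<le> h))"
      using AE by eventually_elim (use blk_filippov nz in blast)
  qed
qed

lemma Theta_0: "blk z = 0 \<Longrightarrow> \<Theta> z = 0"
  by (simp add: controllability_fun_def)

text \<open>If the target were missed, the controllability function would be at most
  \<open>\<Theta> (x 0) - t\<close> before the final time; by continuity it would be at most 0 at
  the final point, where it has to be positive.\<close>

lemma trajectory_reaches_target:
  assumes x: "filippov_trajectory f (\<Theta> (x 0)) x"
  shows "\<exists>T. 0 \<le> T \<and> T \<le> \<Theta> (x 0) \<and> blk (x T) = 0"
proof (rule ccontr)
  assume neg: "\<not> ?thesis"
  let ?T = "\<Theta> (x 0)"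
  have nz: "blk (x t) \<noteq> 0" if "0 \<le> t" "t \<le> ?T" for t using neg that by blast
  \<comment> \<open>\<open>nz\<close> at time 0 is available only for nonnegative \<open>?T\<close>.
    Otherwise \<open>?T\<close> is nonzero, which by \<open>Theta_0\<close> also means that the
    start is off the target.\<close>
  have "?T \<noteq> 0 \<or> blk (x 0) \<noteq> 0" using nz[of 0] by auto
  then have T: "0 < ?T"
    using Theta_0[of "x 0"] controllability_fun_pos[OF _ a0, of "blk (x 0)"] by blast
  have sol: "filippov_solution f ?T x" and cont: "continuous_on {0..?T} x"
    using x unfolding filippov_trajectory_def by auto
  have "(x \<longlongrightarrow> x ?T) (at_left ?T)"
    using continuous_on_Icc_at_leftD[OF cont T] .
  then have "((\<lambda>t. blk (x t)) \<longlongrightarrow> blk (x ?T)) (at_left ?T)"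
    by (rule bounded_linear.tendsto[OF bounded_linear_block])
  then have "((\<lambda>t. \<Theta> (x t)) \<longlongrightarrow> \<Theta> (x ?T)) (at_left ?T)"
    using T nz[of ?T] by (intro isCont_tendsto_compose[OF isCont_controllability_fun[OF _ a0]]) auto
  moreover have "((\<lambda>t. ?T - t) \<longlongrightarrow> ?T - ?T) (at_left ?T)"
    by (intro tendsto_intros)
  moreover have "\<forall>\<^sub>F t in at_left ?T. \<Theta> (x t) \<le> ?T - t"
    unfolding eventually_at_left_field
    using T Theta_decreases[OF sol] nz by (intro exI[of _ 0]) auto
  ultimately have "\<Theta> (x ?T) \<le> ?T - ?T"
    by (intro tendsto_le[of "at_left ?T"]) auto
  with controllability_fun_pos[OF nz[of ?T] a0] T show False by simp
qed

lemma ex_trajectory_reaching_target: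
  assumes esc: "no_escape_off_target f blk z0"
  shows "\<exists>T x. 0 \<le> T \<and> T \<le> \<Theta> z0 \<and> filippov_trajectory f T x \<and> x 0 = z0 \<and> blk (x T) = 0"
proof (cases "blk z0 = 0")
  case True
  have "filippov_trajectory f 0 (\<lambda>_. z0)"
    unfolding filippov_trajectory_def filippov_solution_def by auto
  with True Theta_0[OF True] show ?thesis by (intro exI[of _ 0] exI[of _ "\<lambda>_. z0"]) auto
next
  case False
  let ?U = "{z. blk z \<noteq> 0}"
  have U: "open ?U" by (intro open_Collect_neq continuous_on_blk continuous_intros)
  have bd: "\<exists>\<delta>>0. \<exists>M. \<forall>w\<in>ball z \<delta>. norm (f w) \<le> M" if "z \<in> ?U" for z
    using that blk_0 by (intro f_locally_bounded) auto
  \<comment> \<open>At the time \<open>\<Theta> z0\<close> a solution that is still off the target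
    would have a controllability function at most 0, against its positivity.\<close>
  have time: "\<tau> \<le> \<Theta> z0" if x: "slope_solution f \<tau> x" "x 0 = z0" "\<forall>t\<in>{0..<\<tau>}. x t \<in> ?U" for \<tau> x
  proof (rule ccontr)
    assume "\<not> \<tau> \<le> \<Theta> z0"
    then have less: "\<Theta> z0 < \<tau>" by simp
    have pos: "0 < \<Theta> z0" by (rule controllability_fun_pos[OF False a0])
    have "\<Theta> (x (\<Theta> z0)) \<le> \<Theta> (x 0) - \<Theta> z0"
      using x(3) pos less
      by (intro Theta_decreases[OF slope_solution_imp_filippov_solution[OF x(1)]]) auto
    moreover have "0 < \<Theta> (x (\<Theta> z0))"
      using x(3) pos less by (intro controllability_fun_pos a0) auto
    ultimately show False using x(2) by simp
  qed
  have "\<exists>\<tau> x. 0 < \<tau> \<and> slope_solution f \<tau> x \<and> x 0 = z0 \<and> (\<forall>t\<in>{0..<\<tau>}. x t \<in> ?U) \<and>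
      (\<forall>z. (x \<longlongrightarrow> z) (at_left \<tau>) \<longrightarrow> z \<notin> ?U)"
    by (rule maximal_slope_solution[OF U _ bd time]) (use False in auto)
  then obtain \<tau> x where \<tau>: "0 < \<tau>" and x: "slope_solution f \<tau> x" "x 0 = z0"
    and xU: "\<forall>t\<in>{0..<\<tau>}. x t \<in> ?U" and max: "\<forall>z. (x \<longlongrightarrow> z) (at_left \<tau>) \<longrightarrow> z \<notin> ?U"
    by blast
  have sol: "filippov_solution f \<tau> x" by (rule slope_solution_imp_filippov_solution[OF x(1)])
  have "bounded (x ` {0..<\<tau>})"
    using esc sol x(2) xU unfolding no_escape_off_target_def by blast
  then obtain z where lim: "(x \<longlongrightarrow> z) (at_left \<tau>)"
    using bounded_slope_solution_converges[OF x(1) \<tau> _ f_locally_bounded] by blast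
  \<comment> \<open>Redefining the curve from \<tau> on leaves it a solution on
    \<open>[0, \<tau>)\<close>, and the limit as value at \<tau> makes it continuous on the closed
    interval.\<close>
  define X where "X t = (if t < \<tau> then x t else z)" for t
  have "filippov_solution f \<tau> X"
    by (rule filippov_solution_cong[OF sol]) (simp add: X_def)
  moreover have "continuous_on {0..\<tau>} X"
    unfolding continuous_on_def
  proof
    fix t assume t: "t \<in> {0..\<tau>}"
    show "(X \<longlongrightarrow> X t) (at t within {0..\<tau>})"
    proof (cases "t = \<tau>")
      case True
      have "\<forall>\<^sub>F s in at_left \<tau>. x s = X s"
        unfolding eventually_at_left_field by (intro exI[of _ 0]) (auto simp: X_def \<tau>)
      then have "(X \<longlongrightarrow> z) (at_left \<tau>)"
        by (rule Lim_transform_eventually[OF lim])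
      with True \<tau> show ?thesis by (simp add: X_def at_within_Icc_at_left)
    next
      case False
      then have t': "t \<in> {0..<\<tau>}" using t by auto
      have "(x \<longlongrightarrow> x t) (at t within {0..<\<tau>})"
        using slope_solution_continuous_on[OF x(1)] t' by (simp add: continuous_on_def)
      moreover have "\<forall>\<^sub>F s in at t within {0..<\<tau>}. x s = X s"
        unfolding eventually_at by (intro exI[of _ 1]) (auto simp: X_def)
      ultimately have "(X \<longlongrightarrow> x t) (at t within {0..<\<tau>})"
        by (rule Lim_transform_eventually)
      moreover have "at t within {0..<\<tau>} = at t within {0..\<tau>}"
        by (rule at_within_nhd[of _ "{..<\<tau>}"]) (use t' in auto)
      ultimately show ?thesis using t' by (simp add: X_def)
    qed
  qed
  ultimately have "filippov_trajectory f \<tau> X" unfolding filippov_trajectory_def ..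
  moreover have "blk (X \<tau>) = 0" using max lim by (simp add: X_def)
  moreover have "\<tau> \<le> \<Theta> z0" by (rule time[OF x xU])
  ultimately show ?thesis using \<tau> x(2) by (intro exI[of _ \<tau>] exI[of _ X]) (auto simp: X_def)
qed

end

text \<open>Filippov solutions need not be unique, so the transfer is expressed in two ways: through
  a trajectory that ends in the target, and through all trajectories that last until
  \<open>\<Theta> z0\<close>.\<close>

theorem theorem3p2:
  fixes m i :: nat and ns :: "nat \<Rightarrow> nat"
    and coord :: "nat \<Rightarrow> nat \<Rightarrow> 'n::finite" and pos :: "'k::finite \<Rightarrow> nat"
    and H :: "nat \<Rightarrow> real ^ 'n \<Rightarrow> real \<Rightarrow> real"
    and a0 d :: real
    and uplus uminus u :: "real ^ 'n \<Rightarrow> real"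
  assumes "2 \<le> m" and "m \<le> CARD('n)"
    and "\<And>j. j \<in> {1..m} \<Longrightarrow> 1 \<le> ns j"
    and "bij_betw (\<lambda>(j, k). coord j k) (block_indices m ns) (UNIV :: 'n set)"
    and "\<And>j. j \<in> {1..m} \<Longrightarrow> continuously_differentiable (\<lambda>(z, w). H j z w)"
    and "\<And>j. j \<in> {1..m} \<Longrightarrow> H j 0 0 = 0"
    and "i \<in> {1..m}"
    and "bij_betw pos (UNIV :: 'k set) {1..ns i}"
    and "0 < d"
    and "0 < a0" and "a0 \<le> 2 * d\<^sup>2 / ((matrix_inv (gram pos 1) *v last_unit pos) \<bullet> last_unit pos)"
    and "lipschitz_on_annuli uplus" and "lipschitz_on_annuli uminus"
    and "\<And>z. z \<noteq> 0 \<Longrightarrow> d \<le> H i z (uplus z)"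
    and "\<And>z. z \<noteq> 0 \<Longrightarrow> H i z (uminus z) \<le> - d"
    and "\<And>z. 0 < switching_fun pos a0 (block coord pos i z) \<Longrightarrow> u z = uminus z"
    and "\<And>z. switching_fun pos a0 (block coord pos i z) < 0 \<Longrightarrow> u z = uplus z"
    and "\<And>z. switching_fun pos a0 (block coord pos i z) = 0 \<Longrightarrow>
              u z \<in> closed_segment (uminus z) (uplus z)"
  defines "\<Theta> \<equiv> \<lambda>z. controllability_fun pos a0 (block coord pos i z)"
    and "f \<equiv> \<lambda>z. system_rhs m ns coord H z (u z)"
  shows "\<forall>z0.
      (no_escape_off_target f (block coord pos i) z0 \<longrightarrow>
        (\<exists>T x. 0 \<le> T \<and> T \<le> \<Theta> z0 \<and> filippov_trajectory f T x \<and> x 0 = z0 \<and>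
               block coord pos i (x T) = 0)) \<and>
      (\<forall>x. filippov_trajectory f (\<Theta> z0) x \<and> x 0 = z0 \<longrightarrow>
        (\<exists>T. 0 \<le> T \<and> T \<le> \<Theta> z0 \<and> block coord pos i (x T) = 0))"
proof -
  have "ns i = CARD('k)"
    using bij_betw_same_card[OF assms(8)] by simp
  with assms(8) have "chain pos"
    by unfold_locales simp
  then interpret closed_loop pos m i ns coord H a0 d uplus uminus u
    unfolding closed_loop_def by (intro conjI closed_loop_axioms.intro assms(4-18))
  show ?thesis
    unfolding \<Theta>_def f_def using ex_trajectory_reaching_target trajectory_reaches_target by blast
qed

end
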